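(* Let $n\in\mathbb{N}$, $n\geq 2$, and let $\Omega\subset\mathbb{C}$ be a domain satisfying $\#(\mathbb{C}\setminus\Omega)\geq 2n$. Let $\Psi:S_n(\Omega)\to S_n(\Omega)$ be a holomorphic map such that $\Psi(A)=A$ and $\Psi'(A)=\mathbb{I}$ for some $A\in S_n(\Omega)$. Assume that the matrix $A$ is either diagonalizable or non-derogatory. Then there exists a neighbourhood $\mathcal{N}$ of $A$ (in $S_n(\Omega)$) such that $\Psi(W)$ is conjugate to $W$ for every $W\in\mathcal{N}$.
   Context: $M_n(\mathbb{C})\equiv\mathbb{C}^{n^2}$ is the set of all $n\times n$ complex matrices and $\sigma(W)$ is the set of eigenvalues of $W$. For a domain $\Omega\subset\mathbb{C}$, $S_n(\Omega):=\{W\in M_n(\mathbb{C}):\sigma(W)\subset\Omega\}$, an open connected subset of $M_n(\mathbb{C})$. $\Psi'(A)$ is the complex derivative of $\Psi$ at $A$, a linear map on $M_n(\mathbb{C})$, and $\mathbb{I}$ denotes the identity. A matrix is non-derogatory if its characteristic polynomial and its minimal polynomial coincide. Two matrices $X,Y\in M_n(\mathbb{C})$ are conjugate if $Y=SXS^{-1}$ for some invertible $S\in M_n(\mathbb{C})$. $\#$ denotes cardinality (possibly infinite). *)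

theory Defs
  imports "HOL-Analysis.Analysis" "HOL-Computational_Algebra.Polynomial"
begin

text \<open>
  The space of $n \times n$ complex matrices is the type \<open>complex^'n^'n\<close> with
  \<open>n = CARD('n)\<close>.  Beware that \<open>*\<close> and \<open>^\<close> act entrywise on this type; the matrix product
  is \<open>**\<close>.
\<close>

definition mat_scale :: "complex \<Rightarrow> complex^'n^'n \<Rightarrow> complex^'n^'n" where
  "mat_scale c X = map_matrix (\<lambda>x. c * x) X"

definition domain_in_plane :: "complex set \<Rightarrow> bool" where
  "domain_in_plane \<Omega> \<longleftrightarrow> open \<Omega> \<and> connected \<Omega> \<and> \<Omega> \<noteq> {}"

definition spectrum :: "complex^'n^'n \<Rightarrow> complex set" where
  "spectrum W = {\<mu>. \<exists>v. v \<noteq> 0 \<and> W *v v = \<mu> *s v}"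

definition S_n :: "complex set \<Rightarrow> (complex^'n^'n) set" where
  "S_n \<Omega> = {W. spectrum W \<subseteq> \<Omega>}"

text \<open>
  The space of matrices is only a real normed space for the library, so complex
  differentiability is real Frechet differentiability with a complex-linear derivative.
  The derivative is taken at \<open>W\<close> and not within \<open>U\<close>, so \<open>U\<close> should be open.
\<close>

definition mat_holomorphic_on ::
  "(complex^'n^'n \<Rightarrow> complex^'n^'n) \<Rightarrow> (complex^'n^'n) set \<Rightarrow> bool" where
  "mat_holomorphic_on F U \<longleftrightarrow>
     (\<forall>W\<in>U. \<exists>L. Vector_Spaces.linear mat_scale mat_scale L \<and> (F has_derivative L) (at W))"

definition conjugate_mat :: "complex^'n^'n \<Rightarrow> complex^'n^'n \<Rightarrow> bool" where
  "conjugate_mat X Y \<longleftrightarrow> (\<exists>S. invertible S \<and> Y = S ** X ** matrix_inv S)"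

definition diagonalizable_mat :: "complex^'n^'n \<Rightarrow> bool" where
  "diagonalizable_mat A \<longleftrightarrow>
     (\<exists>D. (\<forall>i j. i \<noteq> j \<longrightarrow> D $ i $ j = 0) \<and> conjugate_mat A D)"

text \<open>The determinant of $X I - W$ over the ring of complex polynomials in $X$.\<close>

definition charpoly :: "complex^'n^'n \<Rightarrow> complex poly" where
  "charpoly W = det (mat [:0, 1:] - map_matrix (\<lambda>x. [:x:]) W)"

primrec mat_power :: "complex^'n^'n \<Rightarrow> nat \<Rightarrow> complex^'n^'n" where
  "mat_power W 0 = mat 1"
| "mat_power W (Suc k) = W ** mat_power W k"

definition poly_mat :: "complex poly \<Rightarrow> complex^'n^'n \<Rightarrow> complex^'n^'n" where
  "poly_mat p W = (\<Sum>i\<le>degree p. mat_scale (coeff p i) (mat_power W i))"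

definition is_minpoly :: "complex^'n^'n \<Rightarrow> complex poly \<Rightarrow> bool" where
  "is_minpoly W p \<longleftrightarrow> lead_coeff p = 1 \<and> poly_mat p W = 0 \<and>
     (\<forall>q. q \<noteq> 0 \<and> poly_mat q W = 0 \<longrightarrow> degree p \<le> degree q)"

definition minpoly :: "complex^'n^'n \<Rightarrow> complex poly" where
  "minpoly W = (THE p. is_minpoly W p)"

definition nonderogatory :: "complex^'n^'n \<Rightarrow> bool" where
  "nonderogatory W \<longleftrightarrow> charpoly W = minpoly W"

text \<open>The definite description in \<open>minpoly\<close> is justified by \<open>ex1_minpoly\<close> below.\<close>

lemma mat_scale_component [simp]: "mat_scale c X $ i $ j = c * X $ i $ j"
  by (simp add: mat_scale_def map_matrix_def)

lemma vector_space_mat_scale: "vector_space (mat_scale :: complex \<Rightarrow> complex^'n^'n \<Rightarrow> _)"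
  by unfold_locales (simp_all add: vec_eq_iff algebra_simps)

lemma poly_mat_eq_sum:
  assumes "degree p \<le> N"
  shows "poly_mat p W = (\<Sum>i\<le>N. mat_scale (coeff p i) (mat_power W i))"
  unfolding poly_mat_def using assms
  by (intro sum.mono_neutral_left) (auto simp: coeff_eq_0 vec_eq_iff)

lemma poly_mat_diff: "poly_mat (p - q) W = poly_mat p W - poly_mat q W"
proof -
  define N where "N = max (degree p) (degree q)"
  have "degree (p - q) \<le> N" "degree p \<le> N" "degree q \<le> N"
    by (auto simp: N_def degree_diff_le_max)
  then show ?thesis
    by (simp add: poly_mat_eq_sum[where N = N] vec_eq_iff sum_subtractf algebra_simps)
qed

lemma poly_mat_smult: "poly_mat (smult c p) W = mat_scale c (poly_mat p W)"
  by (cases "c = 0")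
     (simp_all add: poly_mat_def vec_eq_iff sum_distrib_left mult.assoc)

lemma poly_mat_monom: "poly_mat (monom 1 k) W = mat_power W k"
proof -
  have "poly_mat (monom 1 k) W = (\<Sum>i\<le>k. mat_scale (if i = k then 1 else 0) (mat_power W i))"
    by (subst poly_mat_eq_sum[where N = k]) (auto simp: degree_monom_le intro!: sum.cong)
  also have "\<dots> = (\<Sum>i\<le>k. if i = k then mat_power W i else 0)"
    by (intro sum.cong) (auto simp: vec_eq_iff)
  finally show ?thesis by simp
qed

lemma ex_annihilating_poly: "\<exists>q. q \<noteq> 0 \<and> poly_mat q (W :: complex^'n^'n) = 0"
proof (cases "inj (mat_power W)")
  case False
  then obtain i j where ij: "i \<noteq> j" "mat_power W i = mat_power W j"
    by (auto simp: inj_def)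
  define q :: "complex poly" where "q = monom 1 i - monom 1 j"
  have "q \<noteq> 0" using ij(1) by (simp add: q_def monom_eq_iff')
  moreover have "poly_mat q W = 0"
    by (simp add: q_def poly_mat_diff poly_mat_monom ij(2))
  ultimately show ?thesis by blast
next
  case True
  have "infinite (range (mat_power W))"
    using True finite_imageD by blast
  then have "dependent (range (mat_power W))"
    using independent_imp_finite by blast
  then obtain t u v where t: "finite t" "t \<subseteq> range (mat_power W)"
    and u: "(\<Sum>v\<in>t. u v *\<^sub>R v) = 0" and v: "v \<in> t" "u v \<noteq> 0"
    unfolding dependent_explicit by blast
  define J where "J = mat_power W -` t"
  have finJ: "finite J" using t(1) True by (simp add: J_def finite_vimageI)
  have imJ: "mat_power W ` J = t" using t(2) by (auto simp: J_def)
  define N where "N = Max (insert 0 J)"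
  have JN: "J \<subseteq> {..N}" using finJ by (auto simp: N_def)
  define c where "c i = (if i \<in> J then complex_of_real (u (mat_power W i)) else 0)" for i
  define q where "q = (\<Sum>i\<le>N. monom (c i) i)"
  have coeff_q: "coeff q i = c i" for i
    using JN by (auto simp: q_def coeff_sum c_def)
  obtain k where k: "k \<in> J" "mat_power W k = v" using imJ v(1) by blast
  have "coeff q k \<noteq> 0" using k v(2) by (simp add: coeff_q c_def)
  then have "q \<noteq> 0" by auto
  have "degree q \<le> N"
    using JN by (intro degree_le) (auto simp: coeff_q c_def)
  then have "poly_mat q W = (\<Sum>i\<le>N. mat_scale (c i) (mat_power W i))"
    by (simp add: poly_mat_eq_sum coeff_q)
  also have "\<dots> = (\<Sum>i\<in>J. mat_scale (c i) (mat_power W i))"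
    using JN by (intro sum.mono_neutral_right) (auto simp: c_def vec_eq_iff)
  also have "\<dots> = (\<Sum>i\<in>J. u (mat_power W i) *\<^sub>R mat_power W i)"
    by (intro sum.cong) (auto simp: c_def vec_eq_iff scaleR_conv_of_real[where 'a = complex])
  also have "\<dots> = (\<Sum>v\<in>t. u v *\<^sub>R v)"
    unfolding imJ[symmetric]
    by (subst sum.reindex) (use True in \<open>auto intro: inj_on_subset\<close>)
  finally show ?thesis using u \<open>q \<noteq> 0\<close> by auto
qed

lemma ex1_minpoly: "\<exists>!p. is_minpoly W p"
proof -
  obtain q where q: "q \<noteq> 0" "poly_mat q W = 0"
    and min: "\<And>r. r \<noteq> 0 \<and> poly_mat r W = 0 \<Longrightarrow> degree q \<le> degree r"
    using ex_annihilating_poly[of W]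
      exists_least_iff[of "\<lambda>d. \<exists>q. (q \<noteq> 0 \<and> poly_mat q W = 0) \<and> degree q = d"]
    by (metis not_less)
  have "is_minpoly W (smult (inverse (lead_coeff q)) q)"
    using q min by (simp add: is_minpoly_def poly_mat_smult vec_eq_iff)
  moreover have "p = r" if p: "is_minpoly W p" and r: "is_minpoly W r" for p r
  proof (rule ccontr)
    assume "p \<noteq> r"
    have deg: "degree p = degree r"
    proof -
      have "p \<noteq> 0" "r \<noteq> 0" using p r by (auto simp: is_minpoly_def)
      then show ?thesis
        using p r unfolding is_minpoly_def by (meson le_antisym)
    qed
    have "poly_mat (p - r) W = 0"
      using p r by (simp add: is_minpoly_def poly_mat_diff)
    then have "degree p \<le> degree (p - r)"
      using p \<open>p \<noteq> r\<close> by (simp add: is_minpoly_def)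
    moreover have "degree (p - r) \<le> degree p"
      by (simp add: deg degree_diff_le)
    ultimately have "degree (p - r) = degree p" by simp
    then have "lead_coeff (p - r) = 0"
      using p r deg by (simp add: is_minpoly_def)
    then have "p - r = 0" by (simp only: leading_coeff_0_iff)
    then show False using \<open>p \<noteq> r\<close> by simp
  qed
  ultimately show ?thesis by blast
qed

lemma is_minpoly_minpoly: "is_minpoly W (minpoly W)"
  unfolding minpoly_def by (rule theI') (rule ex1_minpoly)

end

theory Submission
  imports Defs "HOL-Complex_Analysis.Complex_Analysis" "HOL-Combinatorics.Permutations"
    "Jordan_Normal_Form.Jordan_Normal_Form_Existence"
begin

text \<open>
A matrix belongs to \<open>S_n \<Omega>\<close> if and only if its characteristic polynomial has no zeros outside
\<open>\<Omega>\<close>. The proof first shows that \<open>\<Psi>\<close> preserves the characteristic polynomial near \<open>A\<close>, and then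
upgrades this to conjugacy. Write \<open>n\<close> for the size of the matrices.

Boundedness. Along a holomorphic disc in \<open>S_n \<Omega>\<close>, the values of the characteristic polynomial at
\<open>2 * n\<close> points outside \<open>\<Omega>\<close> never vanish. Join to them the constant 1, the leading coefficient. By
Lagrange interpolation any \<open>n + 1\<close> of these \<open>2 * n + 1\<close> functions bound all of them, so at each point
a strict majority is comparable with the largest. Families of this kind obey a theorem of Schottky
type, \<open>nonvanishing_majority_family_bounded\<close>: initial values bound the functions on a smaller disc.
For its proof let \<open>q i\<close> be logarithms of the functions. The Laplacian of \<open>ln (\<Sum>i. exp (2 * Re (q i)))\<close>
is four times a variance of the derivatives. Where the variance is bounded, mean value
inequalities bound the \<open>q i\<close>. Where it is not, a rescaling leads in the limit to polynomials of
degree at most two with variance 1 at the origin, such that at each point a strict majority is maximal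
up to a constant. Two strict majorities meet, so some member is maximal in a direction and in the
opposite one; this forces equal linear coefficients and variance 0, a contradiction.

Invariance. All iterates of \<open>\<Psi>\<close> map discs through \<open>A\<close> into \<open>S_n \<Omega>\<close>, and the characteristic
polynomial is bounded on their images, independently of the iterate. The iterates are tangent to the
identity at \<open>A\<close>. As in Cartan's uniqueness theorem, the lowest order term of the change of the
characteristic polynomial would grow linearly with the number of iterations. Hence there is no
change, \<open>charpoly_preserved_near_fixed_point\<close>.

Conjugacy. Near \<open>A\<close> the map \<open>\<Psi>\<close> is bi-Lipschitz, and open by invariance of domain. A perturbation
of size \<open>s\<^sup>2\<close> can move an eigenvalue of a matrix that is not diagonalizable by \<open>s\<close>, but eigenvalues of
a diagonalizable matrix move at most linearly. So a bi-Lipschitz map that preserves characteristic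
polynomials preserves diagonalizability, and a diagonalizable matrix is conjugate to its image. An
arbitrary \<open>W\<close> is a limit of diagonalizable matrices that split each Jordan block along its flag.
Comparing kernels in the limit, \<open>level_count_le\<close>, for \<open>\<Psi>\<close> and for its inverse, shows that \<open>W\<close> and
\<open>\<Psi> W\<close> have Jordan blocks of the same sizes.
\<close>

unbundle no fps_syntax
no_notation Matrix.vec_index (infixl "$" 100)
hide_const (open) Determinant.det Matrix.mat Matrix.row Matrix.vec Matrix.transpose_mat
hide_fact (open) Determinant.det_def Matrix.mat_def Matrix.row_def Matrix.vec_eq_iff

section \<open>The logarithm of a sum of exponentials\<close>

definition expsum :: "'i set \<Rightarrow> ('i \<Rightarrow> complex \<Rightarrow> complex) \<Rightarrow> complex \<Rightarrow> real" where
  "expsum I q z = (\<Sum>i\<in>I. exp (2 * Re (q i z)))"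

text \<open>
Give the \<open>i\<close>-th member of a finite family the weight \<open>exp (2 * Re (q i z))\<close>, divided by the
total \<open>expsum I q z\<close>. Then \<open>wmean\<close> and \<open>wvar\<close> are the mean and the variance of the derivatives
\<open>deriv (q i) z\<close>. The potential \<open>ln (expsum I q z)\<close> has the derivative \<open>2 * Re (wmean I q z * w)\<close>
in the direction \<open>w\<close>, and its Laplacian is four times \<open>wvar\<close>. The variance does not change when one holomorphic function is
added to all members, which is what makes it the right quantity to rescale by.
\<close>

definition wmean :: "'i set \<Rightarrow> ('i \<Rightarrow> complex \<Rightarrow> complex) \<Rightarrow> complex \<Rightarrow> complex" where
  "wmean I q z = (\<Sum>i\<in>I. of_real (exp (2 * Re (q i z))) * deriv (q i) z) / of_real (expsum I q z)"

definition wvar :: "'i set \<Rightarrow> ('i \<Rightarrow> complex \<Rightarrow> complex) \<Rightarrow> complex \<Rightarrow> real" where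
  "wvar I q z = (\<Sum>i\<in>I. exp (2 * Re (q i z)) * (cmod (deriv (q i) z))\<^sup>2) / expsum I q z
                 - (cmod (wmean I q z))\<^sup>2"

lemma expsum_pos: "finite I \<Longrightarrow> I \<noteq> {} \<Longrightarrow> 0 < expsum I q z"
  unfolding expsum_def by (intro sum_pos) auto

lemma exp_le_expsum: "finite I \<Longrightarrow> i \<in> I \<Longrightarrow> exp (2 * Re (q i z)) \<le> expsum I q z"
  unfolding expsum_def by (intro member_le_sum) auto

text \<open>
The derivative of \<open>wmean I q\<close> at \<open>z\<close> in the direction \<open>w\<close>, as the quotient rule gives it.
\<close>

definition wmean_dir :: "'i set \<Rightarrow> ('i \<Rightarrow> complex \<Rightarrow> complex) \<Rightarrow> complex \<Rightarrow> complex \<Rightarrow> complex" where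
  "wmean_dir I q z w =
     (\<Sum>i\<in>I. of_real (exp (2 * Re (q i z))) *
        (of_real (2 * Re (deriv (q i) z * w)) * deriv (q i) z + deriv (deriv (q i)) z * w))
       / of_real (expsum I q z)
     - wmean I q z * of_real (2 * Re (wmean I q z * w))"

text \<open>
The left side is, up to a factor, the Cauchy-Riemann operator applied to \<open>wmean I q\<close>. The
holomorphic parts \<open>deriv (deriv (q i))\<close> cancel and the squared weights leave the variance. This
is the formula for the Laplacian of \<open>ln (expsum I q z)\<close>.
\<close>

lemma wmean_dir_cauchy_riemann:
  assumes "finite I" "I \<noteq> {}"
  shows "wmean_dir I q z w + \<i> * wmean_dir I q z (\<i> * w) = 2 * cnj w * of_real (wvar I q z)"
proof -
  have CR: "of_real (2 * Re a) + \<i> * of_real (2 * Re (\<i> * a)) = 2 * cnj a" for a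
    by (simp add: complex_eq_iff)
  define S where "S = complex_of_real (expsum I q z)"
  have S: "S \<noteq> 0" using expsum_pos[OF assms, of q z] by (simp add: S_def)
  let ?e = "\<lambda>i. complex_of_real (exp (2 * Re (q i z)))"
  let ?d = "\<lambda>i. deriv (q i) z" and ?E = "wmean I q z"
  let ?A = "\<lambda>w. (\<Sum>i\<in>I. ?e i * (of_real (2 * Re (?d i * w)) * ?d i + deriv (deriv (q i)) z * w))"
  have "?A w + \<i> * ?A (\<i> * w) = (\<Sum>i\<in>I. ?e i * (2 * cnj (?d i * w) * ?d i))"
    unfolding sum_distrib_left sum.distrib[symmetric]
  proof (rule sum.cong)
    fix i
    have "?e i * (of_real (2 * Re (?d i * w)) * ?d i + deriv (deriv (q i)) z * w) +
      \<i> * (?e i * (of_real (2 * Re (?d i * (\<i> * w))) * ?d i + deriv (deriv (q i)) z * (\<i> * w)))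
      = ?e i * ((of_real (2 * Re (?d i * w)) + \<i> * of_real (2 * Re (\<i> * (?d i * w)))) * ?d i)"
      by (simp add: algebra_simps)
    then show "?e i * (of_real (2 * Re (?d i * w)) * ?d i + deriv (deriv (q i)) z * w) +
      \<i> * (?e i * (of_real (2 * Re (?d i * (\<i> * w))) * ?d i + deriv (deriv (q i)) z * (\<i> * w)))
      = ?e i * (2 * cnj (?d i * w) * ?d i)"
      by (simp only: CR)
  qed simp
  also have "\<dots> = 2 * cnj w * of_real (\<Sum>i\<in>I. exp (2 * Re (q i z)) * (cmod (?d i))\<^sup>2)"
    unfolding of_real_sum sum_distrib_left
    by (intro sum.cong refl) (simp only: of_real_mult complex_norm_square, simp add: algebra_simps)
  finally have A: "?A w + \<i> * ?A (\<i> * w) = \<dots>" .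
  have B: "?E * of_real (2 * Re (?E * w)) + \<i> * (?E * of_real (2 * Re (?E * (\<i> * w))))
      = 2 * cnj w * of_real ((cmod ?E)\<^sup>2)"
  proof -
    have "?E * of_real (2 * Re (?E * w)) + \<i> * (?E * of_real (2 * Re (?E * (\<i> * w))))
      = ?E * (of_real (2 * Re (?E * w)) + \<i> * of_real (2 * Re (\<i> * (?E * w))))"
      by (simp add: algebra_simps)
    also have "\<dots> = 2 * cnj w * (?E * cnj ?E)" by (simp only: CR) (simp add: algebra_simps)
    finally show ?thesis by (simp only: complex_norm_square)
  qed
  have "wmean_dir I q z w + \<i> * wmean_dir I q z (\<i> * w)
      = (?A w + \<i> * ?A (\<i> * w)) / S
       - (?E * of_real (2 * Re (?E * w)) + \<i> * (?E * of_real (2 * Re (?E * (\<i> * w)))))"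
    unfolding wmean_dir_def S_def[symmetric]
    by (simp only: add_divide_distrib right_diff_distrib times_divide_eq_right) (simp only: algebra_simps)
  then show ?thesis
    unfolding A B by (simp add: wvar_def S_def algebra_simps)
qed

lemma has_vector_derivative_along:
  assumes "q holomorphic_on ball 0 R" "(\<gamma> has_vector_derivative w) (at s)" "\<gamma> s \<in> ball 0 R"
  shows "((\<lambda>s. q (\<gamma> s)) has_vector_derivative deriv q (\<gamma> s) * w) (at s)"
proof -
  have "(q has_field_derivative deriv q (\<gamma> s)) (at (\<gamma> s))"
    using assms holomorphic_derivI[OF assms(1) open_ball] by blast
  from field_vector_diff_chain_at[OF assms(2) this] show ?thesis
    by (simp add: o_def mult.commute)
qed

lemma exp_Re_derivative_along:
  assumes "q holomorphic_on ball 0 R" "(\<gamma> has_vector_derivative w) (at s)" "\<gamma> s \<in> ball 0 R"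
  shows "((\<lambda>s. exp (2 * Re (q (\<gamma> s)))) has_real_derivative
           exp (2 * Re (q (\<gamma> s))) * (2 * Re (deriv q (\<gamma> s) * w))) (at s)"
proof -
  have "((\<lambda>s. Re (q (\<gamma> s))) has_vector_derivative Re (deriv q (\<gamma> s) * w)) (at s)"
    by (intro bounded_linear.has_vector_derivative[OF bounded_linear_Re] has_vector_derivative_along[OF assms])
  then have "((\<lambda>s. Re (q (\<gamma> s))) has_real_derivative Re (deriv q (\<gamma> s) * w)) (at s)"
    by (simp add: has_real_derivative_iff_has_vector_derivative)
  from DERIV_chain2[OF DERIV_exp DERIV_cmult[OF this, of 2]] show ?thesis
    by (simp add: mult.assoc)
qed

lemma expsum_derivative_along:
  assumes "finite I" "I \<noteq> {}" "\<And>i. i \<in> I \<Longrightarrow> q i holomorphic_on ball 0 R"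
    and "(\<gamma> has_vector_derivative w) (at s)" "\<gamma> s \<in> ball 0 R"
  shows "((\<lambda>s. expsum I q (\<gamma> s)) has_real_derivative
           expsum I q (\<gamma> s) * (2 * Re (wmean I q (\<gamma> s) * w))) (at s)"
proof -
  let ?S = "expsum I q (\<gamma> s)"
  have S: "?S > 0" using expsum_pos assms(1,2) by blast
  have "((\<lambda>s. expsum I q (\<gamma> s)) has_real_derivative
      (\<Sum>i\<in>I. exp (2 * Re (q i (\<gamma> s))) * (2 * Re (deriv (q i) (\<gamma> s) * w)))) (at s)"
    unfolding expsum_def by (intro DERIV_sum exp_Re_derivative_along[where R = R] assms)
  moreover have "(\<Sum>i\<in>I. exp (2 * Re (q i (\<gamma> s))) * (2 * Re (deriv (q i) (\<gamma> s) * w)))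
     = ?S * (2 * Re (wmean I q (\<gamma> s) * w))"
  proof -
    have "?S * (2 * Re (wmean I q (\<gamma> s) * w)) = 2 * Re (of_real ?S * wmean I q (\<gamma> s) * w)"
      by (simp add: algebra_simps)
    also have "of_real ?S * wmean I q (\<gamma> s) =
       (\<Sum>i\<in>I. of_real (exp (2 * Re (q i (\<gamma> s)))) * deriv (q i) (\<gamma> s))"
      using S by (simp add: wmean_def)
    finally show ?thesis
      by (simp add: sum_distrib_right sum_distrib_left algebra_simps)
  qed
  ultimately show ?thesis by simp
qed

lemma ln_expsum_derivative_along:
  assumes "finite I" "I \<noteq> {}" "\<And>i. i \<in> I \<Longrightarrow> q i holomorphic_on ball 0 R"
    and "(\<gamma> has_vector_derivative w) (at s)" "\<gamma> s \<in> ball 0 R"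
  shows "((\<lambda>s. ln (expsum I q (\<gamma> s))) has_real_derivative 2 * Re (wmean I q (\<gamma> s) * w)) (at s)"
  using DERIV_chain2[OF DERIV_ln_divide[OF expsum_pos[OF assms(1,2)]] expsum_derivative_along[where q = q, OF assms]]
    expsum_pos[OF assms(1,2), of q "\<gamma> s"]
  by simp

lemma wmean_derivative_along:
  assumes "finite I" "I \<noteq> {}" and hol: "\<And>i. i \<in> I \<Longrightarrow> q i holomorphic_on ball 0 R"
    and g: "(\<gamma> has_vector_derivative w) (at s)" "\<gamma> s \<in> ball 0 R"
  shows "((\<lambda>s. wmean I q (\<gamma> s)) has_vector_derivative wmean_dir I q (\<gamma> s) w) (at s)"
proof -
  let ?S = "\<lambda>s. expsum I q (\<gamma> s)"
  let ?N = "\<lambda>s. \<Sum>i\<in>I. of_real (exp (2 * Re (q i (\<gamma> s)))) * deriv (q i) (\<gamma> s)"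
  have S: "?S s > 0" using expsum_pos assms(1,2) by blast
  have "((\<lambda>s. inverse (?S s)) has_real_derivative - (?S s * (2 * Re (wmean I q (\<gamma> s) * w))) / (?S s)\<^sup>2) (at s)"
    using DERIV_inverse_fun[OF expsum_derivative_along[where q = q, OF assms]] S
    by (simp add: power2_eq_square divide_inverse mult.assoc)
  then have inv: "((\<lambda>s. inverse (?S s)) has_real_derivative - (2 * Re (wmean I q (\<gamma> s) * w)) / ?S s) (at s)"
    by (rule DERIV_cong) (use S in \<open>simp add: field_simps power2_eq_square\<close>)
  have N: "(?N has_vector_derivative (\<Sum>i\<in>I. of_real (exp (2 * Re (q i (\<gamma> s)))) *
        (of_real (2 * Re (deriv (q i) (\<gamma> s) * w)) * deriv (q i) (\<gamma> s) + deriv (deriv (q i)) (\<gamma> s) * w))) (at s)"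
  proof (intro has_vector_derivative_sum)
    fix i assume i: "i \<in> I"
    have "deriv (q i) holomorphic_on ball 0 R" using hol[OF i] holomorphic_deriv by blast
    from has_vector_derivative_along[OF this g]
    have 1: "((\<lambda>s. deriv (q i) (\<gamma> s)) has_vector_derivative deriv (deriv (q i)) (\<gamma> s) * w) (at s)" .
    from has_vector_derivative_scaleR[OF exp_Re_derivative_along[OF hol[OF i] g] 1]
    show "((\<lambda>s. of_real (exp (2 * Re (q i (\<gamma> s)))) * deriv (q i) (\<gamma> s)) has_vector_derivative
      of_real (exp (2 * Re (q i (\<gamma> s)))) *
        (of_real (2 * Re (deriv (q i) (\<gamma> s) * w)) * deriv (q i) (\<gamma> s) + deriv (deriv (q i)) (\<gamma> s) * w)) (at s)"
      by (simp add: scaleR_conv_of_real algebra_simps)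
  qed
  from has_vector_derivative_scaleR[OF inv N]
  have "((\<lambda>s. inverse (?S s) *\<^sub>R ?N s) has_vector_derivative wmean_dir I q (\<gamma> s) w) (at s)"
    by (rule has_vector_derivative_eq_rhs)
       (use S in \<open>simp add: wmean_dir_def wmean_def scaleR_conv_of_real field_simps\<close>)
  then show ?thesis
    by (simp add: wmean_def scaleR_conv_of_real field_simps)
qed

lemma cis_has_vector_derivative:
  "((\<lambda>t. of_real s * cis t) has_vector_derivative \<i> * (of_real s * cis t)) (at t)"
proof -
  have "((\<lambda>t. cis t) has_vector_derivative \<i> * cis t) (at t)"
    unfolding cis.ctr complex_eq_iff
    by (auto intro!: derivative_eq_intros simp: has_vector_derivative_complex_iff)
  from has_vector_derivative_mult_right[OF this, of "of_real s"] show ?thesis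
    by (simp add: algebra_simps)
qed

lemma radius_has_vector_derivative:
  "((\<lambda>s. of_real s * cis t) has_vector_derivative cis t) (at s)"
  by (auto intro!: derivative_eq_intros)

lemma sum_exp_nonzero: "finite I \<Longrightarrow> I \<noteq> {} \<Longrightarrow> (\<Sum>i\<in>I. exp (f i) :: real) \<noteq> 0"
  using sum_pos[of I "\<lambda>i. exp (f i)"] by auto

lemma continuous_on_wmean:
  assumes "finite I" "I \<noteq> {}" "\<And>i. i \<in> I \<Longrightarrow> q i holomorphic_on ball 0 R"
  shows "continuous_on (ball 0 R) (wmean I q)"
  unfolding wmean_def expsum_def
  using sum_exp_nonzero[OF assms(1,2)] assms(3)
  by (intro continuous_intros holomorphic_on_imp_continuous_on holomorphic_deriv)
     (auto simp del: of_real_sum)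

lemma continuous_on_ln_expsum:
  assumes "finite I" "I \<noteq> {}" "\<And>i. i \<in> I \<Longrightarrow> q i holomorphic_on ball 0 R"
  shows "continuous_on (ball 0 R) (\<lambda>z. ln (expsum I q z))"
  unfolding expsum_def
  using sum_exp_nonzero[OF assms(1,2)] assms(3)
  by (intro continuous_intros holomorphic_on_imp_continuous_on)
     auto

lemma continuous_on_wvar:
  assumes "finite I" "I \<noteq> {}" "\<And>i. i \<in> I \<Longrightarrow> q i holomorphic_on ball 0 R"
  shows "continuous_on (ball 0 R) (wvar I q)"
  unfolding wvar_def
  using sum_exp_nonzero[OF assms(1,2)] assms(3)
  unfolding expsum_def
  by (intro continuous_intros continuous_on_wmean[OF assms(1,2)] holomorphic_on_imp_continuous_on
        holomorphic_deriv) auto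

lemma continuous_on_wmean_dir:
  assumes "finite I" "I \<noteq> {}" "\<And>i. i \<in> I \<Longrightarrow> q i holomorphic_on ball 0 R"
  shows "continuous_on (ball 0 R \<times> UNIV) (\<lambda>(z, w). wmean_dir I q z w)"
proof -
  note A = continuous_on_compose2[OF _ continuous_on_fst[OF continuous_on_id], of "ball 0 R" _ "ball 0 R \<times> UNIV"]
  have 1: "continuous_on (ball 0 R \<times> UNIV) (\<lambda>x::complex \<times> complex. q i (fst x))"
    "continuous_on (ball 0 R \<times> UNIV) (\<lambda>x::complex \<times> complex. deriv (q i) (fst x))"
    "continuous_on (ball 0 R \<times> UNIV) (\<lambda>x::complex \<times> complex. deriv (deriv (q i)) (fst x))" if "i \<in> I" for i
    by (rule A; use assms(3)[OF that] in \<open>auto intro!: holomorphic_on_imp_continuous_on holomorphic_deriv\<close>)+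
  have 2: "continuous_on (ball 0 R \<times> UNIV) (\<lambda>x::complex \<times> complex. wmean I q (fst x))"
    by (rule A[OF continuous_on_wmean[OF assms]]) auto
  show ?thesis
    unfolding wmean_dir_def split_beta expsum_def
    using sum_exp_nonzero[OF assms(1,2)]
    by (intro continuous_intros 1 2) (auto simp del: of_real_sum)
qed

lemma Re_complex_of_real_mult: "Re (of_real s * z) = s * Re z"
  by simp

lemma wmean_dir_scale: "wmean_dir I q z (of_real a * w) = of_real a * wmean_dir I q z w"
proof -
  have "of_real (2 * Re (x * (of_real a * w))) = of_real a * complex_of_real (2 * Re (x * w))" for x
    by (simp add: complex_eq_iff algebra_simps)
  note A = this
  show ?thesis
    unfolding wmean_dir_def A right_diff_distrib sum_distrib_left times_divide_eq_right
    by (intro arg_cong2[where f = minus] arg_cong2[where f = divide] sum.cong refl)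
       (simp_all only: algebra_simps)
qed

text \<open>
The mean over a circle of a function with Laplacian at most \<open>4 * C\<close> exceeds the value at the
centre by at most \<open>C * r\<^sup>2\<close>. Differentiation under the integral sign gives the radial
derivative of the mean as the integral of \<open>2 * Re (wmean I q z * cis t)\<close>; times the radius, that
integral has derivative \<open>4 * r\<close> times the integral of the variance, because the tangential
derivatives integrate to zero. Two comparisons of derivatives finish the proof.
\<close>

lemma circle_integral_ln_expsum_le:
  assumes I: "finite I" "I \<noteq> {}" and hol: "\<And>i. i \<in> I \<Longrightarrow> q i holomorphic_on ball 0 R"
    and var: "\<And>z. z \<in> ball 0 R \<Longrightarrow> wvar I q z \<le> C"
    and r: "0 < r" "r < R"
  shows "integral {0..2*pi} (\<lambda>t. ln (expsum I q (of_real r * cis t)))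
           \<le> 2 * pi * (ln (expsum I q 0) + C * r\<^sup>2)"
proof -
  define U where "U = {-R<..<R}"
  have U: "open U" "convex U" by (auto simp: U_def)
  have inb: "of_real s * cis t \<in> ball 0 R" if "s \<in> U" for s t
    using that by (auto simp: U_def norm_mult)
  let ?u = "\<lambda>s t. ln (expsum I q (of_real s * cis t))"
  let ?E = "wmean I q"
  let ?z = "\<lambda>s t. of_real s * cis t"
  define m where "m s = integral {0..2*pi} (?u s)" for s
  have contz: "continuous_on (U \<times> {0..2*pi}) (\<lambda>(s, t). ?z s t)"
    by (auto simp: split_beta intro!: continuous_intros)
  have cont_comp: "continuous_on (U \<times> {0..2*pi}) (\<lambda>(s, t). f (?z s t))"
    if "continuous_on (ball 0 R) f" for f :: "complex \<Rightarrow> complex"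
    using continuous_on_compose2[OF that contz] inb by (auto simp: split_beta image_subset_iff)
  have cont_t: "continuous_on {0..2*pi} (\<lambda>t. f (?z s t))"
    if "continuous_on (ball 0 R) f" "s \<in> U" for f :: "complex \<Rightarrow> 'b::topological_space" and s
    by (rule continuous_on_compose2[OF that(1)]) (use inb that(2) in \<open>auto intro!: continuous_intros\<close>)
  have cE: "continuous_on (U \<times> {0..2*pi}) (\<lambda>(s, t). ?E (?z s t))"
    by (rule cont_comp[OF continuous_on_wmean[where q = q, OF I hol]])
  have ccis: "continuous_on (U \<times> {0..2*pi}) (\<lambda>x. cis (snd x))"
    by (intro continuous_intros)
  have czs: "continuous_on {0..2*pi} (\<lambda>t. ?z s t)" for s
    by (intro continuous_intros)
  have cEs: "continuous_on {0..2*pi} (\<lambda>t. ?E (?z s t))" if "s \<in> U" for s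
    by (rule cont_t[OF continuous_on_wmean[where q = q, OF I hol] that])
  have cD: "continuous_on (U \<times> {0..2*pi}) (\<lambda>x. wmean_dir I q (?z (fst x) (snd x)) (w (fst x) (snd x)))"
    if "continuous_on (U \<times> {0..2*pi}) (\<lambda>x. w (fst x) (snd x))" for w
    using continuous_on_compose2[OF continuous_on_wmean_dir[where q = q, OF I hol], where
        f = "\<lambda>x. (?z (fst x) (snd x), w (fst x) (snd x))" and s = "U \<times> {0..2*pi}"] inb that contz
    by (simp add: split_beta image_subset_iff continuous_on_Pair)
  define m1 where "m1 s = integral {0..2*pi} (\<lambda>t. 2 * Re (?E (?z s t) * cis t))" for s
  have m: "(m has_real_derivative m1 s) (at s)" if "s \<in> U" for s
  proof -
    have "((\<lambda>s. integral (cbox 0 (2*pi)) (?u s)) has_real_derivative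
       integral (cbox 0 (2*pi)) (\<lambda>t. 2 * Re (?E (?z s t) * cis t))) (at s within U)"
    proof (rule leibniz_rule_field_derivative)
      show "((\<lambda>s. ?u s t) has_real_derivative 2 * Re (?E (?z s t) * cis t)) (at s within U)"
        if "s \<in> U" for s t
        by (rule has_field_derivative_at_within[OF ln_expsum_derivative_along[where q = q,
              OF I hol radius_has_vector_derivative inb[OF that]]])
      show "?u s integrable_on cbox 0 (2*pi)" if "s \<in> U" for s
        unfolding cbox_interval
        by (rule integrable_continuous_real[OF cont_t[OF continuous_on_ln_expsum[where q = q, OF I hol] that]])
      show "continuous_on (U \<times> cbox 0 (2*pi)) (\<lambda>(s, t). 2 * Re (?E (?z s t) * cis t))"
        unfolding split_beta cbox_interval
        by (rule continuous_on_mult[OF continuous_on_const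
              continuous_on_Re[OF continuous_on_mult[OF cE[unfolded split_beta] ccis]]])
    qed (fact that, fact U(2))
    then show ?thesis
      unfolding at_within_open[OF that U(1)] m1_def m_def[abs_def] cbox_interval .
  qed
  define J where "J s = integral {0..2*pi} (\<lambda>t. 2 * Re (?z s t * ?E (?z s t)))" for s
  have J_m1: "J s = s * m1 s" for s
  proof -
    have "2 * Re (?z s t * e) = s * (2 * Re (e * cis t))" for t e
    proof -
      have "?z s t * e = of_real s * (e * cis t)" by (simp only: mult_ac)
      then have "Re (?z s t * e) = s * Re (e * cis t)" by (simp only: Re_complex_of_real_mult)
      then show ?thesis by (simp only: mult.left_commute)
    qed
    then show ?thesis unfolding J_def m1_def by (simp only: integral_mult_right)
  qed
  define g where "g s t = 2 * Re (?z s t * wmean_dir I q (?z s t) (cis t) + cis t * ?E (?z s t))" for s t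
  have J: "(J has_real_derivative integral {0..2*pi} (g s)) (at s)" if "s \<in> U" for s
  proof -
    have "((\<lambda>s. integral (cbox 0 (2*pi)) (\<lambda>t. 2 * Re (?z s t * ?E (?z s t)))) has_real_derivative
       integral (cbox 0 (2*pi)) (g s)) (at s within U)"
    proof (rule leibniz_rule_field_derivative)
      show "((\<lambda>s. 2 * Re (?z s t * ?E (?z s t))) has_real_derivative g s t) (at s within U)"
        if "s \<in> U" for s t
      proof -
        have "((\<lambda>s. ?z s t * ?E (?z s t)) has_vector_derivative
           ?z s t * wmean_dir I q (?z s t) (cis t) + cis t * ?E (?z s t)) (at s)"
          by (rule has_vector_derivative_mult[OF radius_has_vector_derivative
                wmean_derivative_along[where q = q, OF I hol radius_has_vector_derivative inb[OF that]]])
        from has_vector_derivative_mult_right[OF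
            bounded_linear.has_vector_derivative[OF bounded_linear_Re this], of 2]
        show ?thesis
          unfolding has_real_derivative_iff_has_vector_derivative g_def
          by (rule has_vector_derivative_at_within)
      qed
      show "(\<lambda>t. 2 * Re (?z s t * ?E (?z s t))) integrable_on cbox 0 (2*pi)" if "s \<in> U" for s
        unfolding cbox_interval
        by (rule integrable_continuous_real[OF continuous_on_mult[OF continuous_on_const
              continuous_on_Re[OF continuous_on_mult[OF czs cEs[OF that]]]]])
      show "continuous_on (U \<times> cbox 0 (2*pi)) (\<lambda>(s, t). g s t)"
      proof -
        note E = cE[unfolded split_beta] and z = contz[unfolded split_beta]
        show ?thesis
          unfolding g_def split_beta cbox_interval
          by (rule continuous_on_mult[OF continuous_on_const continuous_on_Re[OF continuous_on_add[OF
                continuous_on_mult[OF z cD[OF ccis]] continuous_on_mult[OF ccis E]]]])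
      qed
    qed (fact that, fact U(2))
    then show ?thesis
      unfolding at_within_open[OF that U(1)] J_def[abs_def] cbox_interval .
  qed
  have g_le: "s * integral {0..2*pi} (g s) \<le> 8 * pi * C * s\<^sup>2" if s: "s \<in> U" for s
  proof -
    let ?h = "\<lambda>t. 2 * Im (\<i> * ?z s t * ?E (?z s t) + ?z s t * wmean_dir I q (?z s t) (\<i> * ?z s t))"
    have "((\<lambda>t. 2 * Im (?z s t * ?E (?z s t))) has_vector_derivative ?h t) (at t)" for t
    proof -
      have "((\<lambda>t. ?z s t * ?E (?z s t)) has_vector_derivative
           ?z s t * wmean_dir I q (?z s t) (\<i> * ?z s t) + (\<i> * ?z s t) * ?E (?z s t)) (at t)"
        by (rule has_vector_derivative_mult[OF cis_has_vector_derivative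
              wmean_derivative_along[where q = q, OF I hol cis_has_vector_derivative inb[OF s]]])
      from has_vector_derivative_mult_right[OF bounded_linear.has_vector_derivative[OF bounded_linear_Im this], of 2]
      show ?thesis by (rule has_vector_derivative_eq_rhs) (simp only: add.commute)
    qed
    note dh = this
    have per: "?z s (2*pi) = ?z s 0" by simp
    have "(?h has_integral 2 * Im (?z s (2*pi) * ?E (?z s (2*pi))) - 2 * Im (?z s 0 * ?E (?z s 0))) {0..2*pi}"
      by (rule fundamental_theorem_of_calculus[OF _ has_vector_derivative_at_within[OF dh]]) simp
    then have h: "(?h has_integral 0) {0..2*pi}" unfolding per diff_self .
    have gi: "(g s has_integral integral {0..2*pi} (g s)) {0..2*pi}"
    proof (rule integrable_integral, rule integrable_continuous_real)
      have "continuous_on {0..2*pi} (\<lambda>t. (?z s t, cis t))"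
        by (intro continuous_intros)
      from continuous_on_compose2[OF continuous_on_wmean_dir[where q = q, OF I hol] this]
      have D: "continuous_on {0..2*pi} (\<lambda>t. wmean_dir I q (?z s t) (cis t))"
        using inb[OF s] by (simp add: image_subset_iff)
      have "continuous_on {0..2*pi} cis"
        by (intro continuous_intros)
      then show "continuous_on {0..2*pi} (g s)"
        unfolding g_def
        by (rule continuous_on_mult[OF continuous_on_const continuous_on_Re[OF continuous_on_add[OF
              continuous_on_mult[OF czs D] continuous_on_mult[OF _ cEs[OF s]]]]])
    qed
    have "s * g s t - ?h t \<le> 4 * C * s\<^sup>2" for t
    proof -
      note lin = wmean_dir_scale
      have alg: "of_real s * (z * x + c * e) + \<i> * (\<i> * z * e + z * y) = z * (of_real s * x + \<i> * y)"
        if "z = of_real s * c" for z c e x y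
        unfolding that by (simp add: algebra_simps)
      have ReIm: "s * (2 * Re x) - 2 * Im y = 2 * Re (of_real s * x + \<i> * y)" for x y
        by simp
      have "s * g s t - ?h t = 2 * Re (of_real s * (?z s t * wmean_dir I q (?z s t) (cis t) + cis t * ?E (?z s t))
         + \<i> * (\<i> * ?z s t * ?E (?z s t) + ?z s t * wmean_dir I q (?z s t) (\<i> * ?z s t)))"
        unfolding g_def by (rule ReIm)
      also have "of_real s * (?z s t * wmean_dir I q (?z s t) (cis t) + cis t * ?E (?z s t))
         + \<i> * (\<i> * ?z s t * ?E (?z s t) + ?z s t * wmean_dir I q (?z s t) (\<i> * ?z s t))
         = ?z s t * (wmean_dir I q (?z s t) (?z s t) + \<i> * wmean_dir I q (?z s t) (\<i> * ?z s t))"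
        unfolding lin by (rule alg[OF refl])
      also have "\<dots> = ?z s t * (2 * cnj (?z s t) * of_real (wvar I q (?z s t)))"
        by (simp only: wmean_dir_cauchy_riemann[OF I])
      also have "\<dots> = 2 * (?z s t * cnj (?z s t)) * of_real (wvar I q (?z s t))"
        by (simp only: mult_ac)
      also have "\<dots> = of_real (2 * s\<^sup>2 * wvar I q (?z s t))"
        by (simp only: complex_norm_square[symmetric]) (simp add: norm_mult)
      also have "2 * Re \<dots> = 4 * s\<^sup>2 * wvar I q (?z s t)" by simp
      also have "\<dots> \<le> 4 * C * s\<^sup>2"
        using mult_left_mono[OF var[OF inb[OF s, of t]], of "4 * s\<^sup>2"] by (simp add: algebra_simps)
      finally show ?thesis .
    qed
    note le = this
    have "((\<lambda>t. 4 * C * s\<^sup>2) has_integral 8 * pi * C * s\<^sup>2) {0..2*pi}"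
      using has_integral_const_real[of "4 * C * s\<^sup>2" 0 "2*pi"] by (simp add: mult_ac)
    from has_integral_le[OF has_integral_diff[OF has_integral_mult_right[OF gi, of s] h] this le]
    show ?thesis unfolding diff_0_right .
  qed
  have J_le: "J s \<le> 4 * pi * C * s\<^sup>2" if s: "0 \<le> s" "s < R" for s
  proof (cases "s = 0")
    case False
    have "4 * pi * C * 0\<^sup>2 - J 0 \<le> 4 * pi * C * s\<^sup>2 - J s"
    proof (rule DERIV_nonneg_imp_increasing_open[of 0 s "\<lambda>s. 4 * pi * C * s\<^sup>2 - J s"])
      show "\<exists>y. ((\<lambda>s. 4 * pi * C * s\<^sup>2 - J s) has_real_derivative y) (at x) \<and> 0 \<le> y"
        if x: "0 < x" "x < s" for x
      proof (intro exI conjI)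
        have xU: "x \<in> U" using x s by (auto simp: U_def)
        show "((\<lambda>s. 4 * pi * C * s\<^sup>2 - J s) has_real_derivative 8 * pi * C * x - integral {0..2*pi} (g x)) (at x)"
          by (auto intro!: derivative_eq_intros J[OF xU])
        have "x * integral {0..2*pi} (g x) \<le> x * (8 * pi * C * x)"
          using g_le[OF xU] by (simp add: power2_eq_square algebra_simps)
        then show "0 \<le> 8 * pi * C * x - integral {0..2*pi} (g x)" using x by simp
      qed
      show "continuous_on {0..s} (\<lambda>s. 4 * pi * C * s\<^sup>2 - J s)"
      proof (intro continuous_intros continuous_at_imp_continuous_on ballI)
        fix x assume "x \<in> {0..s}"
        then have "x \<in> U" using s by (auto simp: U_def)
        then show "isCont J x" using J DERIV_isCont by blast
      qed
    qed (use s in auto)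
    moreover have "J 0 = 0" by (simp add: J_m1)
    ultimately show ?thesis by simp
  qed (simp add: J_m1)
  have "m r - 2 * pi * C * r\<^sup>2 \<le> m 0 - 2 * pi * C * 0\<^sup>2"
  proof (rule DERIV_nonpos_imp_decreasing_open[of 0 r "\<lambda>s. m s - 2 * pi * C * s\<^sup>2"])
    show "\<exists>y. ((\<lambda>s. m s - 2 * pi * C * s\<^sup>2) has_real_derivative y) (at x) \<and> y \<le> 0"
      if x: "0 < x" "x < r" for x
    proof (intro exI conjI)
      have xU: "x \<in> U" using x r by (auto simp: U_def)
      show "((\<lambda>s. m s - 2 * pi * C * s\<^sup>2) has_real_derivative m1 x - 4 * pi * C * x) (at x)"
        by (auto intro!: derivative_eq_intros m[OF xU])
      have "x * m1 x \<le> x * (4 * pi * C * x)"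
        using J_le[of x] x r by (simp add: J_m1 power2_eq_square algebra_simps)
      then show "m1 x - 4 * pi * C * x \<le> 0" using x by simp
    qed
    show "continuous_on {0..r} (\<lambda>s. m s - 2 * pi * C * s\<^sup>2)"
    proof (intro continuous_intros continuous_at_imp_continuous_on ballI)
      fix x assume "x \<in> {0..r}"
      then have "x \<in> U" using r by (auto simp: U_def)
      then show "isCont m x" using m DERIV_isCont by blast
    qed
  qed (use r in auto)
  moreover have "m 0 = 2 * pi * ln (expsum I q 0)" by (simp add: m_def)
  ultimately show ?thesis by (simp add: m_def algebra_simps)
qed

section \<open>Taylor coefficients from circle means\<close>

definition taylor_coeff :: "(complex \<Rightarrow> complex) \<Rightarrow> nat \<Rightarrow> complex" where
  "taylor_coeff q l = (deriv ^^ l) q 0 / fact l"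

text \<open>
The negative Fourier coefficients of \<open>q\<close> on a circle vanish, so the Fourier coefficients of
\<open>2 * Re q\<close> are the Taylor coefficients of \<open>q\<close>: a bound on the real part will control \<open>q\<close>.
\<close>

lemma circle_integral_taylor_coeff:
  fixes q :: "complex \<Rightarrow> complex"
  assumes hol: "q holomorphic_on ball 0 R" and r: "0 < r" "r < R"
  shows "((\<lambda>t. q (of_real r * cis t)) has_integral of_real (2 * pi) * q 0) {0..2*pi}"
    and "1 \<le> l \<Longrightarrow> ((\<lambda>t. of_real (2 * Re (q (of_real r * cis t))) * cis (- (real l * t))) has_integral
           of_real (2 * pi * r ^ l) * taylor_coeff q l) {0..2*pi}"
proof -
  let ?z = "\<lambda>t. of_real r * cis t"
  have sub: "cball 0 r \<subseteq> ball (0::complex) R" using r by auto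
  have cont: "continuous_on (cball 0 r) q"
    using holomorphic_on_imp_continuous_on[OF holomorphic_on_subset[OF hol sub]] .
  have holr: "q holomorphic_on ball 0 r"
    using holomorphic_on_subset[OF hol] r by (simp add: subset_ball)
  have K: "((\<lambda>t. q (?z t) * cis (- (real l * t))) has_integral of_real (2 * pi * r ^ l) * taylor_coeff q l) {0..2*pi}" for l
  proof -
    have "((\<lambda>u. q u / (u - 0) ^ (Suc l)) has_contour_integral ((2 * pi * \<i>) / (fact l) * (deriv ^^ l) q 0))
           (circlepath 0 r)"
      by (rule Cauchy_has_contour_integral_higher_derivative_circlepath[OF cont holr]) (use r in simp)
    then have "((\<lambda>t. q (?z t) / ?z t ^ Suc l * r * \<i> * cis t) has_integral
        ((2 * pi * \<i>) / (fact l) * (deriv ^^ l) q 0)) {0..2*pi}"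
      unfolding circlepath_def by (subst (asm) has_contour_integral_part_circlepath_iff) simp_all
    from has_integral_mult_right[OF this, of "of_real (r ^ l) / \<i>"]
    have "((\<lambda>t. of_real (r ^ l) / \<i> * (q (?z t) / ?z t ^ Suc l * r * \<i> * cis t)) has_integral
        of_real (2 * pi * r ^ l) * taylor_coeff q l) {0..2*pi}"
      by (rule has_integral_eq_rhs) (simp add: taylor_coeff_def field_simps)
    moreover have "of_real (r ^ l) / \<i> * (q (?z t) / ?z t ^ Suc l * r * \<i> * cis t) = q (?z t) * cis (- (real l * t))" for t
    proof -
      have "?z t ^ Suc l = of_real (r ^ l) * of_real r * cis (real l * t) * cis t"
        by (simp only: power_Suc2 power_mult_distrib Complex.DeMoivre of_real_power mult_ac)
      then show ?thesis
        using r by (simp add: field_simps cis_mult)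
    qed
    ultimately show ?thesis by (simp only:)
  qed
  from K[of 0] show "((\<lambda>t. q (?z t)) has_integral of_real (2 * pi) * q 0) {0..2*pi}"
    by (simp add: taylor_coeff_def)
  assume l: "1 \<le> l"
  have "((\<lambda>u. q u * u ^ (l - 1)) has_contour_integral 0) (circlepath 0 r)"
    by (rule Cauchy_theorem_disc_simple[where a = 0 and e = R])
       (use hol r in \<open>auto intro!: holomorphic_intros simp: path_image_circlepath\<close>)
  then have "((\<lambda>t. q (?z t) * ?z t ^ (l - 1) * r * \<i> * cis t) has_integral 0) {0..2*pi}"
    unfolding circlepath_def by (subst (asm) has_contour_integral_part_circlepath_iff) simp_all
  from has_integral_mult_right[OF this, of "1 / (\<i> * of_real (r ^ l))"]
  have "((\<lambda>t. 1 / (\<i> * of_real (r ^ l)) * (q (?z t) * ?z t ^ (l - 1) * r * \<i> * cis t)) has_integral 0) {0..2*pi}"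
    by simp
  moreover have "1 / (\<i> * of_real (r ^ l)) * (q (?z t) * ?z t ^ (l - 1) * r * \<i> * cis t) = q (?z t) * cis (real l * t)" for t
  proof -
    obtain k where k: "l = Suc k" using l by (cases l) auto
    have "?z t ^ (l - 1) * of_real r * cis t = of_real (r ^ l) * cis (real l * t)"
    proof -
      have "?z t ^ k * of_real r * cis t = of_real r ^ Suc k * (cis t ^ Suc k)"
        by (simp only: power_Suc2 power_mult_distrib mult_ac)
      then show ?thesis by (simp only: k Complex.DeMoivre diff_Suc_1 of_real_power)
    qed
    then show ?thesis using r by (simp add: field_simps)
  qed
  ultimately have "((\<lambda>t. q (?z t) * cis (real l * t)) has_integral 0) {0..2*pi}"
    by (simp only:)
  then have "((\<lambda>t. cnj (q (?z t) * cis (real l * t))) has_integral cnj 0) {0..2*pi}"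
    by (rule has_integral_linear[OF _ bounded_linear_cnj, unfolded o_def])
  from has_integral_add[OF K[of l] this]
  have "((\<lambda>t. q (?z t) * cis (- (real l * t)) + cnj (q (?z t) * cis (real l * t))) has_integral
     of_real (2 * pi * r ^ l) * taylor_coeff q l) {0..2*pi}" by simp
  moreover have "q (?z t) * cis (- (real l * t)) + cnj (q (?z t) * cis (real l * t))
     = of_real (2 * Re (q (?z t))) * cis (- (real l * t))" for t
    using complex_add_cnj[of "q (?z t)"] by (simp only: complex_cnj_mult cis_cnj distrib_right[symmetric])
  ultimately show "((\<lambda>t. of_real (2 * Re (q (?z t))) * cis (- (real l * t))) has_integral
           of_real (2 * pi * r ^ l) * taylor_coeff q l) {0..2*pi}"
    by (simp only:)
qed

text \<open>
The argument of Borel and Caratheodory. Since \<open>u - 2 * Re q\<close> is nonnegative, its mean bounds its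
Fourier coefficients, and the mean of \<open>Re q\<close> is \<open>Re (q 0)\<close>; the Fourier coefficients of \<open>u\<close> are
bounded by its mean, as \<open>u\<close> is nonnegative as well.
\<close>

lemma taylor_coeff_le_circle_mean:
  fixes q :: "complex \<Rightarrow> complex"
  assumes hol: "q holomorphic_on ball 0 R" and r: "0 < r" "r < R"
    and u: "u integrable_on {0..2*pi}" "\<And>t. 0 \<le> u t" "\<And>t. 2 * Re (q (of_real r * cis t)) \<le> u t"
    and B: "integral {0..2*pi} u \<le> 2 * pi * B" and l: "1 \<le> l"
  shows "cmod (taylor_coeff q l) \<le> 2 * (B - Re (q 0)) / r ^ l"
proof -
  let ?h = "\<lambda>t. Re (q (of_real r * cis t))"
  note K = circle_integral_taylor_coeff[OF hol r]
  have h: "(?h has_integral 2 * pi * Re (q 0)) {0..2*pi}"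
    using has_integral_Re[OF K(1)] by (simp only: Re_complex_of_real_mult)
  have g: "((\<lambda>t. 2 * u t - 2 * ?h t) has_integral 2 * integral {0..2*pi} u - 2 * (2 * pi * Re (q 0))) {0..2*pi}"
    by (intro has_integral_diff has_integral_mult_right integrable_integral u h)
  have "cmod (of_real (2 * pi * r ^ l) * taylor_coeff q l) \<le> 2 * integral {0..2*pi} u - 2 * (2 * pi * Re (q 0))"
  proof (rule order_trans)
    have bd: "cmod (of_real (2 * ?h t) * cis (- (real l * t))) \<le> 2 * u t - 2 * ?h t" for t
      using u(2)[of t] u(3)[of t] by (simp only: norm_mult norm_cis norm_of_real)
    show "cmod (of_real (2 * pi * r ^ l) * taylor_coeff q l) \<le> integral {0..2*pi} (\<lambda>t. 2 * u t - 2 * ?h t)"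
      unfolding integral_unique[OF K(2)[OF l], symmetric]
      by (rule integral_norm_bound_integral[OF has_integral_integrable[OF K(2)[OF l]]
            has_integral_integrable[OF g] bd])
  qed (simp only: integral_unique[OF g])
  also have "\<dots> \<le> 4 * pi * (B - Re (q 0))"
    using B by (simp add: algebra_simps)
  finally have "(2 * pi * r ^ l) * cmod (taylor_coeff q l) \<le> 4 * pi * (B - Re (q 0))"
    using r by (simp only: norm_mult norm_of_real) simp
  then have "pi * (r ^ l * cmod (taylor_coeff q l)) \<le> pi * (2 * (B - Re (q 0)))"
    by (simp add: algebra_simps)
  then have "r ^ l * cmod (taylor_coeff q l) \<le> 2 * (B - Re (q 0))"
    by (rule mult_left_le_imp_le) simp
  then show ?thesis
    using r by (simp add: pos_le_divide_eq mult.commute)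
qed

lemma taylor_remainder_le:
  assumes hol: "q holomorphic_on ball 0 R" and r: "0 < r" "r < R"
    and coeff: "\<And>l. 1 \<le> l \<Longrightarrow> cmod (taylor_coeff q l) \<le> K / r ^ l"
    and z: "cmod z < r" and m: "1 \<le> m"
  shows "cmod (q z - (\<Sum>l<m. taylor_coeff q l * z ^ l)) \<le> K * ((cmod z / r) ^ m / (1 - cmod z / r))"
proof -
  let ?e = "cmod z / r"
  have e: "0 \<le> ?e" "?e < 1" using r z by auto
  have "(\<lambda>l. taylor_coeff q l * z ^ l) sums q z"
    using holomorphic_power_series[OF hol, of z] z r by (simp add: taylor_coeff_def)
  from sums_split_initial_segment[OF this, of m]
  have s: "(\<lambda>l. taylor_coeff q (l + m) * z ^ (l + m)) sums (q z - (\<Sum>l<m. taylor_coeff q l * z ^ l))" .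
  have g: "(\<lambda>l. K * (?e ^ m * ?e ^ l)) sums (K * (?e ^ m * (1 / (1 - ?e))))"
    by (intro sums_mult geometric_sums) (use e in simp)
  have "cmod (taylor_coeff q (l + m) * z ^ (l + m)) \<le> K * (?e ^ m * ?e ^ l)" for l
  proof -
    have "cmod (taylor_coeff q (l + m) * z ^ (l + m)) = cmod (taylor_coeff q (l + m)) * cmod z ^ (l + m)"
      by (simp add: norm_mult norm_power)
    also have "\<dots> \<le> K / r ^ (l + m) * cmod z ^ (l + m)"
      by (intro mult_right_mono coeff) (use m in auto)
    also have "\<dots> = K * (?e ^ m * ?e ^ l)"
      by (simp add: power_divide power_add mult_ac)
    finally show ?thesis .
  qed
  from norm_suminf_le[OF this sums_summable[OF g]]
  show ?thesis using s g by (simp add: sums_iff)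
qed

section \<open>Strict majorities\<close>

lemma strict_majority_inter:
  assumes "finite I" "A \<subseteq> I" "B \<subseteq> I" "card I < 2 * card A" "card I < 2 * card B"
  shows "A \<inter> B \<noteq> {}"
proof
  assume "A \<inter> B = {}"
  then have "card A + card B = card (A \<union> B)"
    using assms finite_subset by (metis card_Un_disjoint)
  also have "\<dots> \<le> card I" using assms by (intro card_mono) auto
  finally show False using assms by simp
qed

text \<open>
Choose a direction in which distinct \<open>a i\<close> have distinct real parts. Two strict majorities of
\<open>I\<close> meet, so some index is maximal both in this direction and in the opposite one; then all real
parts in this direction agree.
\<close>

lemma majority_maximal_in_all_directions:
  fixes a :: "'i \<Rightarrow> complex"
  assumes fin: "finite I" and F: "F \<subseteq> I"
    and maj: "\<And>w. card I < 2 * card {i\<in>F. \<forall>j\<in>F. Re (a j * w) \<le> Re (a i * w)}"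
  shows "\<exists>b. \<forall>i\<in>F. a i = b"
proof -
  have finF: "finite F" using fin F finite_subset by blast
  let ?bad = "\<lambda>d::complex. {s. Re (d * Complex s 1) = 0}"
  have fb: "finite (?bad d)" if "d \<noteq> 0" for d
  proof (rule finite_subset)
    show "?bad d \<subseteq> {Im d / Re d}"
      using that by (cases "Re d = 0") (auto simp: complex_eq_iff field_simps)
  qed auto
  let ?D = "(\<lambda>(i, j). a i - a j) ` (F \<times> F) - {0}"
  have "finite (\<Union>d\<in>?D. ?bad d)" using finF fb by auto
  then obtain s where s: "s \<notin> (\<Union>d\<in>?D. ?bad d)"
    using ex_new_if_finite[OF infinite_UNIV_char_0] by blast
  define w where "w = Complex s 1"
  have gen: "a i = a j" if "i \<in> F" "j \<in> F" "Re ((a i - a j) * w) = 0" for i j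
  proof (rule ccontr)
    assume "a i \<noteq> a j"
    then have "a i - a j \<in> ?D" using that(1,2) by force
    moreover have "s \<in> ?bad (a i - a j)" using that(3) by (simp only: w_def mem_Collect_eq)
    ultimately show False using s by blast
  qed
  let ?J = "\<lambda>w. {i\<in>F. \<forall>j\<in>F. Re (a j * w) \<le> Re (a i * w)}"
  have "?J w \<inter> ?J (- w) \<noteq> {}"
    by (rule strict_majority_inter[OF fin _ _ maj maj]) (use F in auto)
  then obtain i where i: "i \<in> ?J w" "i \<in> ?J (- w)" by blast
  have "a j = a i" if j: "j \<in> F" for j
  proof (rule gen)
    have "Re (a j * w) = Re (a i * w)"
      using i j by (intro antisym) auto
    then show "Re ((a j - a i) * w) = 0" by (simp add: algebra_simps)
  qed (use i j in auto)
  then show ?thesis by blast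
qed

lemma finite_family_convergent_subsequence:
  fixes X :: "nat \<Rightarrow> 'i \<Rightarrow> 'a::heine_borel"
  assumes "finite I" "\<And>i. i \<in> I \<Longrightarrow> bounded (range (\<lambda>n. X n i))"
  shows "\<exists>\<rho>::nat \<Rightarrow> nat. strict_mono \<rho> \<and> (\<forall>i\<in>I. \<exists>l. (\<lambda>n. X (\<rho> n) i) \<longlonglongrightarrow> l)"
  using assms
proof (induction I rule: finite_induct)
  case empty
  then show ?case by (intro exI[of _ "\<lambda>n. n"]) (auto simp: strict_mono_def)
next
  case (insert i I)
  then obtain \<rho> where \<rho>: "strict_mono \<rho>" "\<forall>i\<in>I. \<exists>l. (\<lambda>n. X (\<rho> n) i) \<longlonglongrightarrow> l"
    by auto
  have "bounded (range (\<lambda>n. X (\<rho> n) i))"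
    by (rule bounded_subset[OF insert.prems[of i]]) auto
  then obtain l \<sigma> where \<sigma>: "strict_mono \<sigma>" "((\<lambda>n. X (\<rho> n) i) \<circ> \<sigma>) \<longlonglongrightarrow> l"
    using bounded_imp_convergent_subsequence by blast
  show ?case
  proof (intro exI[of _ "\<rho> \<circ> \<sigma>"] conjI ballI)
    show "strict_mono (\<rho> \<circ> \<sigma>)" using \<rho>(1) \<sigma>(1) by (rule strict_mono_o)
    fix j assume "j \<in> insert i I"
    then show "\<exists>l. (\<lambda>n. X ((\<rho> \<circ> \<sigma>) n) j) \<longlonglongrightarrow> l"
    proof
      assume "j = i" then show ?thesis using \<sigma>(2) by (auto simp: o_def)
    next
      assume "j \<in> I"
      then obtain l where "(\<lambda>n. X (\<rho> n) j) \<longlonglongrightarrow> l" using \<rho>(2) by blast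
      from LIMSEQ_subseq_LIMSEQ[OF this \<sigma>(1)] show ?thesis by (auto simp: o_def)
    qed
  qed
qed

definition majority :: "real \<Rightarrow> 'i set \<Rightarrow> ('i \<Rightarrow> real) \<Rightarrow> bool" where
  "majority c I h \<longleftrightarrow> card I < 2 * card {i\<in>I. \<forall>j\<in>I. h j \<le> h i + c}"

text \<open>
This is \<open>taylor_coeff_le_circle_mean\<close> for the potential \<open>ln (expsum I q z)\<close>. It is nonnegative because
one member vanishes identically, it dominates \<open>2 * Re (q i z)\<close>, and its circle means are bounded
through the variance.
\<close>

lemma taylor_coeff_le_of_wvar_le:
  assumes I: "finite I" and hol: "\<And>i. i \<in> I \<Longrightarrow> q i holomorphic_on ball 0 R"
    and var: "\<And>z. z \<in> ball 0 R \<Longrightarrow> wvar I q z \<le> C"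
    and i0: "i0 \<in> I" "\<And>z. z \<in> ball 0 R \<Longrightarrow> q i0 z = 0"
    and b: "\<And>i. i \<in> I \<Longrightarrow> Re (q i 0) \<le> b"
    and r: "0 < r" "r < R" and i: "i \<in> I" and l: "1 \<le> l"
  shows "cmod (taylor_coeff (q i) l) \<le> 2 * (ln (card I) + 2 * b + C * r\<^sup>2 - Re (q i 0)) / r ^ l"
proof (rule taylor_coeff_le_circle_mean[OF hol[OF i] r _ _ _ _ l])
  have ne: "I \<noteq> {}" using i by auto
  let ?u = "\<lambda>t. ln (expsum I q (of_real r * cis t))"
  have inb: "of_real r * cis t \<in> ball 0 R" for t using r by (simp add: norm_mult)
  have "continuous_on {0..2*pi} ?u"
    by (rule continuous_on_compose2[OF continuous_on_ln_expsum[where q = q, OF I ne hol]])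
       (use inb in \<open>auto intro!: continuous_intros\<close>)
  then show "?u integrable_on {0..2*pi}" by (rule integrable_continuous_real)
  have ge: "exp (2 * Re (q j (of_real r * cis t))) \<le> expsum I q (of_real r * cis t)" if "j \<in> I" for j t
    by (rule exp_le_expsum[OF I that])
  have pos: "0 < expsum I q z" for z by (rule expsum_pos[OF I ne])
  show "0 \<le> ?u t" for t
    using ge[OF i0(1), of t] i0(2)[OF inb[of t]] by simp
  show "2 * Re (q i (of_real r * cis t)) \<le> ?u t" for t
    using ge[OF i, of t] pos ln_le_cancel_iff[of "exp (2 * Re (q i (of_real r * cis t)))" "expsum I q (of_real r * cis t)"]
    by (simp only: exp_gt_zero ln_exp)
  have c: "0 < card I" using I ne by (simp add: card_gt_0_iff)
  have "expsum I q 0 \<le> (\<Sum>i\<in>I. exp (2 * b))"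
    unfolding expsum_def using b by (intro sum_mono) auto
  also have "\<dots> = real (card I) * exp (2 * b)" by simp
  finally have "ln (expsum I q 0) \<le> ln (real (card I) * exp (2 * b))"
    using pos by (subst ln_le_cancel_iff) (use c in auto)
  also have "\<dots> = ln (card I) + 2 * b" using c by (simp add: ln_mult)
  finally have "ln (expsum I q 0) + C * r\<^sup>2 \<le> ln (card I) + 2 * b + C * r\<^sup>2" by simp
  then have "2 * pi * (ln (expsum I q 0) + C * r\<^sup>2) \<le> 2 * pi * (ln (card I) + 2 * b + C * r\<^sup>2)"
    by (intro mult_left_mono) auto
  with circle_integral_ln_expsum_le[where q = q, OF I ne hol var r]
  show "integral {0..2*pi} ?u \<le> 2 * pi * (ln (card I) + 2 * b + C * r\<^sup>2)"
    by (rule order_trans)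
qed

text \<open>
A majority survives in the limit: an index outside \<open>B\<close> leaves the majorities \<open>S x\<close> eventually,
so some \<open>S x\<close> lies inside \<open>B\<close>.
\<close>

lemma card_majority_of_eventually:
  assumes "finite I" and F: "\<And>x. card I < 2 * card (S x)" and "\<And>x. S x \<subseteq> I"
    and ev: "\<And>i. i \<in> I \<Longrightarrow> i \<notin> B \<Longrightarrow> eventually (\<lambda>x. i \<notin> S x) F" and "F \<noteq> bot" "B \<subseteq> I"
  shows "card I < 2 * card B"
proof -
  have "eventually (\<lambda>x. \<forall>i\<in>I - B. i \<notin> S x) F"
    using ev \<open>finite I\<close> by (intro eventually_ball_finite) auto
  then obtain x where "\<forall>i\<in>I - B. i \<notin> S x"
    using \<open>F \<noteq> bot\<close> eventually_happens by blast
  then have "S x \<subseteq> B" using assms(3) by blast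
  then have "card (S x) \<le> card B"
    using assms(1,6) finite_subset card_mono by metis
  then show ?thesis using F[of x] by simp
qed

text \<open>
Far out on a ray the quadratic terms decide which members are maximal, and the slack \<open>c\<close> is
negligible. Hence a strict majority of the \<open>a2 i\<close> is maximal in every direction and all \<open>a2 i\<close>
agree. Once they do, the linear terms decide, and the same argument applies to the \<open>a1 i\<close>.
\<close>

lemma quadratic_majority_constant:
  fixes a1 a2 :: "'i \<Rightarrow> complex" and a0 :: "'i \<Rightarrow> real"
  assumes fin: "finite I" and F: "F \<subseteq> I"
    and maj: "\<And>z. card I < 2 * card {i\<in>F. \<forall>j\<in>F. a0 j + Re (a1 j * z + a2 j * z\<^sup>2) \<le> a0 i + Re (a1 i * z + a2 i * z\<^sup>2) + c}"
  shows "\<exists>b. \<forall>i\<in>F. a1 i = b"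
proof -
  have ray: "card I < 2 * card {i\<in>F. \<forall>j\<in>F. a0 j + Re (a1 j * z) * t + Re (a2 j * z\<^sup>2) * t\<^sup>2
       \<le> a0 i + Re (a1 i * z) * t + Re (a2 i * z\<^sup>2) * t\<^sup>2 + c}" for z t
  proof -
    have e: "Re (a1 i * (of_real t * z) + a2 i * (of_real t * z)\<^sup>2) = Re (a1 i * z) * t + Re (a2 i * z\<^sup>2) * t\<^sup>2" for i
    proof -
      have "a1 i * (of_real t * z) + a2 i * (of_real t * z)\<^sup>2 = of_real t * (a1 i * z) + of_real (t\<^sup>2) * (a2 i * z\<^sup>2)"
        by (simp add: power_mult_distrib algebra_simps)
      then show ?thesis by (simp only: plus_complex.sel Re_complex_of_real_mult mult.commute)
    qed
    show ?thesis using maj[of "of_real t * z"] by (simp only: e add.assoc)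
  qed
  have "\<exists>b. \<forall>i\<in>F. a2 i = b"
  proof (rule majority_maximal_in_all_directions[OF fin F])
    fix w
    define z where "z = csqrt w"
    have z: "z\<^sup>2 = w" by (simp add: z_def)
    show "card I < 2 * card {i\<in>F. \<forall>j\<in>F. Re (a2 j * w) \<le> Re (a2 i * w)}"
    proof (rule card_majority_of_eventually[OF fin ray[where z = z], where F = at_top])
      fix i assume i: "i \<in> I" "i \<notin> {i\<in>F. \<forall>j\<in>F. Re (a2 j * w) \<le> Re (a2 i * w)}"
      show "eventually (\<lambda>t. i \<notin> {i\<in>F. \<forall>j\<in>F. a0 j + Re (a1 j * z) * t + Re (a2 j * z\<^sup>2) * t\<^sup>2
       \<le> a0 i + Re (a1 i * z) * t + Re (a2 i * z\<^sup>2) * t\<^sup>2 + c}) at_top"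
      proof (cases "i \<in> F")
        case True
        then obtain j where j: "j \<in> F" "0 < Re (a2 j * w) - Re (a2 i * w)" using True i by (auto simp: not_le)
        have "0 < D \<Longrightarrow> eventually (\<lambda>t::real. c < A + B * t + D * t\<^sup>2) at_top" for A B D :: real
          by real_asymp
        from this[OF j(2), of "a0 j - a0 i" "Re (a1 j * z) - Re (a1 i * z)"]
        show ?thesis
        proof eventually_elim
          case (elim t)
          then have "a0 i + Re (a1 i * z) * t + Re (a2 i * z\<^sup>2) * t\<^sup>2 + c <
            a0 j + Re (a1 j * z) * t + Re (a2 j * z\<^sup>2) * t\<^sup>2"
            unfolding z left_diff_distrib by linarith
          then show ?case using j(1) by (blast dest: leD)
        qed
      qed simp
    qed (use F in auto)
  qed
  then obtain b2 where b2: "\<And>i. i \<in> F \<Longrightarrow> a2 i = b2" by blast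
  show ?thesis
  proof (rule majority_maximal_in_all_directions[OF fin F])
    fix z
    show "card I < 2 * card {i\<in>F. \<forall>j\<in>F. Re (a1 j * z) \<le> Re (a1 i * z)}"
    proof (rule card_majority_of_eventually[OF fin ray[where z = z], where F = at_top])
      fix i assume i: "i \<in> I" "i \<notin> {i\<in>F. \<forall>j\<in>F. Re (a1 j * z) \<le> Re (a1 i * z)}"
      show "eventually (\<lambda>t. i \<notin> {i\<in>F. \<forall>j\<in>F. a0 j + Re (a1 j * z) * t + Re (a2 j * z\<^sup>2) * t\<^sup>2
       \<le> a0 i + Re (a1 i * z) * t + Re (a2 i * z\<^sup>2) * t\<^sup>2 + c}) at_top"
      proof (cases "i \<in> F")
        case True
        then obtain j where j: "j \<in> F" "0 < Re (a1 j * z) - Re (a1 i * z)" using True i by (auto simp: not_le)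
        have "0 < B \<Longrightarrow> eventually (\<lambda>t::real. c < A + B * t) at_top" for A B :: real
          by real_asymp
        from this[OF j(2), of "a0 j - a0 i"]
        show ?thesis
        proof eventually_elim
          case (elim t)
          then have "a0 i + Re (a1 i * z) * t + Re (b2 * z\<^sup>2) * t\<^sup>2 + c <
            a0 j + Re (a1 j * z) * t + Re (b2 * z\<^sup>2) * t\<^sup>2"
            unfolding left_diff_distrib by linarith
          then have "a0 i + Re (a1 i * z) * t + Re (a2 i * z\<^sup>2) * t\<^sup>2 + c <
            a0 j + Re (a1 j * z) * t + Re (a2 j * z\<^sup>2) * t\<^sup>2"
            by (simp only: b2[OF True] b2[OF j(1)])
          then show ?case using j(1) by (blast dest: leD)
        qed
      qed simp
    qed (use F in auto)
  qed
qed

lemma exp_minus_times_le: "0 \<le> (H::real) \<Longrightarrow> exp (- H) * H \<le> 2 * sqrt (exp (- H))"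
proof -
  assume "0 \<le> H"
  have "H / 2 \<le> exp (H / 2)" using exp_ge_add_one_self[of "H/2"] by linarith
  then have "exp (- H) * H \<le> exp (- H) * (2 * exp (H / 2))" by (intro mult_left_mono) auto
  also have "\<dots> = 2 * exp (- (H / 2))" by (simp add: mult_exp_exp algebra_simps)
  also have "exp (- (H / 2)) = sqrt (exp (- H))"
  proof (rule real_sqrt_unique[symmetric])
    show "(exp (- (H / 2)))\<^sup>2 = exp (- H)" by (simp add: power2_eq_square mult_exp_exp)
  qed simp
  finally show ?thesis .
qed

section \<open>Normality of families with a dominating majority\<close>

text \<open>
The shape into which a majority family is brought by a rescaling around a point of large
variance, after subtraction of the member with the largest real part at that point.
\<close>

definition normalized_tuple :: "real \<Rightarrow> 'i set \<Rightarrow> real \<Rightarrow> ('i \<Rightarrow> complex \<Rightarrow> complex) \<Rightarrow> bool" where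
  "normalized_tuple c I R q \<longleftrightarrow>
     (\<forall>i\<in>I. q i holomorphic_on ball 0 R) \<and>
     (\<forall>z\<in>ball 0 R. majority c I (\<lambda>i. Re (q i z))) \<and>
     (\<forall>z\<in>ball 0 R. wvar I q z \<le> 4) \<and>
     (\<exists>i\<in>I. \<forall>z\<in>ball 0 R. q i z = 0) \<and>
     (\<forall>i\<in>I. Re (q i 0) \<le> 0)"

text \<open>
Otherwise there are normalized tuples with variance 1 at 0 on discs of unbounded radius. The
variance is bounded by 4, so the Taylor coefficients of order three and more tend to zero and a
subsequence converges to quadratic polynomials, except for members whose real part tends to
\<open>-\<infinity>\<close>. A strict majority of the limits is maximal up to \<open>c\<close> at every point, so their linear
coefficients agree, and the variance at 0 tends to 0.
\<close>

lemma no_normalized_tuple_on_large_discs: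
  assumes fin: "finite I"
  shows "\<exists>R>0. \<forall>q. normalized_tuple c I R q \<longrightarrow> wvar I q 0 \<noteq> 1"
proof (rule ccontr)
  assume "\<not> ?thesis"
  then have "\<forall>n. \<exists>q. normalized_tuple c I (real (Suc n)) q \<and> wvar I q 0 = 1"
    by (meson of_nat_0_less_iff zero_less_Suc)
  then obtain q where q: "\<And>n. normalized_tuple c I (real (Suc n)) (q n)" and v1: "\<And>n. wvar I (q n) 0 = 1"
    by metis
  have hol: "q n i holomorphic_on ball 0 (real (Suc n))" if "i \<in> I" for n i
    using q[of n] that by (auto simp: normalized_tuple_def)
  have maj: "majority c I (\<lambda>i. Re (q n i z))" if "cmod z < Suc n" for n z
    using q[of n] that by (auto simp: normalized_tuple_def)
  have var: "wvar I (q n) z \<le> 4" if "z \<in> ball 0 (real (Suc n))" for n z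
    using q[of n] that by (auto simp: normalized_tuple_def)
  have "\<forall>n. \<exists>i\<in>I. \<forall>z\<in>ball 0 (real (Suc n)). q n i z = 0"
    using q by (auto simp: normalized_tuple_def)
  then obtain i0 where i0: "\<And>n. i0 n \<in> I" "\<And>n z. z \<in> ball 0 (real (Suc n)) \<Longrightarrow> q n (i0 n) z = 0"
    by metis
  define H where "H n i = - Re (q n i 0)" for n i
  have H0: "0 \<le> H n i" if "i \<in> I" for n i
    using q[of n] that by (auto simp: normalized_tuple_def H_def)
  define L where "L = ln (real (card I))"
  have ne: "I \<noteq> {}" using i0(1) by blast
  then have L0: "0 \<le> L" using fin by (simp add: L_def card_gt_0_iff Suc_leI)
  have coeff: "cmod (taylor_coeff (q n i) l) \<le> 2 * (L + 4 * r\<^sup>2 + H n i) / r ^ l"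
    if "i \<in> I" "0 < r" "r < real (Suc n)" "1 \<le> l" for n i r l
  proof -
    have b0: "Re (q n j 0) \<le> 0" if jI: "j \<in> I" for j using H0[OF jI, of n] by (simp add: H_def)
    from taylor_coeff_le_of_wvar_le[where q = "q n", OF fin hol var i0(1) i0(2) b0 that(2) that(3) that(1) that(4)]
    have "cmod (taylor_coeff (q n i) l) \<le> 2 * (ln (real (card I)) + 2 * 0 + 4 * r\<^sup>2 - Re (q n i 0)) / r ^ l" .
    then show ?thesis by (simp add: L_def H_def)
  qed
  have coeff12: "cmod (taylor_coeff (q n i) l) \<le> 8 * (L + 1 + H n i)" if "i \<in> I" "l \<in> {1, 2}" for n i l
    using coeff[OF that(1), of "1/2" n l] that(2) L0 H0[OF that(1), of n]
    by (auto simp: power2_eq_square)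
  define y where "y n i = exp (- H n i)" for n i
  have y0: "0 < y n i" for n i by (simp add: y_def)
  have y1: "y n i \<le> 1" if "i \<in> I" for n i using H0[OF that, of n] by (simp add: y_def)
  have ynz: "y n i \<noteq> 0" for n i by (simp add: y_def)
  have yc: "cmod (of_real (y n i) * taylor_coeff (q n i) l) \<le> 8 * ((L + 1) * y n i + 2 * sqrt (y n i))"
    if "i \<in> I" "l \<in> {1, 2}" for n i l
  proof -
    have "cmod (of_real (y n i) * taylor_coeff (q n i) l) = y n i * cmod (taylor_coeff (q n i) l)"
      using y0[of n i] by (simp add: norm_mult)
    also have "\<dots> \<le> y n i * (8 * (L + 1 + H n i))"
      using coeff12[OF that] y0[of n i] by (intro mult_left_mono) auto
    also have "\<dots> = 8 * ((L + 1) * y n i + y n i * H n i)" by (simp add: algebra_simps)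
    also have "\<dots> \<le> 8 * ((L + 1) * y n i + 2 * sqrt (y n i))"
      using exp_minus_times_le[OF H0[OF that(1), of n]] by (simp add: y_def mult.commute)
    finally show ?thesis .
  qed
  \<comment> \<open>The weights \<open>y n i\<close> may tend to 0 while the coefficients diverge; the products with the weights stay bounded.\<close>
  define X where "X n i = (y n i, of_real (y n i) * taylor_coeff (q n i) 1, of_real (y n i) * taylor_coeff (q n i) 2)" for n i
  have "bounded (range (\<lambda>n. X n i))" if i: "i \<in> I" for i
  proof -
    have s: "sqrt (y n i) \<le> 1" for n using y1[OF i, of n] by simp
    have "8 * ((L + 1) * y n i + 2 * sqrt (y n i)) \<le> 8 * ((L + 1) * 1 + 2 * 1)" for n
      using y1[OF i, of n] L0 s[of n] by (intro mult_left_mono add_mono) auto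
    then have b: "cmod (of_real (y n i) * taylor_coeff (q n i) l) \<le> 8 * ((L + 1) * 1 + 2 * 1)" if "l \<in> {1,2}" for n l
      by (rule order_trans[OF yc[OF i that]])
    have "range (\<lambda>n. X n i) \<subseteq> cball 0 1 \<times> cball 0 (8 * ((L + 1) * 1 + 2 * 1)) \<times> cball 0 (8 * ((L + 1) * 1 + 2 * 1))"
      using b[of 1] b[of 2] y1[OF i] y0 by (auto simp: X_def abs_of_pos)
    then show ?thesis
      by (rule bounded_subset[rotated]) (intro bounded_Times bounded_cball)
  qed
  from finite_family_convergent_subsequence[where X = X, OF fin this]
  obtain \<rho> where \<rho>: "strict_mono \<rho>" and "\<forall>i\<in>I. \<exists>l. (\<lambda>n. X (\<rho> n) i) \<longlonglongrightarrow> l" by blast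
  then obtain lm where lm: "\<And>i. i \<in> I \<Longrightarrow> (\<lambda>n. X (\<rho> n) i) \<longlonglongrightarrow> lm i" by metis
  define e where "e i = fst (lm i)" for i
  define d1 where "d1 i = fst (snd (lm i))" for i
  define d2 where "d2 i = snd (snd (lm i))" for i
  have lim: "(\<lambda>n. y (\<rho> n) i) \<longlonglongrightarrow> e i"
     "(\<lambda>n. of_real (y (\<rho> n) i) * taylor_coeff (q (\<rho> n) i) 1) \<longlonglongrightarrow> d1 i"
     "(\<lambda>n. of_real (y (\<rho> n) i) * taylor_coeff (q (\<rho> n) i) 2) \<longlonglongrightarrow> d2 i" if "i \<in> I" for i
    using tendsto_fst[OF lm[OF that]] tendsto_fst[OF tendsto_snd[OF lm[OF that]]]
      tendsto_snd[OF tendsto_snd[OF lm[OF that]]] by (simp_all add: X_def e_def d1_def d2_def)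
  have e0: "0 \<le> e i" if "i \<in> I" for i
    by (rule LIMSEQ_le_const[OF lim(1)[OF that]]) (use y0 less_imp_le in blast)
  define F where "F = {i\<in>I. 0 < e i}"
  define a1 where "a1 i = d1 i / of_real (e i)" for i
  define a2 where "a2 i = d2 i / of_real (e i)" for i
  have \<rho>_top: "filterlim (\<lambda>n. real (Suc (\<rho> n))) at_top sequentially"
    using filterlim_compose[OF filterlim_real_sequentially filterlim_subseq[OF \<rho>]]
    by (rule filterlim_at_top_mono) auto
  \<comment> \<open>The Taylor remainder after the quadratic term, taken on the disc of half the radius, tends to 0.\<close>
  have limF: "(\<lambda>n. Re (q (\<rho> n) i z)) \<longlonglongrightarrow> ln (e i) + Re (a1 i * z + a2 i * z\<^sup>2)" if i: "i \<in> F" for i z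
  proof -
    have iI: "i \<in> I" and ei: "0 < e i" using i by (auto simp: F_def)
    have c: "(\<lambda>n. taylor_coeff (q (\<rho> n) i) l) \<longlonglongrightarrow> d / of_real (e i)"
      if "(\<lambda>n. of_real (y (\<rho> n) i) * taylor_coeff (q (\<rho> n) i) l) \<longlonglongrightarrow> d" for l d
    proof -
      have "(\<lambda>n. of_real (y (\<rho> n) i) * taylor_coeff (q (\<rho> n) i) l / of_real (y (\<rho> n) i)) \<longlonglongrightarrow> d / of_real (e i)"
        by (intro tendsto_divide that tendsto_of_real lim(1)[OF iI]) (use ei in auto)
      then show ?thesis by (simp add: ynz)
    qed
    have c12: "(\<lambda>n. taylor_coeff (q (\<rho> n) i) 1) \<longlonglongrightarrow> a1 i" "(\<lambda>n. taylor_coeff (q (\<rho> n) i) 2) \<longlonglongrightarrow> a2 i"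
      using c[OF lim(2)[OF iI]] c[OF lim(3)[OF iI]] by (simp_all add: a1_def a2_def)
    have "(\<lambda>n. ln (y (\<rho> n) i)) \<longlonglongrightarrow> ln (e i)"
      by (intro tendsto_ln lim(1)[OF iI]) (use ei in auto)
    then have Hl: "(\<lambda>n. H (\<rho> n) i) \<longlonglongrightarrow> - ln (e i)"
      using tendsto_minus[of "\<lambda>n. - H (\<rho> n) i" "ln (e i)"] by (simp add: y_def)
    define x where "x n = 2 * inverse (real (Suc (\<rho> n)))" for n
    have x0: "x \<longlonglongrightarrow> 0"
      unfolding x_def using tendsto_mult_right_zero[OF tendsto_inverse_0_at_top[OF \<rho>_top]] by simp
    have "(\<lambda>n. 2 * ((L + H (\<rho> n) i) * (x n)\<^sup>2 + 4) * cmod z ^ 3 * x n / (1 - cmod z * x n)) \<longlonglongrightarrow>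
       2 * ((L + (- ln (e i))) * 0\<^sup>2 + 4) * cmod z ^ 3 * 0 / (1 - cmod z * 0)"
      by (intro tendsto_intros x0 Hl) auto
    then have bd0: "(\<lambda>n. 2 * ((L + H (\<rho> n) i) * (x n)\<^sup>2 + 4) * cmod z ^ 3 * x n / (1 - cmod z * x n)) \<longlonglongrightarrow> 0"
      by simp
    have rem: "(\<lambda>n. q (\<rho> n) i z - (\<Sum>l<3. taylor_coeff (q (\<rho> n) i) l * z ^ l)) \<longlonglongrightarrow> 0"
    proof (rule Lim_null_comparison[OF _ bd0])
      have "eventually (\<lambda>n. 2 * cmod z < real (Suc (\<rho> n))) sequentially"
        using \<rho>_top by (simp add: filterlim_at_top_dense)
      then show "\<forall>\<^sub>F n in sequentially. cmod (q (\<rho> n) i z - (\<Sum>l<3. taylor_coeff (q (\<rho> n) i) l * z ^ l))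
           \<le> 2 * ((L + H (\<rho> n) i) * (x n)\<^sup>2 + 4) * cmod z ^ 3 * x n / (1 - cmod z * x n)"
      proof eventually_elim
        case (elim n)
        define r where "r = real (Suc (\<rho> n)) / 2"
        have r: "0 < r" "r < real (Suc (\<rho> n))" "cmod z < r" using elim by (auto simp: r_def)
        have xr: "x n = 1 / r" by (simp add: x_def r_def field_simps)
        have "cmod (q (\<rho> n) i z - (\<Sum>l<3. taylor_coeff (q (\<rho> n) i) l * z ^ l))
           \<le> 2 * (L + 4 * r\<^sup>2 + H (\<rho> n) i) * ((cmod z / r) ^ 3 / (1 - cmod z / r))"
          by (rule taylor_remainder_le[OF hol[OF iI] r(1,2) coeff[OF iI r(1,2)] r(3)]) auto
        also have "\<dots> = 2 * ((L + H (\<rho> n) i) * (x n)\<^sup>2 + 4) * cmod z ^ 3 * x n / (1 - cmod z * x n)"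
        proof -
          have key: "(L + 4 * r\<^sup>2 + H (\<rho> n) i) * (cmod z / r) ^ 3 = ((L + H (\<rho> n) i) * (x n)\<^sup>2 + 4) * cmod z ^ 3 * x n"
            using r(1) by (simp add: xr field_simps power2_eq_square power3_eq_cube)
          have "2 * S * (E / D) = 2 * (S * E) / D" for S E D :: real by simp
          from this[of "L + 4 * r\<^sup>2 + H (\<rho> n) i" "(cmod z / r) ^ 3" "1 - cmod z / r", unfolded key]
          show ?thesis by (simp only: xr times_divide_eq_right mult_1_right mult.assoc)
        qed
        finally show ?case .
      qed
    qed
    have "(\<lambda>n. Re (q (\<rho> n) i z - (\<Sum>l<3. taylor_coeff (q (\<rho> n) i) l * z ^ l))
        + (- H (\<rho> n) i) + Re (taylor_coeff (q (\<rho> n) i) 1 * z + taylor_coeff (q (\<rho> n) i) 2 * z\<^sup>2))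
        \<longlonglongrightarrow> Re 0 + (- (- ln (e i))) + Re (a1 i * z + a2 i * z\<^sup>2)"
      by (intro tendsto_intros rem Hl c12)
    moreover have "Re (q (\<rho> n) i z - (\<Sum>l<3. taylor_coeff (q (\<rho> n) i) l * z ^ l))
        + (- H (\<rho> n) i) + Re (taylor_coeff (q (\<rho> n) i) 1 * z + taylor_coeff (q (\<rho> n) i) 2 * z\<^sup>2) = Re (q (\<rho> n) i z)" for n
    proof -
      have "(\<Sum>l<3. taylor_coeff (q (\<rho> n) i) l * z ^ l)
        = q (\<rho> n) i 0 + (taylor_coeff (q (\<rho> n) i) 1 * z + taylor_coeff (q (\<rho> n) i) 2 * z\<^sup>2)"
        by (simp add: eval_nat_numeral taylor_coeff_def[of _ 0])
      then show ?thesis by (simp only: minus_complex.sel plus_complex.sel H_def)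
    qed
    ultimately show ?thesis by (simp only: zero_complex.sel add_0_left minus_minus)
  qed
  \<comment> \<open>A member whose weight tends to 0 sinks to \<open>-\<infinity>\<close> at every point.\<close>
  have limN: "filterlim (\<lambda>n. Re (q (\<rho> n) i z)) at_bot sequentially" if i: "i \<in> I" "i \<notin> F" for i z
  proof -
    have ei: "e i = 0" using i e0[of i] by (auto simp: F_def)
    have "filterlim (\<lambda>n. y (\<rho> n) i) (at_right 0) sequentially"
      using lim(1)[OF i(1)] y0 ynz by (auto simp: filterlim_at ei)
    from filterlim_compose[OF ln_at_0 this]
    have mH: "filterlim (\<lambda>n. - H (\<rho> n) i) at_bot sequentially" by (simp add: y_def)
    define r where "r = 5 * cmod z + 1"
    have r: "0 < r" "cmod z < r" using norm_ge_zero[of z] unfolding r_def by linarith+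
    show ?thesis
      unfolding filterlim_at_bot
    proof
      fix Z
      have "eventually (\<lambda>n. - H (\<rho> n) i \<le> 2 * (Z - (L + 4 * r\<^sup>2) / 2)) sequentially"
        using mH unfolding filterlim_at_bot by blast
      moreover have "eventually (\<lambda>n. r < real (Suc (\<rho> n))) sequentially"
        using \<rho>_top by (simp add: filterlim_at_top_dense)
      ultimately show "eventually (\<lambda>n. Re (q (\<rho> n) i z) \<le> Z) sequentially"
      proof eventually_elim
        case (elim n)
        have "cmod (q (\<rho> n) i z - (\<Sum>l<1. taylor_coeff (q (\<rho> n) i) l * z ^ l))
           \<le> 2 * (L + 4 * r\<^sup>2 + H (\<rho> n) i) * ((cmod z / r) ^ 1 / (1 - cmod z / r))"
          by (rule taylor_remainder_le[OF hol[OF i(1)] r(1) elim(2) coeff[OF i(1) r(1) elim(2)] r(2)]) auto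
        also have "(cmod z / r) ^ 1 / (1 - cmod z / r) = cmod z / (r - cmod z)"
          using r by (simp add: field_simps)
        also have "2 * (L + 4 * r\<^sup>2 + H (\<rho> n) i) * (cmod z / (r - cmod z)) \<le> 2 * (L + 4 * r\<^sup>2 + H (\<rho> n) i) * (1 / 4)"
        proof (intro mult_left_mono)
          show "cmod z / (r - cmod z) \<le> 1 / 4" using r by (simp add: divide_le_eq r_def)
          show "0 \<le> 2 * (L + 4 * r\<^sup>2 + H (\<rho> n) i)" using L0 H0[OF i(1), of "\<rho> n"] by simp
        qed
        finally have "cmod (q (\<rho> n) i z - q (\<rho> n) i 0) \<le> (L + 4 * r\<^sup>2 + H (\<rho> n) i) / 2"
          by (simp add: taylor_coeff_def)
        then have "Re (q (\<rho> n) i z - q (\<rho> n) i 0) \<le> (L + 4 * r\<^sup>2 + H (\<rho> n) i) / 2"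
          using complex_Re_le_cmod order_trans by blast
        then show ?case using elim(1) by (simp add: H_def field_simps)
      qed
    qed
  qed
  have "\<exists>b. \<forall>i\<in>F. a1 i = b"
  proof (rule quadratic_majority_constant[OF fin, where ?a0.0 = "\<lambda>i. ln (e i)" and ?a2.0 = a2 and c = c])
    show "F \<subseteq> I" by (auto simp: F_def)
    fix z
    let ?Q = "\<lambda>i. ln (e i) + Re (a1 i * z + a2 i * z\<^sup>2)"
    let ?B = "{i\<in>F. \<forall>j\<in>F. ?Q j \<le> ?Q i + c}"
    let ?S = "\<lambda>n. {i\<in>I. \<forall>j\<in>I. Re (q (\<rho> n) j z) \<le> Re (q (\<rho> n) i z) + c}"
    have evz: "eventually (\<lambda>n. cmod z < real (Suc (\<rho> n))) sequentially"
      using \<rho>_top by (simp add: filterlim_at_top_dense)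
    let ?S' = "\<lambda>n. if cmod z < real (Suc (\<rho> n)) then ?S n else I"
    have cI: "0 < card I" using fin ne by (simp add: card_gt_0_iff)
    show "card I < 2 * card ?B"
    proof (rule card_majority_of_eventually[OF fin, where S = ?S' and F = sequentially])
      show "card I < 2 * card (?S' n)" for n
      proof (cases "cmod z < real (Suc (\<rho> n))")
        case True
        then show ?thesis using maj[OF True] unfolding majority_def by (simp only: if_True)
      qed (use cI in simp)
      fix i assume i: "i \<in> I" "i \<notin> ?B"
      have "eventually (\<lambda>n. i \<notin> ?S n) sequentially"
      proof (cases "i \<in> F")
        case True
        then obtain j where j: "j \<in> F" "\<not> ?Q j \<le> ?Q i + c" using i(2) by blast
        have dl: "(\<lambda>n. Re (q (\<rho> n) j z) - (Re (q (\<rho> n) i z) + c)) \<longlonglongrightarrow> ?Q j - (?Q i + c)"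
          by (rule tendsto_diff[OF limF[OF j(1)] tendsto_add[OF limF[OF True] tendsto_const]])
        have "eventually (\<lambda>n. 0 < Re (q (\<rho> n) j z) - (Re (q (\<rho> n) i z) + c)) sequentially"
          by (rule order_tendstoD(1)[OF dl]) (use j(2) in linarith)
        then show ?thesis
        proof eventually_elim
          case (elim n)
          then have "\<not> Re (q (\<rho> n) j z) \<le> Re (q (\<rho> n) i z) + c" by linarith
          moreover have "j \<in> I" using j(1) by (simp add: F_def)
          ultimately show ?case by blast
        qed
      next
        case False
        have "eventually (\<lambda>n. Re (q (\<rho> n) i z) < - c) sequentially"
          using limN[OF i(1) False] by (simp add: filterlim_at_bot_dense)
        with evz show ?thesis
        proof eventually_elim
          case (elim n)
          have "q (\<rho> n) (i0 (\<rho> n)) z = 0" using elim by (intro i0(2)) auto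
          then have "\<not> Re (q (\<rho> n) (i0 (\<rho> n)) z) \<le> Re (q (\<rho> n) i z) + c" using elim by simp
          then show ?case using i0(1) by blast
        qed
      qed
      with evz show "eventually (\<lambda>n. i \<notin> ?S' n) sequentially"
        by eventually_elim simp
    qed (auto simp: F_def)
  qed
  then obtain b where b: "\<And>i. i \<in> F \<Longrightarrow> a1 i = b" by blast
  have d1: "d1 i = of_real (e i) * b" if i: "i \<in> I" for i
  proof (cases "i \<in> F")
    case True
    then show ?thesis using b[OF True] by (auto simp: a1_def F_def field_simps)
  next
    case False
    then have ei: "e i = 0" using i e0[of i] by (auto simp: F_def)
    have "(\<lambda>n. 8 * ((L + 1) * y (\<rho> n) i + 2 * sqrt (y (\<rho> n) i))) \<longlonglongrightarrow> 8 * ((L + 1) * 0 + 2 * sqrt 0)"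
      using lim(1)[OF i] unfolding ei by (intro tendsto_intros)
    then have "(\<lambda>n. 8 * ((L + 1) * y (\<rho> n) i + 2 * sqrt (y (\<rho> n) i))) \<longlonglongrightarrow> 0" by simp
    then have "(\<lambda>n. of_real (y (\<rho> n) i) * taylor_coeff (q (\<rho> n) i) 1) \<longlonglongrightarrow> 0"
      by (rule Lim_null_comparison[rotated]) (rule always_eventually, use yc[OF i] in simp)
    from LIMSEQ_unique[OF this lim(2)[OF i]] show ?thesis by (simp add: ei)
  qed
  have ex2: "exp (2 * Re (q n i 0)) = (y n i)\<^sup>2" for n i
    by (simp add: y_def H_def power2_eq_square mult_exp_exp)
  have S: "(\<lambda>n. expsum I (q (\<rho> n)) 0) \<longlonglongrightarrow> (\<Sum>i\<in>I. (e i)\<^sup>2)"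
    unfolding expsum_def ex2 by (intro tendsto_intros lim)
  have "1 \<le> (\<Sum>i\<in>I. (e i)\<^sup>2)"
  proof (rule LIMSEQ_le_const[OF S], intro exI allI impI)
    fix n
    show "1 \<le> expsum I (q (\<rho> n)) 0"
      using exp_le_expsum[OF fin i0(1)[of "\<rho> n"], of "q (\<rho> n)" 0] i0(2)[of 0 "\<rho> n"] by simp
  qed
  then have S0: "(\<Sum>i\<in>I. (e i)\<^sup>2) \<noteq> 0" by linarith
  have dv: "deriv (q n i) 0 = taylor_coeff (q n i) 1" for n i by (simp add: taylor_coeff_def)
  have M: "(\<lambda>n. wmean I (q (\<rho> n)) 0) \<longlonglongrightarrow> (\<Sum>i\<in>I. of_real (e i) * d1 i) / of_real (\<Sum>i\<in>I. (e i)\<^sup>2)"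
    unfolding wmean_def
  proof (intro tendsto_divide tendsto_of_real S tendsto_sum)
    fix i assume "i \<in> I"
    from tendsto_mult[OF tendsto_of_real[OF lim(1)[OF this]] lim(2)[OF this]]
    show "(\<lambda>n. of_real (exp (2 * Re (q (\<rho> n) i 0))) * deriv (q (\<rho> n) i) 0) \<longlonglongrightarrow> of_real (e i) * d1 i"
      by (simp only: ex2 dv power2_eq_square of_real_mult mult.assoc)
  qed (use S0 in \<open>simp only: of_real_eq_0_iff not_False_eq_True\<close>)
  have V: "(\<lambda>n. wvar I (q (\<rho> n)) 0) \<longlonglongrightarrow> (\<Sum>i\<in>I. (cmod (d1 i))\<^sup>2) / (\<Sum>i\<in>I. (e i)\<^sup>2)
      - (cmod ((\<Sum>i\<in>I. of_real (e i) * d1 i) / of_real (\<Sum>i\<in>I. (e i)\<^sup>2)))\<^sup>2"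
    unfolding wvar_def
  proof (intro tendsto_diff tendsto_divide S S0 tendsto_sum tendsto_power tendsto_norm M)
    fix i assume "i \<in> I"
    from tendsto_power[OF tendsto_norm[OF lim(2)[OF this]], of 2]
    show "(\<lambda>n. exp (2 * Re (q (\<rho> n) i 0)) * (cmod (deriv (q (\<rho> n) i) 0))\<^sup>2) \<longlonglongrightarrow> (cmod (d1 i))\<^sup>2"
      by (simp only: ex2 dv norm_mult norm_of_real power_mult_distrib power2_abs)
  qed
  define s where "s = (\<Sum>i\<in>I. (e i)\<^sup>2)"
  have A: "(\<Sum>i\<in>I. (cmod (d1 i))\<^sup>2) = s * (cmod b)\<^sup>2"
    unfolding sum_distrib_right s_def by (intro sum.cong) (simp_all add: d1 norm_mult power_mult_distrib)
  have B: "(\<Sum>i\<in>I. of_real (e i) * d1 i) = of_real s * b"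
    unfolding s_def of_real_sum sum_distrib_right by (intro sum.cong) (simp_all add: d1 power2_eq_square)
  have "s * (cmod b)\<^sup>2 / s - (cmod (of_real s * b / of_real s))\<^sup>2 = 0"
    using S0 by (simp add: s_def[symmetric])
  with V have "(\<lambda>n. wvar I (q (\<rho> n)) 0) \<longlonglongrightarrow> 0"
    unfolding A B s_def[symmetric] by (simp only:)
  then have "(\<lambda>n. 1::real) \<longlonglongrightarrow> 0" by (simp only: v1)
  then show False by (simp add: LIMSEQ_const_iff)
qed

text \<open>
Adding a common holomorphic function shifts the mean of the derivatives but not their variance;
it also multiplies all weights by a common factor. Rescaling the variable by \<open>r\<close> multiplies the
derivatives by \<open>r\<close>.
\<close>

lemma wvar_affine:
  assumes I: "finite I" "I \<noteq> {}" and r: "0 \<le> r"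
    and d: "\<And>i. i \<in> I \<Longrightarrow> q i field_differentiable at (a + of_real r * z)" and g: "g field_differentiable at (a + of_real r * z)"
  shows "wvar I (\<lambda>i z. q i (a + of_real r * z) - g (a + of_real r * z)) z = r\<^sup>2 * wvar I q (a + of_real r * z)"
proof -
  let ?w = "a + of_real r * z"
  let ?q = "\<lambda>i z. q i (a + of_real r * z) - g (a + of_real r * z)"
  define e where "e i = exp (2 * Re (q i ?w))" for i
  define x where "x i = deriv (q i) ?w" for i
  define G where "G = deriv g ?w"
  define k where "k = exp (- 2 * Re (g ?w))"
  define S where "S = expsum I q ?w"
  have S: "S > 0" using expsum_pos[OF I] by (simp add: S_def)
  have k: "k > 0" by (simp add: k_def)
  have ex: "exp (2 * Re (?q i z)) = k * e i" for i
    by (simp add: e_def k_def mult_exp_exp algebra_simps)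
  have Sq: "expsum I ?q z = k * S"
    by (simp only: expsum_def ex S_def e_def sum_distrib_left)
  have dq: "deriv (?q i) z = of_real r * (x i - G)" if "i \<in> I" for i
  proof (rule DERIV_imp_deriv)
    have af: "((\<lambda>z. a + of_real r * z) has_field_derivative of_real r) (at z)"
      by (auto intro!: derivative_eq_intros)
    have 1: "(q i has_field_derivative x i) (at ?w)" "(g has_field_derivative G) (at ?w)"
      using d[OF that] g by (simp_all add: x_def G_def field_differentiable_derivI)
    have "(?q i has_field_derivative x i * of_real r - G * of_real r) (at z)"
      by (intro DERIV_diff DERIV_chain2[OF 1(1) af] DERIV_chain2[OF 1(2) af])
    then show "(?q i has_field_derivative of_real r * (x i - G)) (at z)"
      by (simp add: algebra_simps)
  qed
  define E where "E = wmean I q ?w"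
  have ES: "(\<Sum>i\<in>I. of_real (e i) * x i) = of_real S * E"
    using S by (simp add: E_def wmean_def S_def[symmetric] e_def x_def)
  have SS: "(\<Sum>i\<in>I. e i) = S" by (simp add: S_def expsum_def e_def)
  have "wmean I ?q z = (\<Sum>i\<in>I. of_real (k * e i) * (of_real r * (x i - G))) / of_real (k * S)"
    unfolding wmean_def Sq ex by (intro arg_cong2[where f = divide] sum.cong refl) (simp only: dq)
  also have "(\<Sum>i\<in>I. of_real (k * e i) * (of_real r * (x i - G)))
      = of_real (k * r) * ((\<Sum>i\<in>I. of_real (e i) * x i) - of_real (\<Sum>i\<in>I. e i) * G)"
    by (simp add: sum_distrib_left sum_distrib_right sum_subtractf algebra_simps)
  also have "\<dots> / of_real (k * S) = of_real r * (E - G)"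
    unfolding ES SS using S k by (simp add: field_simps)
  finally have M: "wmean I ?q z = of_real r * (E - G)" .
  have sq: "(cmod (x - y))\<^sup>2 = (cmod x)\<^sup>2 + (cmod y)\<^sup>2 - 2 * Re (x * cnj y)" for x y
    unfolding cmod_power2 by (simp add: power2_eq_square algebra_simps)
  have num: "(\<Sum>i\<in>I. e i * (cmod (x i - G))\<^sup>2) = (\<Sum>i\<in>I. e i * (cmod (x i))\<^sup>2) + S * (cmod G)\<^sup>2 - 2 * S * Re (E * cnj G)"
  proof -
    have "(\<Sum>i\<in>I. e i * (cmod (x i - G))\<^sup>2) = (\<Sum>i\<in>I. e i * (cmod (x i))\<^sup>2) + (\<Sum>i\<in>I. e i) * (cmod G)\<^sup>2
        - 2 * Re ((\<Sum>i\<in>I. of_real (e i) * x i) * cnj G)"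
      unfolding sq by (simp add: sum_distrib_left sum_distrib_right sum_subtractf sum.distrib algebra_simps)
    then show ?thesis unfolding SS ES by (simp add: algebra_simps)
  qed
  have "wvar I ?q z = (\<Sum>i\<in>I. (k * e i) * (cmod (of_real r * (x i - G)))\<^sup>2) / (k * S) - (cmod (of_real r * (E - G)))\<^sup>2"
    unfolding wvar_def Sq ex M by (intro arg_cong2[where f = minus] arg_cong2[where f = divide] sum.cong refl) (simp only: dq)
  also have "(\<Sum>i\<in>I. (k * e i) * (cmod (of_real r * (x i - G)))\<^sup>2) = k * r\<^sup>2 * (\<Sum>i\<in>I. e i * (cmod (x i - G))\<^sup>2)"
    unfolding sum_distrib_left
    by (intro sum.cong refl) (simp only: norm_mult norm_of_real power_mult_distrib power2_abs mult_ac)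
  also have "k * r\<^sup>2 * (\<Sum>i\<in>I. e i * (cmod (x i - G))\<^sup>2) / (k * S) - (cmod (of_real r * (E - G)))\<^sup>2
     = r\<^sup>2 * ((\<Sum>i\<in>I. e i * (cmod (x i))\<^sup>2) / S - (cmod E)\<^sup>2)"
    unfolding num norm_mult norm_of_real power_mult_distrib power2_abs sq[of E G]
    using S k by (simp add: field_simps)
  also have "\<dots> = r\<^sup>2 * wvar I q ?w"
    by (simp only: wvar_def S_def e_def x_def E_def)
  finally show ?thesis .
qed

text \<open>
The rescaling argument of Zalcman. If the variance is too large somewhere, then there is a point
around which it is at most four times its value at the point, on a disc that is large compared
with the natural length scale \<open>1 / sqrt V\<close> there. Rescaling produces a normalized tuple with
variance 1 at the centre on a disc of the forbidden radius.
\<close>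

lemma wvar_le_inverse_boundary_distance:
  assumes fin: "finite (I :: 'i set)"
  shows "\<exists>K>0. \<forall>q. (\<forall>i\<in>I. q i holomorphic_on ball 0 1) \<longrightarrow>
           (\<forall>z\<in>ball 0 1. majority c I (\<lambda>i. Re (q i z))) \<longrightarrow>
           (\<forall>z\<in>ball 0 1. wvar I q z * (1 - cmod z)\<^sup>2 \<le> K)"
proof -
  obtain R where R: "R > 0" and none: "\<And>q::'i \<Rightarrow> complex \<Rightarrow> complex. normalized_tuple c I R q \<Longrightarrow> wvar I q 0 \<noteq> 1"
    using no_normalized_tuple_on_large_discs[OF fin] by blast
  define K where "K = 4 * R\<^sup>2"
  have K: "K > 0" using R by (simp add: K_def)
  have "wvar I q z1 * (1 - cmod z1)\<^sup>2 \<le> K"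
    if hol: "\<And>i. i \<in> I \<Longrightarrow> q i holomorphic_on ball 0 1"
      and maj: "\<And>z. z \<in> ball 0 1 \<Longrightarrow> majority c I (\<lambda>i. Re (q i z))"
      and z1: "z1 \<in> ball 0 1" for q :: "'i \<Rightarrow> complex \<Rightarrow> complex" and z1
  proof (rule ccontr)
    assume "\<not> ?thesis"
    then have gt: "K < wvar I q z1 * (1 - cmod z1)\<^sup>2" by simp
    have ne: "I \<noteq> {}" using maj[OF z1] by (auto simp: majority_def)
    define v where "v = wvar I q z1"
    define d where "d = 1 - cmod z1"
    have d: "d > 0" using z1 by (simp add: d_def)
    have "0 < v * d\<^sup>2" using gt K by (simp only: v_def d_def)
    then have v: "v > 0" using d by (simp add: zero_less_mult_iff)
    have Kd: "sqrt (K / v) < d"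
    proof (rule real_less_lsqrt)
      show "K / v < d\<^sup>2" using gt v by (simp add: v_def[symmetric] d_def[symmetric] field_simps)
    qed (use d in auto)
    obtain t where t1: "sqrt (K / v) < t" and t2: "t < d" using dense[OF Kd] by blast
    have sK: "0 < sqrt (K / v)" using K v by simp
    have t3: "0 < t" using less_trans[OF sK t1] .
    note t = t1 t2 t3
    have tK: "K < t\<^sup>2 * v"
    proof -
      have "K / v = (sqrt (K / v))\<^sup>2" using K v by simp
      also have "\<dots> < t\<^sup>2" by (rule power_strict_mono[OF t(1) less_imp_le[OF sK]]) simp
      finally show ?thesis using v by (simp add: field_simps)
    qed
    define s where "s = cmod z1 + t"
    have s: "0 < s" "s < 1" "cmod z1 < s" using t by (simp_all add: s_def d_def add_nonneg_pos)
    \<comment> \<open>A maximum point of this product is the centre of the rescaling.\<close>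
    define \<phi> where "\<phi> z = (s - cmod z)\<^sup>2 * wvar I q z" for z
    have "continuous_on (cball 0 s) (wvar I q)"
      by (rule continuous_on_subset[OF continuous_on_wvar[where q = q, OF fin ne hol]]) (use s in auto)
    then have "continuous_on (cball 0 s) \<phi>"
      unfolding \<phi>_def by (intro continuous_on_mult continuous_on_power continuous_on_diff continuous_on_const
          continuous_on_norm continuous_on_id)
    from continuous_attains_sup[OF compact_cball _ this] s
    obtain a where a: "a \<in> cball 0 s" and amax: "\<And>z. z \<in> cball 0 s \<Longrightarrow> \<phi> z \<le> \<phi> a" by force
    have pa: "K < \<phi> a"
      using amax[of z1] tK s by (simp add: \<phi>_def s_def v_def)
    then have "\<phi> a \<noteq> 0" using K by simp
    then have as: "cmod a < s" using a by (cases "cmod a = s") (auto simp: \<phi>_def)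
    define V where "V = wvar I q a"
    define \<delta> where "\<delta> = (s - cmod a) / 2"
    have \<delta>: "\<delta> > 0" using as by (simp add: \<delta>_def)
    have pV: "\<phi> a = 4 * \<delta>\<^sup>2 * V" by (simp add: \<phi>_def \<delta>_def V_def power2_eq_square algebra_simps)
    have "0 < (4 * \<delta>\<^sup>2) * V" using less_trans[OF K pa] unfolding pV .
    then have V: "V > 0" using \<delta> by (simp add: zero_less_mult_iff)
    have V4: "wvar I q z \<le> 4 * V" if "cmod (z - a) < \<delta>" for z
    proof -
      have "cmod z \<le> cmod a + cmod (z - a)" using norm_triangle_ineq[of a "z - a"] by simp
      then have sz: "\<delta> \<le> s - cmod z" using that by (simp add: \<delta>_def)
      show ?thesis
      proof (cases "0 \<le> wvar I q z")
        case True
        have "\<delta>\<^sup>2 * wvar I q z \<le> \<phi> z"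
          unfolding \<phi>_def using sz \<delta> True by (intro mult_right_mono power_mono) auto
        also have "\<dots> \<le> 4 * \<delta>\<^sup>2 * V" using amax[of z] sz \<delta> by (simp add: pV)
        finally have "\<delta>\<^sup>2 * wvar I q z \<le> \<delta>\<^sup>2 * (4 * V)" by simp
        then show ?thesis using \<delta> by (simp add: mult_le_cancel_left_pos)
      qed (use V in simp)
    qed
    define \<rho> where "\<rho> = 1 / sqrt V"
    have \<rho>: "\<rho> > 0" "\<rho>\<^sup>2 * V = 1" using V by (auto simp: \<rho>_def power_divide)
    have \<rho>R: "\<rho> * R < \<delta>"
    proof (rule power2_less_imp_less)
      have "R\<^sup>2 < \<delta>\<^sup>2 * V" using pa unfolding pV K_def by simp
      then have "\<rho>\<^sup>2 * R\<^sup>2 < \<rho>\<^sup>2 * (\<delta>\<^sup>2 * V)" using \<rho>(1) by simp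
      also have "\<dots> = \<delta>\<^sup>2 * (\<rho>\<^sup>2 * V)" by (simp only: mult_ac)
      finally show "(\<rho> * R)\<^sup>2 < \<delta>\<^sup>2" by (simp only: \<rho>(2) power_mult_distrib mult_1_right)
    qed (use \<delta> in simp)
    obtain i0 where i0: "i0 \<in> I" "\<And>i. i \<in> I \<Longrightarrow> Re (q i a) \<le> Re (q i0 a)"
    proof -
      have "Max ((\<lambda>i. Re (q i a)) ` I) \<in> (\<lambda>i. Re (q i a)) ` I" using fin ne by (intro Max_in) auto
      then obtain i0 where i0: "i0 \<in> I" "Max ((\<lambda>i. Re (q i a)) ` I) = Re (q i0 a)" by blast
      have "Re (q i a) \<le> Re (q i0 a)" if "i \<in> I" for i
        using Max_ge[OF finite_imageI[OF fin] imageI[OF that, of "\<lambda>i. Re (q i a)"]] i0(2) by simp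
      then show ?thesis by (rule that[OF i0(1)])
    qed
    have dist: "cmod (of_real \<rho> * z) < \<delta>" if "cmod z < R" for z
    proof -
      have "\<rho> * cmod z \<le> \<rho> * R" using that \<rho>(1) by (intro mult_left_mono) auto
      from le_less_trans[OF this \<rho>R] show ?thesis using \<rho>(1) by (simp add: norm_mult)
    qed
    have inb: "a + of_real \<rho> * z \<in> ball 0 1" if "cmod z < R" for z
      using norm_triangle_ineq[of a "of_real \<rho> * z"] dist[OF that] s as by (simp add: \<delta>_def)
    define p where "p = (\<lambda>i z. q i (a + of_real \<rho> * z) - q i0 (a + of_real \<rho> * z))"
    have diff: "q i field_differentiable at (a + of_real \<rho> * z)" if "i \<in> I" "cmod z < R" for i z
      using holomorphic_on_imp_differentiable_at[OF hol[OF that(1)] open_ball inb[OF that(2)]] .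
    have pv: "wvar I p z = \<rho>\<^sup>2 * wvar I q (a + of_real \<rho> * z)" if "cmod z < R" for z
      unfolding p_def
      by (rule wvar_affine[OF fin ne less_imp_le[OF \<rho>(1)] diff[OF _ that] diff[OF i0(1) that]])
    have "normalized_tuple c I R p"
      unfolding normalized_tuple_def
    proof (intro conjI ballI)
      show "p i holomorphic_on ball 0 R" if "i \<in> I" for i
      proof -
        have "q j \<circ> (\<lambda>z. a + of_real \<rho> * z) holomorphic_on ball 0 R" if "j \<in> I" for j
        proof (rule holomorphic_on_compose_gen[OF _ hol[OF that]])
          show "(\<lambda>z. a + of_real \<rho> * z) holomorphic_on ball 0 R" by (intro holomorphic_intros)
          show "(\<lambda>z. a + of_real \<rho> * z) ` ball 0 R \<subseteq> ball 0 1" using inb by (simp add: image_subset_iff)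
        qed
        from holomorphic_on_diff[OF this[OF that] this[OF i0(1)]]
        show ?thesis by (simp only: p_def o_def)
      qed
      show "majority c I (\<lambda>i. Re (p i z))" if "z \<in> ball 0 R" for z
      proof -
        have e: "x - y \<le> w - y + c \<longleftrightarrow> x \<le> w + c" for x y w :: real by linarith
        show ?thesis
          using maj[OF inb[of z]] that unfolding majority_def p_def by (simp only: minus_complex.sel e mem_ball_0)
      qed
      show "wvar I p z \<le> 4" if "z \<in> ball 0 R" for z
      proof -
        have zR: "cmod z < R" using that by simp
        have "wvar I p z \<le> \<rho>\<^sup>2 * (4 * V)"
          unfolding pv[OF zR] using dist[OF zR] \<rho> by (intro mult_left_mono V4) auto
        then show ?thesis using \<rho>(2) by simp
      qed
      show "\<exists>i\<in>I. \<forall>z\<in>ball 0 R. p i z = 0" using i0(1) by (auto simp: p_def)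
      show "Re (p i 0) \<le> 0" if "i \<in> I" for i using i0(2)[OF that] by (simp add: p_def)
    qed
    from none[OF this] pv[of 0] R \<rho>(2) show False by (simp add: V_def)
  qed
  then show ?thesis using K by blast
qed

text \<open>
The variance is bounded on the disc of radius \<open>1/2\<close>, hence so are the Taylor coefficients at
radius \<open>2/5\<close>, up to a multiple of \<open>- Re (q i 0)\<close>, which can be arbitrarily large. On the disc of
radius \<open>1/15\<close> the geometric tail of the Taylor series is at most \<open>1/2\<close>, so this multiple is
absorbed by \<open>Re (q i 0)\<close> itself.
\<close>

lemma majority_tuples_locally_bounded:
  assumes fin: "finite (I :: 'i set)" and b: "0 \<le> b"
  shows "\<exists>M. \<forall>q. (\<forall>i\<in>I. q i holomorphic_on ball 0 1) \<longrightarrow>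
           (\<forall>z\<in>ball 0 1. majority c I (\<lambda>i. Re (q i z))) \<longrightarrow>
           (\<exists>i\<in>I. \<forall>z\<in>ball 0 1. q i z = 0) \<longrightarrow> (\<forall>i\<in>I. Re (q i 0) \<le> b) \<longrightarrow>
           (\<forall>i\<in>I. \<forall>z. cmod z \<le> 1/15 \<longrightarrow> Re (q i z) \<le> M)"
proof -
  obtain K where K: "K > 0" and bound: "\<And>q::'i \<Rightarrow> complex \<Rightarrow> complex. \<forall>i\<in>I. q i holomorphic_on ball 0 1 \<Longrightarrow>
           \<forall>z\<in>ball 0 1. majority c I (\<lambda>i. Re (q i z)) \<Longrightarrow>
           \<forall>z\<in>ball 0 1. wvar I q z * (1 - cmod z)\<^sup>2 \<le> K"
    using wvar_le_inverse_boundary_distance[OF fin] by blast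
  define X where "X = ln (card I) + 2 * b + 4 * K * (2/5)\<^sup>2"
  have "Re (q i z) \<le> b + X"
    if hol: "\<forall>i\<in>I. q i holomorphic_on ball 0 1" and maj: "\<forall>z\<in>ball 0 1. majority c I (\<lambda>i. Re (q i z))"
      and i01: "i0 \<in> I" "\<forall>z\<in>ball 0 1. q i0 z = 0" and qb: "\<forall>i\<in>I. Re (q i 0) \<le> b"
      and i: "i \<in> I" and z: "cmod z \<le> 1/15" for q :: "'i \<Rightarrow> complex \<Rightarrow> complex" and i0 i z
  proof -
    have sub: "ball 0 (1/2) \<subseteq> ball (0::complex) 1" by (rule subset_ball) simp
    have i02: "q i0 z = 0" if "z \<in> ball 0 (1/2)" for z
      by (rule bspec[OF i01(2) subsetD[OF sub that]])
    note i0 = i01(1) i02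
    have hol2: "q j holomorphic_on ball 0 (1/2)" if "j \<in> I" for j
      by (rule holomorphic_on_subset[OF bspec[OF hol that]]) (simp add: subset_ball)
    have var: "wvar I q w \<le> 4 * K" if "w \<in> ball 0 (1/2)" for w
    proof (cases "0 \<le> wvar I q w")
      case True
      have "wvar I q w * (1/2)\<^sup>2 \<le> wvar I q w * (1 - cmod w)\<^sup>2"
        using that True by (intro mult_left_mono power_mono) auto
      also have "\<dots> \<le> K" using bound[OF hol maj] that by auto
      finally show ?thesis by (simp add: power2_eq_square)
    qed (use K in simp)
    have r: "0 < (2/5::real)" "2/5 < (1/2::real)" by auto
    have cf: "cmod (taylor_coeff (q i) l) \<le> 2 * (X - Re (q i 0)) / (2/5) ^ l" if "1 \<le> l" for l
      using taylor_coeff_le_of_wvar_le[where q = q and b = b, OF fin hol2 var i0 bspec[OF qb] r i that]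
      by (simp only: X_def)
    have c1: "1 \<le> real (card I)" proof -
      have "0 < card I" using fin i by (auto simp: card_gt_0_iff)
      then show ?thesis by simp
    qed
    then have lnc: "0 \<le> ln (real (card I))" by simp
    have X: "2 * b \<le> X" using lnc K by (simp add: X_def)
    have hb: "Re (q i 0) \<le> b" using qb i by blast
    have "cmod (q i z - (\<Sum>l<1. taylor_coeff (q i) l * z ^ l))
        \<le> 2 * (X - Re (q i 0)) * ((cmod z / (2/5)) ^ 1 / (1 - cmod z / (2/5)))"
      by (rule taylor_remainder_le[OF hol2[OF i] r cf]) (use z in auto)
    also have "\<dots> \<le> 2 * (X - Re (q i 0)) * (1/2)"
    proof (rule mult_left_mono)
      show "(cmod z / (2/5)) ^ 1 / (1 - cmod z / (2/5)) \<le> 1/2"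
        using z by (simp add: divide_le_eq)
      show "0 \<le> 2 * (X - Re (q i 0))" using X hb b by simp
    qed
    finally have "cmod (q i z - q i 0) \<le> X - Re (q i 0)" by (simp add: taylor_coeff_def)
    then have "Re (q i z - q i 0) \<le> X - Re (q i 0)" using complex_Re_le_cmod order_trans by blast
    then show ?thesis using b by simp
  qed
  then show ?thesis
    by (intro exI[of _ "b + X"] allI impI ballI) (elim bexE)
qed

text \<open>
Passing to logarithms turns moduli into real parts and the factor \<open>C\<close> into the slack \<open>ln C\<close>. For
\<open>I\<close> with three elements, one of them the constant 1, this contains the theorem of Schottky: the
functions \<open>g\<close>, \<open>g - 1\<close> and 1 never vanish if \<open>g\<close> omits 0 and 1, and any two of their moduli
bound the third.
\<close>

theorem nonvanishing_majority_family_bounded: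
  assumes fin: "finite (I :: 'i set)" and C: "1 \<le> C" and b: "1 \<le> b"
  shows "\<exists>M. \<forall>u. (\<forall>i\<in>I. u i holomorphic_on ball 0 1 \<and> (\<forall>z\<in>ball 0 1. u i z \<noteq> 0)) \<longrightarrow>
           (\<forall>z\<in>ball 0 1. card I < 2 * card {i\<in>I. \<forall>j\<in>I. cmod (u j z) \<le> C * cmod (u i z)}) \<longrightarrow>
           (\<exists>i\<in>I. \<forall>z\<in>ball 0 1. u i z = 1) \<longrightarrow> (\<forall>i\<in>I. cmod (u i 0) \<le> b) \<longrightarrow>
           (\<forall>i\<in>I. \<forall>z. cmod z \<le> 1/15 \<longrightarrow> cmod (u i z) \<le> M)"
proof -
  have "0 \<le> ln b" using b by simp
  from majority_tuples_locally_bounded[OF fin this, of "ln C"]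
  obtain M where M': "\<forall>q. (\<forall>i\<in>I. q i holomorphic_on ball 0 1) \<longrightarrow>
           (\<forall>z\<in>ball 0 1. majority (ln C) I (\<lambda>i. Re (q i z))) \<longrightarrow>
           (\<exists>i\<in>I. \<forall>z\<in>ball 0 1. q i z = 0) \<longrightarrow> (\<forall>i\<in>I. Re (q i 0) \<le> ln b) \<longrightarrow>
           (\<forall>i\<in>I. \<forall>z. cmod z \<le> 1/15 \<longrightarrow> Re (q i z) \<le> M)"
    by (elim exE)
  note M = M'[THEN spec, THEN mp, THEN mp, THEN mp, THEN mp]
  have "cmod (u i z) \<le> exp M"
    if u: "\<And>i. i \<in> I \<Longrightarrow> u i holomorphic_on ball 0 1" "\<And>i z. i \<in> I \<Longrightarrow> z \<in> ball 0 1 \<Longrightarrow> u i z \<noteq> 0"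
      and maj: "\<And>z. z \<in> ball 0 1 \<Longrightarrow> card I < 2 * card {i\<in>I. \<forall>j\<in>I. cmod (u j z) \<le> C * cmod (u i z)}"
      and one: "\<exists>i\<in>I. \<forall>z\<in>ball 0 1. u i z = 1" and ub: "\<And>i. i \<in> I \<Longrightarrow> cmod (u i 0) \<le> b"
      and i: "i \<in> I" and z: "cmod z \<le> 1/15" for u :: "'i \<Rightarrow> complex \<Rightarrow> complex" and i z
  proof -
    \<comment> \<open>The branch for the constant 1 has to be 0 rather than another multiple of \<open>2 * pi * \<i>\<close>.\<close>
    let ?log = "\<lambda>i g. g holomorphic_on ball 0 1 \<and> (\<forall>z\<in>ball 0 1. u i z = exp (g z)) \<and>
        ((\<forall>z\<in>ball 0 1. u i z = 1) \<longrightarrow> g = (\<lambda>_. 0))"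
    have ex: "\<exists>g. ?log i g" if i: "i \<in> I" for i
    proof (cases "\<forall>z\<in>ball 0 1. u i z = 1")
      case True
      then show ?thesis by (intro exI[of _ "\<lambda>_. 0"]) auto
    next
      case False
      obtain g where "g holomorphic_on ball 0 1" "\<And>z. z \<in> ball 0 1 \<Longrightarrow> u i z = exp (g z)"
        using contractible_imp_holomorphic_log[OF u(1)[OF i] convex_imp_contractible[OF convex_ball] u(2)[OF i]] by blast
      with False show ?thesis by blast
    qed
    define q where "q i = (SOME g. ?log i g)" for i
    have "?log i (q i)" if "i \<in> I" for i
      unfolding q_def by (rule someI_ex[OF ex[OF that]])
    note lq = this[THEN conjunct1] this[THEN conjunct2, THEN conjunct1] this[THEN conjunct2, THEN conjunct2]
    note q = lq(1) lq(2)[THEN bspec] lq(3)[THEN mp]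
    have le: "cmod (u j w) \<le> K * cmod (u i w) \<longleftrightarrow> Re (q j w) \<le> Re (q i w) + ln K"
      if "i \<in> I" "j \<in> I" "w \<in> ball 0 1" "1 \<le> K" for i j w K
    proof -
      have "K * cmod (u i w) = exp (Re (q i w) + ln K)" using that by (simp add: q(2) exp_add)
      then show ?thesis using that by (simp add: q(2))
    qed
    have bdd: "\<forall>i\<in>I. \<forall>z. cmod z \<le> 1/15 \<longrightarrow> Re (q i z) \<le> M"
    proof (rule M)
      show "\<forall>z\<in>ball 0 1. majority (ln C) I (\<lambda>i. Re (q i z))"
      proof
        fix w :: complex assume w: "w \<in> ball 0 1"
        have "{i\<in>I. \<forall>j\<in>I. cmod (u j w) \<le> C * cmod (u i w)} = {i\<in>I. \<forall>j\<in>I. Re (q j w) \<le> Re (q i w) + ln C}"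
          by (intro Collect_cong conj_cong ball_cong refl le[OF _ _ w C])
        with maj[OF w] show "majority (ln C) I (\<lambda>i. Re (q i w))" by (simp add: majority_def)
      qed
      from one obtain i1 where i1: "i1 \<in> I" "\<forall>z\<in>ball 0 1. u i1 z = 1" by (elim bexE)
      have "\<forall>z\<in>ball 0 1. q i1 z = 0" by (simp add: q(3)[OF i1])
      with i1(1) show "\<exists>i\<in>I. \<forall>z\<in>ball 0 1. q i z = 0" by (intro bexI)
      show "\<forall>i\<in>I. Re (q i 0) \<le> ln b"
      proof
        fix j assume j: "j \<in> I"
        have "exp (Re (q j 0)) \<le> b" using ub[OF j] q(2)[OF j, of 0] by simp
        then show "Re (q j 0) \<le> ln b" using b by (simp add: ln_ge_iff)
      qed
    qed (intro ballI q(1))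
    have "Re (q i z) \<le> M" by (rule bspec[OF bdd i, THEN spec, THEN mp, OF z])
    moreover have "cmod (u i z) = exp (Re (q i z))" using q(2)[OF i, of z] z by simp
    ultimately show ?thesis by simp
  qed
  then show ?thesis
    by (intro exI[of _ "exp M"] allI impI ballI) blast
qed

section \<open>Characteristic polynomials at omitted points\<close>

abbreviation char_fun :: "complex^'n^'n \<Rightarrow> complex \<Rightarrow> complex" where
  "char_fun X x \<equiv> det (mat x - X)"

lemma char_fun_eq_0_iff:
  fixes X :: "complex^'n^'n"
  shows "char_fun X x = 0 \<longleftrightarrow> x \<in> spectrum X"
proof -
  have "char_fun X x = 0 \<longleftrightarrow> \<not> invertible (mat x - X)" by (simp add: invertible_det_nz)
  also have "\<dots> \<longleftrightarrow> (\<exists>v. v \<noteq> 0 \<and> (mat x - X) *v v = 0)"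
    unfolding invertible_left_inverse matrix_left_invertible_ker by blast
  also have "\<dots> \<longleftrightarrow> x \<in> spectrum X"
  proof -
    have "mat x *v v = x *s v" for v :: "complex^'n"
      by (simp add: vec_eq_iff matrix_vector_mult_def mat_def if_distrib[of "\<lambda>a. a * _"] cong: if_cong)
    then have "(mat x - X) *v v = 0 \<longleftrightarrow> X *v v = x *s v" for v
      by (auto simp: matrix_vector_mult_diff_rdistrib)
    then show ?thesis by (simp add: spectrum_def)
  qed
  finally show ?thesis .
qed

text \<open>
Evaluation at \<open>x\<close> commutes with the determinant; this links the polynomial with the scalar
functions \<open>char_fun\<close>.
\<close>

lemma poly_charpoly: "poly (charpoly X) x = char_fun X x"
  unfolding charpoly_def det_def poly_sum poly_mult poly_prod
  by (intro sum.cong refl arg_cong2[where f = "(*)"] prod.cong)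
     (auto simp: mat_def map_matrix_def of_int_poly)

lemma charpoly_monic:
  fixes X :: "complex^'n^'n"
  shows "degree (charpoly X) \<le> CARD('n)" "coeff (charpoly X) CARD('n) = 1"
proof -
  let ?M = "mat [:0, 1:] - map_matrix (\<lambda>x. [:x:]) X :: complex poly^'n^'n"
  let ?t = "\<lambda>p. of_int (sign p) * (\<Prod>i\<in>UNIV. ?M $ i $ p i)"
  have entry: "?M $ i $ j = (if i = j then [:- (X $ i $ j), 1:] else [:- (X $ i $ j):])" for i j
    by (simp add: mat_def map_matrix_def)
  have deg: "degree (?t p) \<le> (\<Sum>i\<in>UNIV. if p i = i then 1 else 0)" for p
  proof -
    have "degree (?t p) \<le> degree (\<Prod>i\<in>UNIV. ?M $ i $ p i)"
      by (metis (no_types, lifting) add_0 degree_mult_le degree_of_int)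
    also have "\<dots> \<le> (\<Sum>i\<in>UNIV. degree (?M $ i $ p i))"
      by (rule degree_prod_sum_le[unfolded o_def]) simp
    also have "\<dots> \<le> (\<Sum>i\<in>UNIV. if p i = i then 1 else 0)"
      by (intro sum_mono) (simp only: entry, auto)
    finally show ?thesis .
  qed
  have cp: "charpoly X = (\<Sum>p\<in>{p. p permutes UNIV}. ?t p)"
    by (simp add: charpoly_def det_def)
  have le: "degree (?t p) \<le> CARD('n)" for p
  proof -
    have "(\<Sum>i\<in>(UNIV::'n set). if p i = i then 1 else 0) \<le> (\<Sum>i\<in>(UNIV::'n set). 1::nat)"
      by (intro sum_mono) auto
    then show ?thesis using deg[of p] by simp
  qed
  show "degree (charpoly X) \<le> CARD('n)" unfolding cp by (intro degree_sum_le le) simp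
  have lt: "coeff (?t p) CARD('n) = 0" if "p \<noteq> id" for p
  proof (rule coeff_eq_0)
    obtain i where "p i \<noteq> i" using \<open>p \<noteq> id\<close> by (auto simp: fun_eq_iff)
    then have "(\<Sum>i\<in>(UNIV::'n set). if p i = i then 1 else 0) < (\<Sum>i\<in>(UNIV::'n set). 1::nat)"
      by (intro sum_strict_mono_ex1) auto
    then show "degree (?t p) < CARD('n)" using deg[of p] by simp
  qed
  have "coeff (charpoly X) CARD('n) = (\<Sum>p\<in>{p. p permutes UNIV}. coeff (?t p) CARD('n))"
    by (simp only: cp coeff_sum)
  also have "\<dots> = coeff (?t id) CARD('n)"
    using lt by (subst sum.remove[of _ id]) (auto simp: permutes_id intro!: sum.neutral)
  also have "?t id = (\<Prod>i\<in>UNIV. [:- (X $ i $ i), 1:])" by (simp only: entry sign_id) simp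
  also have "coeff \<dots> CARD('n) = 1"
  proof -
    have "degree (\<Prod>i\<in>(UNIV::'n set). [:- (X $ i $ i), 1:]) = CARD('n)"
      by (subst degree_prod_eq_sum_degree) auto
    moreover have "lead_coeff (\<Prod>i\<in>(UNIV::'n set). [:- (X $ i $ i), 1:]) = 1"
      by (simp add: lead_coeff_prod)
    ultimately show ?thesis by simp
  qed
  finally show "coeff (charpoly X) CARD('n) = 1" .
qed

text \<open>
The difference of \<open>p\<close> and the monic polynomial with root set \<open>T\<close> has degree below \<open>card T\<close>, and
ordinary Lagrange interpolation applies to it.
\<close>

lemma monic_lagrange_interpolation:
  fixes p :: "complex poly"
  assumes T: "finite T" and p: "degree p \<le> card T" "coeff p (card T) = 1"
  shows "poly p x = (\<Prod>t\<in>T. x - t) + (\<Sum>t\<in>T. poly p t * (\<Prod>s\<in>T - {t}. (x - s) / (t - s)))"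
proof (cases "T = {}")
  case True
  then have "p = [:1:]" using p by (auto elim!: degree_eq_zeroE)
  then show ?thesis using True by simp
next
  case ne: False
  define P where "P = (\<Prod>t\<in>T. [:- t, 1:])"
  define L where "L = (\<Sum>t\<in>T. Polynomial.smult (poly p t) (\<Prod>s\<in>T - {t}. Polynomial.smult (1 / (t - s)) [:- s, 1:]))"
  have dP: "degree P = card T" unfolding P_def by (subst degree_prod_eq_sum_degree) auto
  have lP: "coeff P (card T) = 1"
    unfolding dP[symmetric] by (simp add: P_def lead_coeff_prod)
  have c0: "card T > 0" using T ne by (simp add: card_gt_0_iff)
  have d1: "degree (p - P) < card T"
  proof -
    have "degree (p - P) \<le> card T" using p(1) dP by (intro degree_diff_le) auto
    moreover have "degree (p - P) \<noteq> card T"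
    proof
      assume d: "degree (p - P) = card T"
      have "lead_coeff (p - P) = 0" unfolding d by (simp add: p(2) lP)
      then have "p - P = 0" by (simp only: leading_coeff_0_iff)
      then show False using d c0 by simp
    qed
    ultimately show ?thesis by simp
  qed
  have d2: "degree L < card T"
  proof -
    have "degree L \<le> card T - 1"
      unfolding L_def
    proof (intro degree_sum_le T)
      fix t assume t: "t \<in> T"
      have "degree (Polynomial.smult (poly p t) (\<Prod>s\<in>T - {t}. Polynomial.smult (1 / (t - s)) [:- s, 1:]))
          \<le> degree (\<Prod>s\<in>T - {t}. Polynomial.smult (1 / (t - s)) [:- s, 1:])" by (rule degree_smult_le)
      also have "\<dots> \<le> (\<Sum>s\<in>T - {t}. degree (Polynomial.smult (1 / (t - s)) [:- s, 1:]))"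
        using T by (intro degree_prod_sum_le[unfolded o_def]) auto
      also have "\<dots> \<le> (\<Sum>s\<in>T - {t}. 1)"
        by (intro sum_mono order_trans[OF degree_smult_le]) simp
      also have "\<dots> = card T - 1" using t T by simp
      finally show "degree (Polynomial.smult (poly p t) (\<Prod>s\<in>T - {t}. Polynomial.smult (1 / (t - s)) [:- s, 1:])) \<le> card T - 1" .
    qed
    then show ?thesis using c0 by linarith
  qed
  have polyL: "poly L x = (\<Sum>t\<in>T. poly p t * (\<Prod>s\<in>T - {t}. (x - s) / (t - s)))" for x
    unfolding L_def poly_sum poly_smult poly_prod
    by (intro sum.cong refl arg_cong2[where f = "(*)"] prod.cong) (simp add: diff_divide_distrib)
  have polyP: "poly P x = (\<Prod>t\<in>T. x - t)" for x by (simp add: P_def poly_prod)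
  have "p - P = L"
  proof (rule poly_eqI_degree[of T])
    fix x assume x: "x \<in> T"
    have "poly P x = 0" unfolding polyP using T x by (intro prod_zero) auto
    moreover have "poly L x = (\<Sum>t\<in>T. if t = x then poly p x else 0)"
      unfolding polyL
    proof (rule sum.cong[OF refl])
      fix t assume t: "t \<in> T"
      show "poly p t * (\<Prod>s\<in>T - {t}. (x - s) / (t - s)) = (if t = x then poly p x else 0)"
      proof (cases "t = x")
        case True
        have "(\<Prod>s\<in>T - {x}. (x - s) / (x - s)) = 1" by (intro prod.neutral) auto
        then show ?thesis using True by simp
      next
        case False
        have "(\<Prod>s\<in>T - {t}. (x - s) / (t - s)) = 0"
          using T x False by (intro prod_zero) auto
        then show ?thesis using False by simp
      qed
    qed
    ultimately show "poly (p - P) x = poly L x" using T x by simp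
  qed (use d1 d2 in auto)
  then have "p = L + P" by (simp only: diff_eq_eq)
  then have "poly p x = poly (L + P) x" by (rule arg_cong)
  then show ?thesis by (simp only: poly_add polyP polyL add.commute)
qed

text \<open>
The index \<open>None\<close> stands for the leading coefficient of a monic polynomial, viewed as its value at
infinity. With it, \<open>n + 1\<close> values determine a polynomial of degree \<open>n\<close> up to a bounded factor.
\<close>

definition values_at :: "complex poly \<Rightarrow> complex option \<Rightarrow> complex" where
  "values_at p j = (case j of None \<Rightarrow> 1 | Some w \<Rightarrow> poly p w)"

lemma monic_poly_value_bound:
  assumes T: "finite T"
  shows "\<exists>c\<ge>0. \<forall>p. degree p \<le> card T \<and> coeff p (card T) = 1 \<longrightarrow> cmod (poly p x) \<le> c * (1 + (\<Sum>t\<in>T. cmod (poly p t)))"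
proof -
  let ?l = "\<lambda>t. cmod (\<Prod>s\<in>T - {t}. (x - s) / (t - s))"
  define c where "c = cmod (\<Prod>t\<in>T. x - t) + (\<Sum>t\<in>T. ?l t)"
  have l0: "0 \<le> (\<Sum>t\<in>T. ?l t)" by (intro sum_nonneg) simp
  then have c: "0 \<le> c" "cmod (\<Prod>t\<in>T. x - t) \<le> c" by (auto simp: c_def)
  have lc: "?l t \<le> c" if "t \<in> T" for t
    using member_le_sum[of t T ?l] T that by (simp add: c_def add_increasing)
  have "cmod (poly p x) \<le> c * (1 + (\<Sum>t\<in>T. cmod (poly p t)))"
    if p: "degree p \<le> card T" "coeff p (card T) = 1" for p
  proof -
    have "cmod (poly p x) \<le> cmod (\<Prod>t\<in>T. x - t) + cmod (\<Sum>t\<in>T. poly p t * (\<Prod>s\<in>T - {t}. (x - s) / (t - s)))"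
      unfolding monic_lagrange_interpolation[OF T p, of x] by (rule norm_triangle_ineq)
    also have "\<dots> \<le> c + (\<Sum>t\<in>T. cmod (poly p t) * ?l t)"
      by (intro add_mono c(2) order_trans[OF norm_sum]) (simp add: norm_mult)
    also have "(\<Sum>t\<in>T. cmod (poly p t) * ?l t) \<le> (\<Sum>t\<in>T. cmod (poly p t) * c)"
      by (intro sum_mono mult_left_mono lc) auto
    finally show ?thesis by (simp add: algebra_simps sum_distrib_left)
  qed
  then show ?thesis using c(1) by blast
qed

text \<open>
The divided difference of \<open>p\<close> over the \<open>n + 1\<close> points is its leading coefficient, so the values
there cannot all be small.
\<close>

lemma monic_poly_one_bound:
  assumes T: "finite T" and s: "s \<notin> T"
  shows "\<exists>c\<ge>0. \<forall>p. degree p \<le> card T \<and> coeff p (card T) = 1 \<longrightarrow> 1 \<le> c * (\<Sum>t\<in>insert s T. cmod (poly p t))"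
proof -
  let ?l = "\<lambda>t. cmod (\<Prod>r\<in>T - {t}. (s - r) / (t - r))"
  define P where "P = cmod (\<Prod>t\<in>T. s - t)"
  have P: "P > 0" using T s by (auto simp: P_def)
  define c where "c = 1 + (\<Sum>t\<in>T. ?l t)"
  have l0: "0 \<le> (\<Sum>t\<in>T. ?l t)" by (intro sum_nonneg) simp
  have lc: "?l t \<le> c" if "t \<in> T" for t
    using member_le_sum[of t T ?l] T that by (simp add: c_def)
  have "1 \<le> c / P * (\<Sum>t\<in>insert s T. cmod (poly p t))"
    if p: "degree p \<le> card T" "coeff p (card T) = 1" for p
  proof -
    have "(\<Prod>t\<in>T. s - t) = poly p s - (\<Sum>t\<in>T. poly p t * (\<Prod>r\<in>T - {t}. (s - r) / (t - r)))"
      unfolding monic_lagrange_interpolation[OF T p, of s] by simp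
    then have "P \<le> cmod (poly p s) + cmod (\<Sum>t\<in>T. poly p t * (\<Prod>r\<in>T - {t}. (s - r) / (t - r)))"
      unfolding P_def by (simp only: norm_triangle_ineq4)
    also have "\<dots> \<le> cmod (poly p s) + (\<Sum>t\<in>T. cmod (poly p t) * ?l t)"
      by (intro add_left_mono order_trans[OF norm_sum]) (simp add: norm_mult)
    also have "\<dots> \<le> c * cmod (poly p s) + (\<Sum>t\<in>T. cmod (poly p t) * c)"
    proof (intro add_mono sum_mono mult_left_mono lc)
      have "1 * cmod (poly p s) \<le> c * cmod (poly p s)" using l0 by (intro mult_right_mono) (auto simp: c_def)
      then show "cmod (poly p s) \<le> c * cmod (poly p s)" by simp
    qed auto
    also have "\<dots> = c * (\<Sum>t\<in>insert s T. cmod (poly p t))"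
      using T s by (simp add: algebra_simps sum_distrib_left)
    finally show ?thesis using P by (simp add: field_simps)
  qed
  moreover have "0 \<le> c / P" using l0 P by (simp add: c_def)
  ultimately show ?thesis by blast
qed

lemma nonemptyE: "A \<noteq> {} \<Longrightarrow> (\<And>x. x \<in> A \<Longrightarrow> P) \<Longrightarrow> P"
  by blast

text \<open>
If \<open>None\<close> belongs to \<open>S\<close>, the other members are \<open>n\<close> interpolation nodes for a monic polynomial. If
not, \<open>S\<close> consists of \<open>n + 1\<close> nodes, which also bound the leading coefficient from below.
\<close>

lemma values_bounded_by_subset:
  assumes W: "finite W" and S: "S \<subseteq> insert None (Some ` W)" "card S = Suc n"
  shows "\<exists>c\<ge>0. \<forall>p. degree p \<le> n \<and> coeff p n = 1 \<longrightarrow> cmod (values_at p j) \<le> c * (\<Sum>i\<in>S. cmod (values_at p i))"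
proof -
  define T where "T = {w. Some w \<in> S}"
  have finS: "finite S" using W S(1) finite_subset by blast
  have ST: "S - {None} = Some ` T"
  proof (rule Set.set_eqI)
    fix i show "i \<in> S - {None} \<longleftrightarrow> i \<in> Some ` T" by (cases i) (auto simp: T_def)
  qed
  have finT: "finite T"
  proof (rule finite_imageD)
    show "finite (Some ` T)" unfolding ST[symmetric] using finS by simp
  qed simp
  have sumT: "(\<Sum>i\<in>S - {None}. cmod (values_at p i)) = (\<Sum>t\<in>T. cmod (poly p t))" for p
    unfolding ST by (subst sum.reindex) (auto simp: values_at_def)
  have cT: "card (S - {None}) = card T" unfolding ST by (simp add: card_image)
  have ex_one: "\<exists>c\<ge>0. \<forall>p. degree p \<le> n \<and> coeff p n = 1 \<longrightarrow> 1 \<le> c * (\<Sum>i\<in>S. cmod (values_at p i))"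
    proof (cases "None \<in> S")
      case True
      have "1 \<le> (\<Sum>i\<in>S. cmod (values_at p i))" for p
        using member_le_sum[OF True _ finS, of "\<lambda>i. cmod (values_at p i)"] by (simp add: values_at_def)
      then show ?thesis by (intro exI[of _ 1]) auto
    next
      case False
      then have S': "S - {None} = S" by auto
      then have "card T = Suc n" using cT S(2) by simp
      then have "T \<noteq> {}" by auto
      then obtain s where s: "s \<in> T" by (elim nonemptyE)
      have c: "card (T - {s}) = n" using \<open>card T = Suc n\<close> s by simp
      from monic_poly_one_bound[of "T - {s}" s] finT obtain c where "c \<ge> 0"
        "\<And>p. degree p \<le> n \<and> coeff p n = 1 \<longrightarrow> 1 \<le> c * (\<Sum>t\<in>insert s (T - {s}). cmod (poly p t))"
        unfolding c by auto
      then show ?thesis using sumT S' s by (intro exI[of _ c]) (simp add: insert_absorb)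
    qed
  have ex_sub: "\<exists>T'. finite T' \<and> card T' = n \<and> (\<forall>p. (\<Sum>t\<in>T'. cmod (poly p t)) \<le> (\<Sum>i\<in>S. cmod (values_at p i)))"
    proof (cases "None \<in> S")
      case True
      then have "card T = n" using cT S(2) finS by simp
      moreover have "(\<Sum>t\<in>T. cmod (poly p t)) \<le> (\<Sum>i\<in>S. cmod (values_at p i))" for p
        unfolding sumT[symmetric] using finS by (intro sum_mono2) auto
      ultimately show ?thesis using finT by blast
    next
      case False
      then have S': "S - {None} = S" by auto
      then have cn: "card T = Suc n" using cT S(2) by simp
      then have "T \<noteq> {}" by auto
      then obtain s where s: "s \<in> T" by (elim nonemptyE)
      have c: "card (T - {s}) = n" using cn s by simp
      have "(\<Sum>t\<in>T - {s}. cmod (poly p t)) \<le> (\<Sum>t\<in>T. cmod (poly p t))" for p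
        using finT by (intro sum_mono2) auto
      then have "(\<Sum>t\<in>T - {s}. cmod (poly p t)) \<le> (\<Sum>i\<in>S. cmod (values_at p i))" for p
        using sumT[of p] unfolding S' by simp
      then show ?thesis using finT c by blast
    qed
  from ex_one obtain c1 where c1: "c1 \<ge> 0"
    and one': "\<forall>p. degree p \<le> n \<and> coeff p n = 1 \<longrightarrow> 1 \<le> c1 * (\<Sum>i\<in>S. cmod (values_at p i))"
    by (elim exE conjE)
  from ex_sub obtain T' where T1: "finite T'" "card T' = n"
    and T2: "\<forall>p. (\<Sum>t\<in>T'. cmod (poly p t)) \<le> (\<Sum>i\<in>S. cmod (values_at p i))"
    by (elim exE conjE)
  note T' = T1 spec[OF T2]
  have one: "1 \<le> c1 * (\<Sum>i\<in>S. cmod (values_at p i))" if "degree p \<le> n" "coeff p n = 1" for p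
    using one' that by simp
  show ?thesis
  proof (cases j)
    case None
    then show ?thesis using c1 one by (intro exI[of _ c1]) (auto simp: values_at_def)
  next
    case (Some x)
    obtain c where c: "c \<ge> 0"
      "\<And>p. degree p \<le> n \<and> coeff p n = 1 \<longrightarrow> cmod (poly p x) \<le> c * (1 + (\<Sum>t\<in>T'. cmod (poly p t)))"
      using monic_poly_value_bound[OF T'(1), of x] unfolding T'(2) by blast
    have "cmod (values_at p j) \<le> c * (c1 + 1) * (\<Sum>i\<in>S. cmod (values_at p i))"
      if p: "degree p \<le> n" "coeff p n = 1" for p
    proof -
      have "cmod (values_at p j) \<le> c * (1 + (\<Sum>t\<in>T'. cmod (poly p t)))"
        using c(2) p by (simp add: Some values_at_def)
      also have "\<dots> \<le> c * (c1 * (\<Sum>i\<in>S. cmod (values_at p i)) + (\<Sum>i\<in>S. cmod (values_at p i)))"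
        by (intro mult_left_mono add_mono one p T'(3) c(1))
      finally show ?thesis by (simp add: algebra_simps)
    qed
    then show ?thesis using c(1) c1 by (intro exI[of _ "c * (c1 + 1)"]) auto
  qed
qed

text \<open>
Any \<open>n + 1\<close> of the \<open>2 * n + 1\<close> values bound all of them. Hence at most \<open>n\<close> of them are much smaller
than the largest, and the remaining ones are a strict majority. This is where the number \<open>2 * n\<close> of
omitted points comes from.
\<close>

lemma values_at_majority:
  assumes W: "finite W" "card W = 2 * n"
  defines "I \<equiv> insert None (Some ` W)"
  shows "\<exists>C\<ge>1. \<forall>p. degree p \<le> n \<and> coeff p n = 1 \<longrightarrow>
     card I < 2 * card {i\<in>I. \<forall>j\<in>I. cmod (values_at p j) \<le> C * cmod (values_at p i)}"
proof -
  have finI: "finite I" using W by (simp add: I_def)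
  have cI: "card I = 2 * n + 1" using W by (simp add: I_def card_image)
  let ?D = "{S. S \<subseteq> I \<and> card S = Suc n} \<times> I"
  have finD: "finite ?D" using finI by (intro finite_cartesian_product) auto
  have "\<forall>d\<in>?D. \<exists>c. 0 \<le> c \<and> (\<forall>p. degree p \<le> n \<and> coeff p n = 1 \<longrightarrow>
      cmod (values_at p (snd d)) \<le> c * (\<Sum>i\<in>fst d. cmod (values_at p i)))"
  proof
    fix d assume d: "d \<in> ?D"
    then have "fst d \<subseteq> insert None (Some ` W)" "card (fst d) = Suc n" by (auto simp: I_def)
    from values_bounded_by_subset[OF W(1) this]
    show "\<exists>c. 0 \<le> c \<and> (\<forall>p. degree p \<le> n \<and> coeff p n = 1 \<longrightarrow>
      cmod (values_at p (snd d)) \<le> c * (\<Sum>i\<in>fst d. cmod (values_at p i)))" .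
  qed
  from bchoice[OF this] obtain c where c0: "\<forall>d\<in>?D. 0 \<le> c d \<and> (\<forall>p. degree p \<le> n \<and> coeff p n = 1 \<longrightarrow>
      cmod (values_at p (snd d)) \<le> c d * (\<Sum>i\<in>fst d. cmod (values_at p i)))"
    by (elim exE)
  note c = bspec[OF c0, THEN conjunct1] bspec[OF c0, THEN conjunct2, THEN spec, THEN mp]
  define C0 where "C0 = 1 + (\<Sum>d\<in>?D. c d)"
  have s0: "0 \<le> (\<Sum>d\<in>?D. c d)" by (intro sum_nonneg c(1))
  have cC: "c d \<le> C0" if "d \<in> ?D" for d
  proof -
    have "c d \<le> sum c ?D" by (rule member_le_sum[OF that _ finD]) (rule c(1), elim DiffD1)
    then show ?thesis unfolding C0_def by simp
  qed
  define C where "C = C0 * real (Suc n)"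
  have C0: "1 \<le> C0" using s0 by (simp add: C0_def)
  have "1 * 1 \<le> C0 * real (Suc n)" using C0 by (intro mult_mono) auto
  then have C1: "1 \<le> C" by (simp add: C_def)
  have "card I < 2 * card {i\<in>I. \<forall>j\<in>I. cmod (values_at p j) \<le> C * cmod (values_at p i)}"
    if p: "degree p \<le> n \<and> coeff p n = 1" for p
  proof (rule ccontr)
    let ?G = "{i\<in>I. \<forall>j\<in>I. cmod (values_at p j) \<le> C * cmod (values_at p i)}"
    assume "\<not> ?thesis"
    then have "card ?G \<le> n" using cI by simp
    moreover have "card (I - ?G) = card I - card ?G" using finI by (intro card_Diff_subset) auto
    ultimately have "Suc n \<le> card (I - ?G)" using cI by simp
    then obtain S where S: "S \<subseteq> I - ?G" "card S = Suc n"
      by (rule obtain_subset_with_card_n)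
    have "finite S" by (rule card_ge_0_finite) (simp add: S(2))
    moreover have "S \<noteq> {}" using S(2) by auto
    ultimately have finS: "finite S" "S \<noteq> {}" .
    let ?v = "\<lambda>i. cmod (values_at p i)"
    have "Max (?v ` S) \<in> ?v ` S" using finS by (intro Max_in) auto
    then obtain i where i: "i \<in> S" "Max (?v ` S) = ?v i" by blast
    have imax: "?v k \<le> ?v i" if "k \<in> S" for k
      using Max_ge[OF finite_imageI[OF finS(1)] imageI[OF that, of ?v]] i(2) by simp
    have "?v j \<le> C * ?v i" if j: "j \<in> I" for j
    proof -
      have d: "(S, j) \<in> ?D" using S j by auto
      have "?v j \<le> c (S, j) * (\<Sum>k\<in>S. ?v k)" using c(2)[OF d p] by (simp only: fst_conv snd_conv)
      also have "\<dots> \<le> C0 * (\<Sum>k\<in>S. ?v i)"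
        using cC[OF d] C0 imax by (intro mult_mono sum_mono sum_nonneg) auto
      finally show ?thesis using S(2) by (simp add: C_def algebra_simps)
    qed
    then have "i \<in> ?G" using i S(1) by auto
    then show False using i S(1) by blast
  qed
  then show ?thesis using C1 by blast
qed

section \<open>Holomorphic curves of matrices\<close>

text \<open>
The derivative of a curve in the sense of Frechet is a real-linear map on the plane. Holomorphy means
that it is complex-linear, hence multiplication with a matrix \<open>D\<close>.
\<close>

definition hol_curve :: "(complex \<Rightarrow> complex^'n^'n) \<Rightarrow> complex set \<Rightarrow> bool" where
  "hol_curve X S \<longleftrightarrow> (\<forall>z\<in>S. \<exists>D. (X has_derivative (\<lambda>h. mat_scale h D)) (at z))"

lemma norm_mat_scale: "norm (mat_scale c X) = cmod c * norm X"
proof -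
  have "norm (mat_scale c X $ i) = cmod c * norm (X $ i)" for i
    unfolding norm_vec_def by (simp add: norm_mult L2_set_right_distrib)
  then show ?thesis
    unfolding norm_vec_def[of "mat_scale c X"] norm_vec_def[of X] by (simp add: L2_set_right_distrib)
qed

lemma mat_scale_mat_scale: "mat_scale a (mat_scale b X) = mat_scale (a * b) X"
  by (simp add: vec_eq_iff)

lemma hol_curve_line: "hol_curve (\<lambda>z. A + mat_scale z H) S"
proof -
  have "linear (\<lambda>z. mat_scale z H)"
    by (rule linearI) (simp_all add: vec_eq_iff algebra_simps)
  then have "bounded_linear (\<lambda>z. mat_scale z H)" by (simp add: linear_conv_bounded_linear)
  from bounded_linear_imp_has_derivative[OF this]
  have "((\<lambda>z. A + mat_scale z H) has_derivative (\<lambda>h. mat_scale h H)) (at z)" for z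
    by (auto intro!: derivative_eq_intros)
  then show ?thesis unfolding hol_curve_def by blast
qed

lemma hol_curve_compose:
  assumes F: "mat_holomorphic_on F U" and X: "hol_curve X S" and sub: "\<And>z. z \<in> S \<Longrightarrow> X z \<in> U"
  shows "hol_curve (\<lambda>z. F (X z)) S"
  unfolding hol_curve_def
proof
  fix z assume z: "z \<in> S"
  obtain D where D: "(X has_derivative (\<lambda>h. mat_scale h D)) (at z)"
    using X z unfolding hol_curve_def by blast
  obtain L where L: "Vector_Spaces.linear mat_scale mat_scale L" "(F has_derivative L) (at (X z))"
    using F sub[OF z] unfolding mat_holomorphic_on_def by blast
  have "((\<lambda>z. F (X z)) has_derivative (\<lambda>h. L (mat_scale h D))) (at z)"
    using has_derivative_compose[OF D L(2)] .
  moreover have "L (mat_scale h D) = mat_scale h (L D)" for h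
    by (rule module_hom.scale[OF L(1)[unfolded Vector_Spaces.linear_iff_module_hom]])
  ultimately show "\<exists>D. ((\<lambda>z. F (X z)) has_derivative (\<lambda>h. mat_scale h D)) (at z)" by auto
qed

lemma hol_curve_entry:
  fixes X :: "complex \<Rightarrow> complex^'n^'n"
  assumes X: "hol_curve X S" and S: "open S"
  shows "(\<lambda>z. X z $ i $ j) holomorphic_on S"
  unfolding holomorphic_on_open[OF S]
proof
  fix z assume z: "z \<in> S"
  obtain D where D: "(X has_derivative (\<lambda>h. mat_scale h D)) (at z)"
    using X z unfolding hol_curve_def by blast
  from bounded_linear.has_derivative[OF bounded_linear_vec_nth bounded_linear.has_derivative[OF bounded_linear_vec_nth D]]
  have "((\<lambda>z. X z $ i $ j) has_derivative (\<lambda>h. mat_scale h D $ i $ j)) (at z)" .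
  then have "((\<lambda>z. X z $ i $ j) has_field_derivative D $ i $ j) (at z)"
    by (simp add: has_field_derivative_def mult_commute_abs)
  then show "\<exists>f'. ((\<lambda>z. X z $ i $ j) has_field_derivative f') (at z)" by blast
qed

lemma hol_curve_char_fun:
  fixes X :: "complex \<Rightarrow> complex^'n^'n"
  assumes X: "hol_curve X S" and S: "open S"
  shows "(\<lambda>z. char_fun (X z) x) holomorphic_on S"
  unfolding det_def vector_minus_component
  by (intro holomorphic_intros hol_curve_entry[OF X S])

text \<open>
Along a disc in \<open>S_n \<Omega>\<close> the values of the characteristic polynomial at \<open>2 * n\<close> omitted points
never vanish. Together with the constant 1 they form a majority family, so they are bounded in
terms of their values at \<open>A\<close>; interpolation bounds the value at any \<open>x\<close>.
\<close>

lemma char_fun_bounded_on_discs: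
  fixes A :: "complex^'n^'n"
  assumes \<Omega>: "infinite (- \<Omega>) \<or> 2 * CARD('n) \<le> card (- \<Omega>)"
  shows "\<exists>B. \<forall>X. (\<forall>z\<in>ball 0 1. X z \<in> S_n \<Omega>) \<and> hol_curve X (ball 0 1) \<and> X 0 = A \<longrightarrow>
           (\<forall>z. cmod z \<le> 1/15 \<longrightarrow> cmod (char_fun (X z) x) \<le> B)"
proof -
  let ?n = "CARD('n)"
  obtain W where W: "W \<subseteq> - \<Omega>" "finite W" "card W = 2 * ?n"
  proof (cases "infinite (- \<Omega>)")
    case True
    from infinite_arbitrarily_large[OF this, of "2 * ?n"] show ?thesis using that by blast
  next
    case False
    then have "2 * ?n \<le> card (- \<Omega>)" using \<Omega> by simp
    then obtain T where "T \<subseteq> - \<Omega>" "card T = 2 * ?n" "finite T" by (rule obtain_subset_with_card_n)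
    then show ?thesis using that by simp
  qed
  define I where "I = insert None (Some ` W)"
  have finI: "finite I" using W(2) by (simp add: I_def)
  from values_at_majority[OF W(2,3)] obtain C where C: "1 \<le> C"
    and maj: "\<forall>p. degree p \<le> ?n \<and> coeff p ?n = 1 \<longrightarrow>
     card I < 2 * card {i\<in>I. \<forall>j\<in>I. cmod (values_at p j) \<le> C * cmod (values_at p i)}"
    unfolding I_def by (elim exE conjE)
  define b where "b = 1 + (\<Sum>i\<in>I. cmod (values_at (charpoly A) i))"
  have b1: "1 \<le> b" unfolding b_def using sum_nonneg[of I "\<lambda>i. cmod (values_at (charpoly A) i)"] by simp
  from nonvanishing_majority_family_bounded[OF finI C b1] obtain M where
    M: "\<forall>u. (\<forall>i\<in>I. u i holomorphic_on ball 0 1 \<and> (\<forall>z\<in>ball 0 1. u i z \<noteq> 0)) \<longrightarrow>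
           (\<forall>z\<in>ball 0 1. card I < 2 * card {i\<in>I. \<forall>j\<in>I. cmod (u j z) \<le> C * cmod (u i z)}) \<longrightarrow>
           (\<exists>i\<in>I. \<forall>z\<in>ball 0 1. u i z = 1) \<longrightarrow> (\<forall>i\<in>I. cmod (u i 0) \<le> b) \<longrightarrow>
           (\<forall>i\<in>I. \<forall>z. cmod z \<le> 1/15 \<longrightarrow> cmod (u i z) \<le> M)"
    by (elim exE)
  have "?n \<le> card W" using W(3) by simp
  then obtain T where T: "T \<subseteq> W" "card T = ?n" "finite T" by (rule obtain_subset_with_card_n)
  from monic_poly_value_bound[OF T(3), of x] obtain c where c: "c \<ge> 0"
    and cb: "\<forall>p. degree p \<le> ?n \<and> coeff p ?n = 1 \<longrightarrow> cmod (poly p x) \<le> c * (1 + (\<Sum>t\<in>T. cmod (poly p t)))"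
    unfolding T(2) by (elim exE conjE)
  have "cmod (char_fun (X z) x) \<le> c * (1 + real ?n * M)"
    if X: "\<forall>z\<in>ball 0 1. X z \<in> S_n \<Omega>" "hol_curve X (ball 0 1)" "X 0 = A" and z: "cmod z \<le> 1/15"
    for X :: "complex \<Rightarrow> complex^'n^'n" and z
  proof -
    let ?u = "\<lambda>i z. values_at (charpoly (X z)) i"
    have mon: "degree (charpoly Y) \<le> ?n \<and> coeff (charpoly Y) ?n = 1" for Y :: "complex^'n^'n"
      using charpoly_monic[of Y] by simp
    have "\<forall>i\<in>I. \<forall>z. cmod z \<le> 1/15 \<longrightarrow> cmod (?u i z) \<le> M"
    proof (rule M[THEN spec, THEN mp, THEN mp, THEN mp, THEN mp])
      show "\<forall>i\<in>I. ?u i holomorphic_on ball 0 1 \<and> (\<forall>z\<in>ball 0 1. ?u i z \<noteq> 0)"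
      proof
        fix i assume i: "i \<in> I"
        show "?u i holomorphic_on ball 0 1 \<and> (\<forall>z\<in>ball 0 1. ?u i z \<noteq> 0)"
        proof (cases i)
          case None
          then show ?thesis by (simp add: values_at_def)
        next
          case (Some w)
          then have w: "w \<notin> \<Omega>" using i W(1) by (auto simp: I_def)
          have "char_fun (X z) w \<noteq> 0" if "z \<in> ball 0 1" for z
            using X(1) that w unfolding char_fun_eq_0_iff S_n_def by blast
          then show ?thesis
            using hol_curve_char_fun[OF X(2) open_ball, of w] by (simp add: Some values_at_def poly_charpoly)
        qed
      qed
      show "\<forall>z\<in>ball 0 1. card I < 2 * card {i\<in>I. \<forall>j\<in>I. cmod (?u j z) \<le> C * cmod (?u i z)}"
        by (intro ballI maj[THEN spec, THEN mp] mon)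
      show "\<exists>i\<in>I. \<forall>z\<in>ball 0 1. ?u i z = 1"
        by (rule bexI[of _ None]) (simp_all add: values_at_def I_def)
      show "\<forall>i\<in>I. cmod (?u i 0) \<le> b"
      proof
        fix i assume "i \<in> I"
        then have "cmod (values_at (charpoly A) i) \<le> (\<Sum>i\<in>I. cmod (values_at (charpoly A) i))"
          using finI by (intro member_le_sum) auto
        then show "cmod (?u i 0) \<le> b" by (simp add: b_def X(3))
      qed
    qed
    then have uM: "cmod (poly (charpoly (X z)) t) \<le> M" if "t \<in> T" for t
      using that T(1) z by (force simp: I_def values_at_def)
    have "cmod (char_fun (X z) x) \<le> c * (1 + (\<Sum>t\<in>T. cmod (poly (charpoly (X z)) t)))"
      using cb[THEN spec, THEN mp, OF mon] by (simp add: poly_charpoly)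
    also have "\<dots> \<le> c * (1 + (\<Sum>t\<in>T. M))"
      by (intro mult_left_mono add_left_mono sum_mono uM c)
    finally show ?thesis by (simp add: T(2))
  qed
  then show ?thesis
    by (intro exI[of _ "c * (1 + real ?n * M)"] allI impI) (elim conjE)
qed

section \<open>Schwarz lemmas\<close>

lemma holomorphic_factor_power:
  assumes "\<phi> holomorphic_on ball 0 1" and "eventually (\<lambda>z. cmod (\<phi> z) \<le> C * cmod z ^ m) (at 0)"
  shows "\<exists>\<psi>. \<psi> holomorphic_on ball 0 1 \<and> (\<forall>z\<in>ball 0 1. \<phi> z = z ^ m * \<psi> z)"
  using assms
proof (induction m arbitrary: \<phi>)
  case 0
  then show ?case by (intro exI[of _ \<phi>]) simp
next
  case (Suc m)
  have "isCont \<phi> 0"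
    using Suc.prems(1) by (intro continuous_on_interior[OF holomorphic_on_imp_continuous_on]) (auto simp: interior_open)
  then have "(\<phi> \<longlongrightarrow> \<phi> 0) (at 0)" by (simp add: isCont_def)
  moreover have "((\<lambda>z. C * cmod z ^ Suc m) \<longlongrightarrow> C * cmod 0 ^ Suc m) (at 0)"
    by (intro tendsto_intros)
  then have "((\<lambda>z. C * cmod z ^ Suc m) \<longlongrightarrow> 0) (at (0::complex))" by simp
  from Lim_null_comparison[OF Suc.prems(2) this] have "(\<phi> \<longlongrightarrow> 0) (at 0)" .
  ultimately have "\<phi> 0 = 0" using LIM_unique by blast
  from Schwarz3[OF Suc.prems(1) this] obtain h where h: "h holomorphic_on ball 0 1"
    "\<And>z. norm z < 1 \<Longrightarrow> \<phi> z = z * h z" by blast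
  have "eventually (\<lambda>z::complex. z \<in> ball 0 1) (at 0)"
    by (rule eventually_at_in_open') auto
  moreover have "eventually (\<lambda>z::complex. z \<noteq> 0) (at 0)"
    by (simp add: eventually_at_filter)
  ultimately have "eventually (\<lambda>z. cmod (h z) \<le> C * cmod z ^ m) (at 0)"
    using Suc.prems(2)
  proof eventually_elim
    case (elim z)
    then have "cmod z * cmod (h z) \<le> cmod z * (C * cmod z ^ m)"
      using h(2)[of z] by (simp add: norm_mult mult_ac)
    then show ?case using elim(2) by simp
  qed
  from Suc.IH[OF h(1) this] obtain \<psi> where \<psi>: "\<psi> holomorphic_on ball 0 1" "\<forall>z\<in>ball 0 1. h z = z ^ m * \<psi> z"
    by (elim exE conjE)
  show ?case
  proof (intro exI conjI ballI)
    show "\<psi> holomorphic_on ball 0 1" by fact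
    show "\<phi> z = z ^ Suc m * \<psi> z" if "z \<in> ball 0 1" for z
      using h(2)[of z] \<psi>(2) that by simp
  qed
qed

text \<open>
A zero of order \<open>m\<close> can be divided out, and by the maximum principle on circles of radius close to
1 the quotient obeys the same bound.
\<close>

lemma schwarz_lemma_power:
  assumes hol: "\<phi> holomorphic_on ball 0 1" and bd: "\<And>z. z \<in> ball 0 1 \<Longrightarrow> cmod (\<phi> z) \<le> B"
    and ev: "eventually (\<lambda>z. cmod (\<phi> z) \<le> C * cmod z ^ m) (at 0)"
  shows "\<exists>\<psi>. \<psi> holomorphic_on ball 0 1 \<and> (\<forall>z\<in>ball 0 1. \<phi> z = z ^ m * \<psi> z) \<and> (\<forall>z\<in>ball 0 1. cmod (\<psi> z) \<le> B)"
proof -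
  from holomorphic_factor_power[OF hol ev] obtain \<psi> where
    \<psi>: "\<psi> holomorphic_on ball 0 1" "\<forall>z\<in>ball 0 1. \<phi> z = z ^ m * \<psi> z" by (elim exE conjE)
  have "cmod (\<psi> z) \<le> B" if z: "z \<in> ball 0 1" for z
  proof -
    have *: "cmod (\<psi> z) * r ^ m \<le> B" if r: "cmod z < r" "r < 1" for r
    proof -
      have r0: "0 < r" using r(1) norm_ge_zero[of z] by linarith
      have sub: "cball 0 r \<subseteq> ball (0::complex) 1" using r by auto
      have "cmod (\<psi> z) \<le> B / r ^ m"
      proof (rule maximum_modulus_frontier[where S = "cball 0 r" and f = \<psi>])
        show "\<psi> holomorphic_on interior (cball 0 r)"
          using holomorphic_on_subset[OF \<psi>(1)] interior_subset sub by blast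
        show "continuous_on (closure (cball 0 r)) \<psi>"
          using holomorphic_on_imp_continuous_on[OF holomorphic_on_subset[OF \<psi>(1) sub]] by simp
        fix w assume "w \<in> frontier (cball (0::complex) r)"
        then have w: "cmod w = r" using r0 by (simp add: frontier_cball)
        then have w1: "w \<in> ball 0 1" using r by simp
        have "r ^ m * cmod (\<psi> w) \<le> B"
          using bd[OF w1] \<psi>(2) w1 by (simp add: norm_mult norm_power w)
        then show "cmod (\<psi> w) \<le> B / r ^ m" using r0 by (simp add: field_simps)
      qed (use r in auto)
      then show ?thesis using r0 by (simp add: field_simps)
    qed
    have "((\<lambda>r. cmod (\<psi> z) * r ^ m) \<longlongrightarrow> cmod (\<psi> z) * 1 ^ m) (at_left 1)"
      by (intro tendsto_intros)
    moreover have "eventually (\<lambda>r. cmod (\<psi> z) * r ^ m \<le> B) (at_left 1)"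
      unfolding eventually_at_left_field using * z by (intro exI[of _ "cmod z"]) simp
    ultimately have "cmod (\<psi> z) * 1 ^ m \<le> B"
      by (intro tendsto_upperbound) auto
    then show ?thesis by simp
  qed
  then show ?thesis using \<psi> by blast
qed

lemma schwarz_lemma_difference:
  assumes hol: "\<phi> holomorphic_on ball 0 1" and bd: "\<And>z. z \<in> ball 0 1 \<Longrightarrow> cmod (\<phi> z) \<le> B" and z: "z \<in> ball 0 1"
  shows "cmod (\<phi> z - \<phi> 0) \<le> 2 * B * cmod z"
proof -
  have hd: "(\<lambda>z. \<phi> z - \<phi> 0) holomorphic_on ball 0 1" by (intro holomorphic_intros hol)
  have bd2: "cmod (\<phi> z - \<phi> 0) \<le> 2 * B" if "z \<in> ball 0 1" for z
    using norm_triangle_ineq4[of "\<phi> z" "\<phi> 0"] bd[OF that] bd[of 0] by simp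
  from Schwarz3[OF hd] obtain h where h: "h holomorphic_on ball 0 1"
    "\<And>z. norm z < 1 \<Longrightarrow> \<phi> z - \<phi> 0 = z * h z" by auto
  have "continuous_on (cball 0 (1/2)) h"
    by (rule holomorphic_on_imp_continuous_on[OF holomorphic_on_subset[OF h(1)]]) auto
  from continuous_attains_sup[OF compact_cball _ continuous_on_norm[OF this]]
  obtain y where y: "\<And>w. w \<in> cball 0 (1/2) \<Longrightarrow> cmod (h w) \<le> cmod (h y)" by force
  have "eventually (\<lambda>w::complex. w \<in> ball 0 (1/2)) (at 0)"
    by (rule eventually_at_in_open') auto
  then have ev: "eventually (\<lambda>w. cmod (\<phi> w - \<phi> 0) \<le> cmod (h y) * cmod w ^ 1) (at 0)"
  proof eventually_elim
    case (elim w)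
    have "cmod w * cmod (h w) \<le> cmod w * cmod (h y)" using y[of w] elim by (intro mult_left_mono) auto
    then show ?case using h(2)[of w] elim by (simp add: norm_mult mult.commute)
  qed
  have "\<exists>\<psi>. \<psi> holomorphic_on ball 0 1 \<and> (\<forall>z\<in>ball 0 1. \<phi> z - \<phi> 0 = z ^ 1 * \<psi> z) \<and> (\<forall>z\<in>ball 0 1. cmod (\<psi> z) \<le> 2 * B)"
    by (rule schwarz_lemma_power[OF hd _ ev]) (rule bd2)
  then obtain \<psi> where
    \<psi>: "\<forall>z\<in>ball 0 1. \<phi> z - \<phi> 0 = z ^ 1 * \<psi> z" "\<forall>z\<in>ball 0 1. cmod (\<psi> z) \<le> 2 * B" by (elim exE conjE)
  have "cmod z * cmod (\<psi> z) \<le> cmod z * (2 * B)" using \<psi>(2) z by (intro mult_left_mono) auto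
  then show ?thesis using \<psi>(1) z by (simp add: norm_mult mult_ac)
qed

section \<open>Invariance of the characteristic polynomial\<close>

lemma iterate_hol_curve:
  assumes "mat_holomorphic_on \<Psi> U" "\<Psi> \<in> U \<rightarrow> U" "hol_curve X S" "\<And>z. z \<in> S \<Longrightarrow> X z \<in> U"
  shows "hol_curve (\<lambda>z. (\<Psi> ^^ k) (X z)) S \<and> (\<forall>z\<in>S. (\<Psi> ^^ k) (X z) \<in> U)"
proof (induction k)
  case 0
  then show ?case using assms(3,4) by simp
next
  case (Suc k)
  have "hol_curve (\<lambda>z. \<Psi> ((\<Psi> ^^ k) (X z))) S"
    by (rule hol_curve_compose[OF assms(1)]) (use Suc.IH in auto)
  moreover have "\<forall>z\<in>S. \<Psi> ((\<Psi> ^^ k) (X z)) \<in> U" using Suc.IH assms(2) by blast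
  ultimately show ?case by simp
qed

lemma iterate_has_derivative_id:
  assumes "\<Psi> A = A" "(\<Psi> has_derivative (\<lambda>H. H)) (at A)"
  shows "(\<Psi> ^^ k) A = A \<and> ((\<Psi> ^^ k) has_derivative (\<lambda>H. H)) (at A)"
proof (induction k)
  case 0
  have "((\<lambda>x. x) has_derivative (\<lambda>H. H)) (at A)" by (rule has_derivative_ident)
  then show ?case by (simp add: id_def)
next
  case (Suc k)
  have "((\<lambda>W. \<Psi> ((\<Psi> ^^ k) W)) has_derivative (\<lambda>H. H)) (at A)"
    using has_derivative_compose[of "\<Psi> ^^ k" "\<lambda>H. H" A UNIV \<Psi> "\<lambda>H. H"] Suc.IH assms by simp
  then show ?case using Suc.IH assms(1) by (simp add: o_def)
qed

lemma tendsto_mat_scale: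
  assumes "(X \<longlongrightarrow> H) F"
  shows "((\<lambda>z. mat_scale c (X z)) \<longlongrightarrow> mat_scale c H) F"
proof -
  have "linear (mat_scale c :: complex^'n^'n \<Rightarrow> _)"
    by (rule linearI) (simp_all add: vec_eq_iff algebra_simps)
  then have "bounded_linear (mat_scale c :: complex^'n^'n \<Rightarrow> _)" by (simp add: linear_conv_bounded_linear)
  from bounded_linear.tendsto[OF this assms] show ?thesis .
qed

lemma tendsto_char_fun:
  assumes "(X \<longlongrightarrow> Y) F"
  shows "((\<lambda>z. char_fun (X z) x) \<longlongrightarrow> char_fun Y x) F"
  unfolding det_def vector_minus_component
  by (intro tendsto_intros tendsto_vec_nth assms)

lemma mat_scale_simps [simp]: "mat_scale 0 X = 0" "mat_scale c 0 = 0" "mat_scale 1 X = X"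
  by (simp_all add: vec_eq_iff)

text \<open>
The argument of Cartan's uniqueness theorem, carried out for the scalar functions \<open>char_fun\<close>
instead of the map itself, since only these are known to be bounded along the iterates. Let \<open>G\<close> be
the change of \<open>char_fun\<close> under \<open>\<Psi>\<close> and suppose that it vanishes to order \<open>m\<close> on all complex
lines through \<open>A\<close>. The iterates are tangent to the identity at \<open>A\<close>, so the total change under \<open>k\<close>
steps has \<open>k\<close> times the same coefficient of order \<open>m\<close>. It is bounded in \<open>k\<close>, hence the
coefficient is zero. So \<open>G\<close> vanishes to every order, and the Schwarz lemma with a bound that does
not depend on the order gives \<open>G = 0\<close>.
\<close>

theorem charpoly_preserved_near_fixed_point:
  fixes \<Psi> :: "complex^'n^'n \<Rightarrow> complex^'n^'n"
  assumes U: "open U" and hol: "mat_holomorphic_on \<Psi> U" and self: "\<Psi> \<in> U \<rightarrow> U" and AU: "A \<in> U"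
    and fixA: "\<Psi> A = A" and der: "(\<Psi> has_derivative (\<lambda>H. H)) (at A)"
    and bound: "\<And>x. \<exists>B. \<forall>X. (\<forall>z\<in>ball 0 1. X z \<in> U) \<and> hol_curve X (ball 0 1) \<and> X 0 = A \<longrightarrow>
           (\<forall>z. cmod z \<le> 1/15 \<longrightarrow> cmod (char_fun (X z) x) \<le> B)"
  shows "\<exists>r>0. \<forall>W\<in>ball A r. \<forall>x. char_fun (\<Psi> W) x = char_fun W x"
proof -
  obtain r0 where r0: "r0 > 0" "ball A r0 \<subseteq> U" using U AU open_contains_ball by blast
  define r where "r = r0 / 15"
  have r: "r > 0" using r0 by (simp add: r_def)
  note it = iterate_has_derivative_id[OF fixA der]
  have inU: "A + mat_scale z H \<in> U" if "norm H < r0" "z \<in> ball 0 1" for z H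
  proof -
    have "norm (mat_scale z H) \<le> 1 * norm H"
      unfolding norm_mat_scale using that(2) by (intro mult_right_mono) auto
    then have "A + mat_scale z H \<in> ball A r0" using that(1) by (simp add: dist_norm)
    then show ?thesis using r0(2) by blast
  qed
  have "char_fun (\<Psi> W) x = char_fun W x" if W: "W \<in> ball A (r / 2)" for W x
  proof -
    obtain B where B: "\<forall>X. (\<forall>z\<in>ball 0 1. X z \<in> U) \<and> hol_curve X (ball 0 1) \<and> X 0 = A \<longrightarrow>
           (\<forall>z. cmod z \<le> 1/15 \<longrightarrow> cmod (char_fun (X z) x) \<le> B)" using bound[of x] by (elim exE)
    define g where "g k H z = char_fun ((\<Psi> ^^ k) (A + mat_scale z H)) x" for k H z
    have rr0: "norm H < r0" if "norm H < r" for H :: "complex^'n^'n" using that r by (simp add: r_def)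
    have curve: "hol_curve (\<lambda>z. (\<Psi> ^^ k) (A + mat_scale z H)) (ball 0 1)"
        "\<And>z. z \<in> ball 0 1 \<Longrightarrow> (\<Psi> ^^ k) (A + mat_scale z H) \<in> U" if "norm H < r0" for k H
      using iterate_hol_curve[OF hol self hol_curve_line inU[OF that]] by blast+
    have gb: "cmod (g k H z) \<le> B" if "norm H < r" "z \<in> ball 0 1" for k H z
    proof -
      have n: "norm (mat_scale 15 H) < r0" using that(1) by (simp add: norm_mat_scale r_def)
      have "\<forall>w. cmod w \<le> 1/15 \<longrightarrow> cmod (char_fun ((\<Psi> ^^ k) (A + mat_scale w (mat_scale 15 H))) x) \<le> B"
      proof (rule B[THEN spec, THEN mp], intro conjI ballI)
        show "hol_curve (\<lambda>w. (\<Psi> ^^ k) (A + mat_scale w (mat_scale 15 H))) (ball 0 1)" by (rule curve(1)[OF n])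
        show "(\<Psi> ^^ k) (A + mat_scale w (mat_scale 15 H)) \<in> U" if "w \<in> ball 0 1" for w by (rule curve(2)[OF n that])
        show "(\<Psi> ^^ k) (A + mat_scale 0 (mat_scale 15 H)) = A" using it[of k] by simp
      qed
      from this[THEN spec, of "z / 15"] that(2) show ?thesis
        by (simp add: g_def mat_scale_mat_scale norm_divide)
    qed
    have ghol: "(\<lambda>z. g k H z) holomorphic_on ball 0 1" if "norm H < r" for k H
      unfolding g_def by (rule hol_curve_char_fun[OF curve(1)[OF rr0[OF that]] open_ball])
    define G where "G W = char_fun (\<Psi> W) x - char_fun W x" for W
    define D where "D = 2 * B"
    have GA: "G (A + mat_scale z H) = g 1 H z - g 0 H z" for z H by (simp add: G_def g_def)
    have gd: "cmod (g k H z - g l H z) \<le> D" if "norm H < r" "z \<in> ball 0 1" for k l H z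
      using norm_triangle_ineq4[of "g k H z" "g l H z"] gb[OF that, of k] gb[OF that, of l] by (simp add: D_def)
    have D0: "0 \<le> D" using order_trans[OF norm_ge_zero gd[of 0 0 0 0]] r by simp
    have Gcont: "((\<lambda>z. G (X z)) \<longlongrightarrow> G Y) F" if "(X \<longlongrightarrow> Y) F" "Y \<in> U" for X Y and F :: "complex filter"
    proof -
      obtain L where "(\<Psi> has_derivative L) (at Y)" using hol \<open>Y \<in> U\<close> unfolding mat_holomorphic_on_def by blast
      then have "isCont \<Psi> Y" by (rule has_derivative_continuous)
      from isCont_tendsto_compose[OF this that(1)] show ?thesis
        unfolding G_def by (intro tendsto_diff tendsto_char_fun that(1))
    qed
    have main: "\<forall>H z. norm H < r \<longrightarrow> z \<in> ball 0 1 \<longrightarrow> cmod (G (A + mat_scale z H)) \<le> D * cmod z ^ m" for m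
    proof (induction m)
      case 0
      then show ?case unfolding GA using gd by simp
    next
      case (Suc m)
      have "\<exists>\<psi>. \<psi> holomorphic_on ball 0 1 \<and> (\<forall>z\<in>ball 0 1. G (A + mat_scale z H) = z ^ m * \<psi> z)
              \<and> (\<forall>z\<in>ball 0 1. cmod (\<psi> z) \<le> D)" if H: "norm H < r" for H
      proof (rule schwarz_lemma_power)
        show "(\<lambda>z. G (A + mat_scale z H)) holomorphic_on ball 0 1"
          unfolding GA by (intro holomorphic_on_diff ghol[OF H])
        show "cmod (G (A + mat_scale z H)) \<le> D" if "z \<in> ball 0 1" for z
          unfolding GA by (rule gd[OF H that])
        have "eventually (\<lambda>z::complex. z \<in> ball 0 1) (at 0)" by (rule eventually_at_in_open') auto
        then show "eventually (\<lambda>z. cmod (G (A + mat_scale z H)) \<le> D * cmod z ^ m) (at 0)"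
          by eventually_elim (use Suc.IH H in blast)
      qed
      then have "\<forall>H\<in>{H. norm H < r}. \<exists>\<psi>. \<psi> holomorphic_on ball 0 1 \<and> (\<forall>z\<in>ball 0 1. G (A + mat_scale z H) = z ^ m * \<psi> z)
              \<and> (\<forall>z\<in>ball 0 1. cmod (\<psi> z) \<le> D)" by simp
      from bchoice[OF this] obtain \<psi> where \<psi>0: "\<forall>H\<in>{H. norm H < r}. \<psi> H holomorphic_on ball 0 1 \<and>
           (\<forall>z\<in>ball 0 1. G (A + mat_scale z H) = z ^ m * \<psi> H z) \<and> (\<forall>z\<in>ball 0 1. cmod (\<psi> H z) \<le> D)"
        by (elim exE)
      have \<psi>hol: "\<psi> H holomorphic_on ball 0 1"
        and \<psi>eq: "\<And>z. z \<in> ball 0 1 \<Longrightarrow> G (A + mat_scale z H) = z ^ m * \<psi> H z"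
        and \<psi>b: "\<And>z. z \<in> ball 0 1 \<Longrightarrow> cmod (\<psi> H z) \<le> D" if "norm H < r" for H
        using bspec[OF \<psi>0, of H] that by simp_all
      have \<psi>d: "cmod (\<psi> H z - \<psi> H 0) \<le> 2 * D * cmod z" if "norm H < r" "z \<in> ball 0 1" for H z
        by (rule schwarz_lemma_difference[OF \<psi>hol[OF that(1)] _ that(2)]) (rule \<psi>b[OF that(1)])
      \<comment> \<open>The maps \<open>\<psi> H\<close> are uniformly Lipschitz at 0, and at a fixed small \<open>s\<close> the value \<open>\<psi> H s\<close> is continuous in \<open>H\<close>; so \<open>\<psi>\<close> is continuous at \<open>(H, 0)\<close>.\<close>
      have joint: "((\<lambda>z. \<psi> (X z) z) \<longlongrightarrow> \<psi> H 0) (at 0)" if X: "(X \<longlongrightarrow> H) (at 0)" and H: "norm H < r" for X H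
      proof (rule tendstoI)
        fix e :: real assume e: "e > 0"
        define s where "s = min (1/2) (e / (10 * (D + 1)))"
        have s: "0 < s" "s < 1" using e D0 by (auto simp: s_def)
        have "s \<le> e / (10 * (D + 1))" unfolding s_def by (rule min.cobounded2)
        moreover have "0 < 10 * (D + 1)" using D0 by simp
        ultimately have "s * (10 * (D + 1)) \<le> e" by (simp only: pos_le_divide_eq)
        then have Ds: "2 * D * s \<le> e / 5" using s(1) by (simp add: algebra_simps)
        have sb: "complex_of_real s \<in> ball 0 1" using s by simp
        have "((\<lambda>z. G (A + mat_scale (of_real s) (X z)) / of_real s ^ m) \<longlongrightarrow> G (A + mat_scale (of_real s) H) / of_real s ^ m) (at 0)"
          by (intro tendsto_divide Gcont tendsto_add tendsto_const tendsto_mat_scale X inU[OF rr0[OF H] sb]) (use s in simp)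
        then have "((\<lambda>z. G (A + mat_scale (of_real s) (X z)) / of_real s ^ m) \<longlongrightarrow> \<psi> H (of_real s)) (at 0)"
          using \<psi>eq[OF H sb] s by simp
        from tendstoD[OF this, of "e / 5"] e
        have e1: "eventually (\<lambda>z. dist (G (A + mat_scale (of_real s) (X z)) / of_real s ^ m) (\<psi> H (of_real s)) < e / 5) (at 0)"
          by simp
        have e2: "eventually (\<lambda>z. norm (X z) < r) (at 0)"
          using order_tendstoD(2)[OF tendsto_norm[OF X] H] .
        have e3: "eventually (\<lambda>z::complex. z \<in> ball 0 s) (at 0)"
          by (rule eventually_at_in_open') (use s in auto)
        show "eventually (\<lambda>z. dist (\<psi> (X z) z) (\<psi> H 0) < e) (at 0)"
          using e1 e2 e3
        proof eventually_elim
          case (elim z)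
          have zb: "z \<in> ball 0 1" using elim(3) s by simp
          have "2 * D * cmod z \<le> 2 * D * s" using elim(3) D0 by (intro mult_left_mono) auto
          then have t1: "cmod (\<psi> (X z) z - \<psi> (X z) 0) \<le> e / 5" using \<psi>d[OF elim(2) zb] Ds by linarith
          have t2: "cmod (\<psi> (X z) (of_real s) - \<psi> (X z) 0) \<le> e / 5"
            using \<psi>d[OF elim(2) sb] Ds s by simp
          have t3: "cmod (\<psi> H (of_real s) - \<psi> H 0) \<le> e / 5" using \<psi>d[OF H sb] Ds s by simp
          have t4: "cmod (\<psi> (X z) (of_real s) - \<psi> H (of_real s)) < e / 5"
            using elim(1) \<psi>eq[OF elim(2) sb] s by (simp add: dist_norm)
          have tri: "cmod (a - d) \<le> cmod (a - b) + cmod (c - b) + cmod (c - f) + cmod (f - d)" for a b c d f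
          proof -
            show ?thesis
              using dist_triangle[of a d b] dist_triangle[of b d c] dist_triangle[of c d f] norm_minus_commute[of b c]
              unfolding dist_norm by linarith
          qed
          from tri[of "\<psi> (X z) z" "\<psi> H 0" "\<psi> (X z) 0" "\<psi> (X z) (of_real s)" "\<psi> H (of_real s)"] t1 t2 t3 t4 e
          show ?case unfolding dist_norm by linarith
        qed
      qed
      have zero: "\<psi> H 0 = 0" if H: "norm H < r" for H
      proof -
        have kb: "real k * cmod (\<psi> H 0) \<le> D" for k
        proof -
          \<comment> \<open>The direction from \<open>A\<close> in which the \<open>j\<close>-th iterate lies at time \<open>z\<close>; it tends to \<open>H\<close>.\<close>
          define X where "X j z = mat_scale (1 / z) ((\<Psi> ^^ j) (A + mat_scale z H) - A)" for j z
          have XH: "(X j \<longlongrightarrow> H) (at 0)" for j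
          proof (rule tendstoI)
            fix e :: real assume e: "e > 0"
            define e' where "e' = e / (2 * (norm H + 1))"
            have n1: "0 < norm H + 1" using norm_ge_zero[of H] by linarith
            have e': "e' > 0" using e n1 unfolding e'_def by (intro divide_pos_pos mult_pos_pos) simp_all
            have "e' * norm H \<le> e' * (norm H + 1)" using e' by simp
            also have "\<dots> = e / 2" unfolding e'_def using n1 by (simp add: field_simps)
            finally have e'H: "e' * norm H < e" using e by simp
            obtain d where d: "d > 0" "\<And>y. norm (y - A) < d \<Longrightarrow> norm ((\<Psi> ^^ j) y - (\<Psi> ^^ j) A - (y - A)) \<le> e' * norm (y - A)"
              using it[of j, THEN conjunct2, unfolded has_derivative_at_alt, THEN conjunct2, THEN spec, THEN mp, OF e'] by blast
            have dp: "0 < d / (norm H + 1)" using d(1) n1 by (rule divide_pos_pos)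
            have ev: "eventually (\<lambda>z::complex. z \<in> ball 0 (d / (norm H + 1))) (at 0)"
              by (rule eventually_at_in_open') (use dp in auto)
            have ev0: "eventually (\<lambda>z::complex. z \<noteq> 0) (at 0)" by (simp add: eventually_at_filter)
            show "eventually (\<lambda>z. dist (X j z) H < e) (at 0)"
              using ev ev0
            proof eventually_elim
              case (elim z)
              let ?y = "A + mat_scale z H"
              have zH: "cmod z * (norm H + 1) < d" using elim(1) n1 by (simp add: pos_less_divide_eq)
              moreover have "cmod z * norm H \<le> cmod z * (norm H + 1)" by (intro mult_left_mono) simp_all
              ultimately have "cmod z * norm H < d" by linarith
              then have "norm ((\<Psi> ^^ j) ?y - A - mat_scale z H) \<le> e' * (cmod z * norm H)"
                using d(2)[of ?y] it[of j] by (simp add: norm_mat_scale)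
              moreover have "mat_scale z (X j z - H) = (\<Psi> ^^ j) ?y - A - mat_scale z H"
                using elim(2) by (simp add: X_def vec_eq_iff algebra_simps)
              then have "cmod z * norm (X j z - H) = norm ((\<Psi> ^^ j) ?y - A - mat_scale z H)"
                by (simp only: norm_mat_scale[symmetric])
              ultimately have "cmod z * norm (X j z - H) \<le> cmod z * (e' * norm H)" by (simp add: mult_ac)
              then have "norm (X j z - H) \<le> e' * norm H" using elim(2) by simp
              then show ?case using e'H by (simp add: dist_norm)
            qed
          qed
          define \<Sigma> where "\<Sigma> z = (\<Sum>j<k. \<psi> (X j z) z)" for z
          have "(\<Sigma> \<longlongrightarrow> (\<Sum>j<k. \<psi> H 0)) (at 0)"
            unfolding \<Sigma>_def by (intro tendsto_sum joint XH H)
          then have lim: "(\<Sigma> \<longlongrightarrow> of_nat k * \<psi> H 0) (at 0)" by simp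
          have evX: "eventually (\<lambda>z. \<forall>j\<in>{..<k}. norm (X j z) < r) (at 0)"
            by (intro eventually_ball_finite ballI order_tendstoD(2)[OF tendsto_norm[OF XH] H]) simp
          have ev0: "eventually (\<lambda>z::complex. z \<noteq> 0) (at 0)" by (simp add: eventually_at_filter)
          have ev1: "eventually (\<lambda>z::complex. z \<in> ball 0 1) (at 0)" by (rule eventually_at_in_open') auto
          have eq: "eventually (\<lambda>z. g k H z - g 0 H z = z ^ m * \<Sigma> z) (at 0)"
            using evX ev0 ev1
          proof eventually_elim
            case (elim z)
            have "g k H z - g 0 H z = (\<Sum>j<k. g (Suc j) H z - g j H z)"
              by (rule sum_lessThan_telescope[symmetric])
            also have "\<dots> = (\<Sum>j<k. z ^ m * \<psi> (X j z) z)"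
            proof (rule sum.cong[OF refl])
              fix j assume j: "j \<in> {..<k}"
              have "A + mat_scale z (X j z) = (\<Psi> ^^ j) (A + mat_scale z H)"
                using elim(2) by (simp add: X_def mat_scale_mat_scale)
              then have "g (Suc j) H z - g j H z = G (A + mat_scale z (X j z))"
                by (simp add: G_def g_def)
              then show "g (Suc j) H z - g j H z = z ^ m * \<psi> (X j z) z"
                using \<psi>eq[of "X j z" z] elim(1,3) j by simp
            qed
            finally show ?case by (simp add: \<Sigma>_def sum_distrib_left)
          qed
          have "eventually (\<lambda>z. cmod (\<Sigma> z) < cmod (of_nat k * \<psi> H 0) + 1) (at 0)"
            by (rule order_tendstoD(2)[OF tendsto_norm[OF lim]]) simp
          with eq have "eventually (\<lambda>z. cmod (g k H z - g 0 H z) \<le> (cmod (of_nat k * \<psi> H 0) + 1) * cmod z ^ m) (at 0)"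
          proof eventually_elim
            case (elim z)
            have "cmod (\<Sigma> z) * cmod z ^ m \<le> (cmod (of_nat k * \<psi> H 0) + 1) * cmod z ^ m"
              using elim(2) by (intro mult_right_mono) auto
            then show ?case unfolding elim(1) norm_mult norm_power by (simp only: mult.commute)
          qed
          note ev = this
          have "\<exists>\<xi>. \<xi> holomorphic_on ball 0 1 \<and> (\<forall>z\<in>ball 0 1. g k H z - g 0 H z = z ^ m * \<xi> z) \<and> (\<forall>z\<in>ball 0 1. cmod (\<xi> z) \<le> D)"
            by (rule schwarz_lemma_power[OF holomorphic_on_diff[OF ghol[OF H] ghol[OF H]] _ ev]) (rule gd[OF H])
          then obtain \<xi> where \<xi>: "\<forall>z\<in>ball 0 1. g k H z - g 0 H z = z ^ m * \<xi> z" "\<forall>z\<in>ball 0 1. cmod (\<xi> z) \<le> D"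
            by (elim exE conjE)
          have "eventually (\<lambda>z. cmod (\<Sigma> z) \<le> D) (at 0)"
            using eq ev0 ev1
          proof eventually_elim
            case (elim z)
            have "z ^ m * \<Sigma> z = z ^ m * \<xi> z" by (rule trans[OF elim(1)[symmetric] bspec[OF \<xi>(1) elim(3)]])
            then have "\<Sigma> z = \<xi> z" using elim(2) by simp
            then show ?case using \<xi>(2) elim(3) by simp
          qed
          then have "cmod (of_nat k * \<psi> H 0) \<le> D"
            by (intro tendsto_upperbound[OF tendsto_norm[OF lim]]) auto
          then show ?thesis by (simp add: norm_mult)
        qed
        show ?thesis
        proof (rule ccontr)
          assume "\<psi> H 0 \<noteq> 0"
          then have "0 < cmod (\<psi> H 0)" by simp
          from reals_Archimedean3[OF this, THEN spec, of D] obtain k :: nat where "D < real k * cmod (\<psi> H 0)"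
            by (elim exE)
          then show False using kb[of k] by simp
        qed
      qed
      show ?case
      proof (intro allI impI)
        fix H :: "complex^'n^'n" and z assume H: "norm H < r" and z: "z \<in> ball (0::complex) 1"
        have ev1: "eventually (\<lambda>z::complex. z \<in> ball 0 1) (at 0)" by (rule eventually_at_in_open') auto
        then have ev: "eventually (\<lambda>z. cmod (\<psi> H z) \<le> 2 * D * cmod z ^ 1) (at 0)"
          by eventually_elim (use \<psi>d[OF H] zero[OF H] in simp)
        have "\<exists>\<xi>. \<xi> holomorphic_on ball 0 1 \<and> (\<forall>z\<in>ball 0 1. \<psi> H z = z ^ 1 * \<xi> z) \<and> (\<forall>z\<in>ball 0 1. cmod (\<xi> z) \<le> D)"
          by (rule schwarz_lemma_power[OF \<psi>hol[OF H] _ ev]) (rule \<psi>b[OF H])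
        then obtain \<xi> where \<xi>: "\<forall>z\<in>ball 0 1. \<psi> H z = z ^ 1 * \<xi> z" "\<forall>z\<in>ball 0 1. cmod (\<xi> z) \<le> D"
          by (elim exE conjE)
        have "cmod z ^ Suc m * cmod (\<xi> z) \<le> cmod z ^ Suc m * D" using \<xi>(2) z by (intro mult_left_mono) auto
        moreover have "G (A + mat_scale z H) = z ^ Suc m * \<xi> z"
          using \<psi>eq[OF H z] \<xi>(1) z by simp
        ultimately show "cmod (G (A + mat_scale z H)) \<le> D * cmod z ^ Suc m"
          by (simp only: norm_mult norm_power mult.commute)
      qed
    qed
    define H where "H = mat_scale 2 (W - A)"
    have H: "norm H < r" using W by (simp add: H_def norm_mat_scale dist_norm norm_minus_commute)
    have WA: "A + mat_scale (1/2) H = W" by (simp add: H_def mat_scale_mat_scale)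
    have le: "cmod (G W) \<le> D * (1/2) ^ m" for m
      using main[of m, THEN spec, THEN spec, THEN mp, THEN mp, OF H, of "1/2"] unfolding WA
      by (simp add: norm_divide)
    have "(\<lambda>m. D * (1/2) ^ m) \<longlonglongrightarrow> D * 0"
      by (intro tendsto_mult tendsto_const LIMSEQ_power_zero) simp
    then have "cmod (G W) \<le> D * 0"
      by (rule LIMSEQ_le_const) (use le in blast)
    then show ?thesis by (simp add: G_def)
  qed
  then show ?thesis using r by (intro exI[of _ "r / 2"]) simp
qed

section \<open>Lipschitz estimate near the fixed point\<close>

lemma norm_le_sum_entries: "norm (M :: complex^'n^'n) \<le> (\<Sum>i\<in>UNIV. \<Sum>j\<in>UNIV. cmod (M $ i $ j))"
proof -
  have "norm M \<le> (\<Sum>i\<in>UNIV. norm (M $ i))"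
    unfolding norm_vec_def[of M] by (rule L2_set_le_sum) simp
  also have "\<dots> \<le> (\<Sum>i\<in>UNIV. \<Sum>j\<in>UNIV. cmod (M $ i $ j))"
    unfolding norm_vec_def[of "M $ _"] by (intro sum_mono L2_set_le_sum) simp
  finally show ?thesis .
qed

text \<open>
The map \<open>\<Psi> - id\<close> is \<open>o\<close> of the distance to \<open>A\<close>, so it is small on a small ball. The Schwarz lemma
on the complex line through \<open>X\<close> and \<open>Y\<close> turns smallness into a small Lipschitz constant. In this
way no continuity of the derivative is involved.
\<close>

lemma holomorphic_near_identity_lipschitz:
  fixes \<Psi> :: "complex^'n^'n \<Rightarrow> complex^'n^'n"
  assumes U: "open U" and hol: "mat_holomorphic_on \<Psi> U" and AU: "A \<in> U"
    and fixA: "\<Psi> A = A" and der: "(\<Psi> has_derivative (\<lambda>H. H)) (at A)"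
  shows "\<exists>r>0. ball A r \<subseteq> U \<and> (\<forall>X\<in>ball A r. \<forall>Y\<in>ball A r. norm ((\<Psi> Y - Y) - (\<Psi> X - X)) \<le> 1/2 * norm (Y - X))"
proof -
  let ?n = "real CARD('n)"
  \<comment> \<open>Each entry contributes at most \<open>4 * e\<close> times the distance, and there are \<open>?n\<^sup>2\<close> entries.\<close>
  define e where "e = 1 / (8 * ?n\<^sup>2)"
  have e: "e > 0" by (simp add: e_def)
  obtain r0 where r0: "r0 > 0" "ball A r0 \<subseteq> U" using U AU open_contains_ball by blast
  obtain d where d: "d > 0" "\<And>W. norm (W - A) < d \<Longrightarrow> norm (\<Psi> W - \<Psi> A - (W - A)) \<le> e * norm (W - A)"
    using der[unfolded has_derivative_at_alt, THEN conjunct2, THEN spec, THEN mp, OF e] by blast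
  define \<delta> where "\<delta> = min r0 d / 2"
  have \<delta>: "\<delta> > 0" "2 * \<delta> \<le> r0" "2 * \<delta> \<le> d" using r0 d by (auto simp: \<delta>_def)
  have R: "norm (\<Psi> W - W) \<le> e * (2 * \<delta>)" if "norm (W - A) < 2 * \<delta>" for W
  proof -
    have "norm (\<Psi> W - W) \<le> e * norm (W - A)" using d(2)[of W] that \<delta> fixA by simp
    also have "\<dots> \<le> e * (2 * \<delta>)" using that e by (intro mult_left_mono) auto
    finally show ?thesis .
  qed
  have "norm ((\<Psi> Y - Y) - (\<Psi> X - X)) \<le> 1/2 * norm (Y - X)"
    if X: "X \<in> ball A (\<delta> / 2)" and Y: "Y \<in> ball A (\<delta> / 2)" for X Y
  proof (cases "X = Y")
    case False
    define V where "V = Y - X"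
    have V: "0 < norm V" using False by (simp add: V_def)
    have "norm V \<le> norm (Y - A) + norm (X - A)"
      unfolding V_def using norm_triangle_ineq4[of "Y - A" "X - A"] by simp
    then have V\<delta>: "norm V < \<delta>" using X Y by (simp add: dist_norm norm_minus_commute)
    define V' where "V' = mat_scale (of_real (\<delta> / norm V)) V"
    have nV': "norm V' = \<delta>" unfolding V'_def norm_mat_scale norm_of_real using V \<delta> by simp
    have near: "norm (X + mat_scale w V' - A) < 2 * \<delta>" if "w \<in> ball 0 1" for w
    proof -
      have "norm (mat_scale w V') \<le> 1 * \<delta>"
        unfolding norm_mat_scale nV' using that \<delta> by (intro mult_right_mono) auto
      moreover have "norm (X + mat_scale w V' - A) \<le> norm (X - A) + norm (mat_scale w V')"
        using norm_triangle_ineq[of "X - A" "mat_scale w V'"] by (simp add: algebra_simps)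
      ultimately show ?thesis using X \<delta>(1) by (simp add: dist_norm norm_minus_commute)
    qed
    have nearU: "X + mat_scale w V' \<in> U" if "w \<in> ball 0 1" for w
      using near[OF that] \<delta>(2) r0(2) by (auto simp: subset_iff dist_norm norm_minus_commute)
    have entry: "cmod (((\<Psi> Y - Y) - (\<Psi> X - X)) $ i $ j) \<le> 4 * e * norm V" for i j
    proof -
      define \<phi> where "\<phi> w = \<Psi> (X + mat_scale w V') $ i $ j - (X + mat_scale w V') $ i $ j" for w
      have hc: "hol_curve (\<lambda>w. X + mat_scale w V') (ball 0 1)" by (rule hol_curve_line)
      have h: "\<phi> holomorphic_on ball 0 1"
        unfolding \<phi>_def
        by (rule holomorphic_on_diff[OF hol_curve_entry[OF hol_curve_compose[OF hol hc nearU] open_ball]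
              hol_curve_entry[OF hc open_ball]])
      have b: "cmod (\<phi> w) \<le> e * (2 * \<delta>)" if "w \<in> ball 0 1" for w
      proof -
        let ?W = "X + mat_scale w V'"
        have "cmod (\<phi> w) = cmod ((\<Psi> ?W - ?W) $ i $ j)" by (simp add: \<phi>_def)
        also have "\<dots> \<le> norm ((\<Psi> ?W - ?W) $ i)" by (rule Finite_Cartesian_Product.norm_nth_le)
        also have "\<dots> \<le> norm (\<Psi> ?W - ?W)" by (rule Finite_Cartesian_Product.norm_nth_le)
        also have "\<dots> \<le> e * (2 * \<delta>)" by (rule R[OF near[OF that]])
        finally show ?thesis .
      qed
      let ?w = "complex_of_real (norm V / \<delta>)"
      have w2: "cmod ?w = norm V / \<delta>" unfolding norm_of_real using V \<delta>(1) by simp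
      have w1: "?w \<in> ball 0 1" unfolding mem_ball_0 w2 using V\<delta> \<delta>(1) by simp
      note w = w1 w2
      have "mat_scale ?w V' = V" using V \<delta> by (simp add: V'_def mat_scale_mat_scale)
      then have "X + mat_scale ?w V' = Y" by (simp add: V_def)
      then have "((\<Psi> Y - Y) - (\<Psi> X - X)) $ i $ j = \<phi> ?w - \<phi> 0" by (simp only: \<phi>_def mat_scale_simps vector_minus_component add_0_right)
      moreover have "cmod (\<phi> ?w - \<phi> 0) \<le> 2 * (e * (2 * \<delta>)) * cmod ?w"
        by (rule schwarz_lemma_difference[OF h _ w(1)]) (rule b)
      ultimately have "cmod (((\<Psi> Y - Y) - (\<Psi> X - X)) $ i $ j) \<le> 2 * (e * (2 * \<delta>)) * (norm V / \<delta>)"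
        by (simp only: w(2))
      then show ?thesis using \<delta>(1) by simp
    qed
    have "norm ((\<Psi> Y - Y) - (\<Psi> X - X)) \<le> (\<Sum>i\<in>(UNIV::'n set). \<Sum>j\<in>(UNIV::'n set). 4 * e * norm V)"
      by (rule order_trans[OF norm_le_sum_entries]) (intro sum_mono entry)
    also have "\<dots> = 1/2 * norm V" by (simp add: e_def power2_eq_square)
    finally show ?thesis by (simp add: V_def)
  qed simp
  moreover have "ball A (\<delta> / 2) \<subseteq> U" using subset_ball[of "\<delta> / 2" r0 A] \<delta> r0(2) by auto
  ultimately show ?thesis using \<delta>(1) by (intro exI[of _ "\<delta> / 2"]) auto
qed

section \<open>Conjugation\<close>

lemma conjugate_matI:
  fixes X Y S T :: "complex^'n^'n"
  assumes "S ** T = mat 1" "T ** S = mat 1" "Y = S ** X ** T"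
  shows "conjugate_mat X Y"
proof -
  have "invertible S" using assms(1,2) invertible_def by blast
  have "S ** matrix_inv S = mat 1 \<and> matrix_inv S ** S = mat 1"
    unfolding matrix_inv_def by (rule someI[of _ T]) (use assms(1,2) in simp)
  then have "matrix_inv S = T"
    using assms(2) by (metis matrix_mul_assoc matrix_mul_lid matrix_mul_rid)
  then show ?thesis using \<open>invertible S\<close> assms(3) unfolding conjugate_mat_def by blast
qed

lemma conjugate_matE:
  fixes X Y :: "complex^'n^'n"
  assumes "conjugate_mat X Y"
  obtains S T where "S ** T = mat 1" "T ** S = mat 1" "Y = S ** X ** T"
proof -
  obtain S where S: "invertible S" "Y = S ** X ** matrix_inv S"
    using assms unfolding conjugate_mat_def by blast
  obtain T where T: "S ** T = mat 1" "T ** S = mat 1" using S(1) unfolding invertible_def by blast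
  have "S ** matrix_inv S = mat 1 \<and> matrix_inv S ** S = mat 1"
    unfolding matrix_inv_def by (rule someI[of _ T]) (use T in simp)
  then show ?thesis using that S(2) by blast
qed

lemma conjugate_mat_intertwine:
  fixes X M S :: "complex^'n^'n"
  assumes "invertible S" "X ** S = S ** M"
  shows "conjugate_mat M X"
proof -
  obtain T where T: "S ** T = mat 1" "T ** S = mat 1" using assms(1) unfolding invertible_def by blast
  have "S ** M ** T = X ** (S ** T)" by (simp only: assms(2)[symmetric] matrix_mul_assoc)
  then show ?thesis using conjugate_matI[OF T, of X M] T(1) by simp
qed

lemma conjugate_mat_sym:
  fixes X Y :: "complex^'n^'n"
  assumes "conjugate_mat X Y" shows "conjugate_mat Y X"
proof -
  obtain S T where S: "S ** T = mat 1" "T ** S = mat 1" "Y = S ** X ** T" using assms by (rule conjugate_matE)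
  have "T ** Y ** S = (T ** S) ** X ** (T ** S)" by (simp only: S(3) matrix_mul_assoc)
  then have "X = T ** Y ** S" by (simp add: S(2))
  then show ?thesis by (rule conjugate_matI[OF S(2,1)])
qed

lemma conjugate_mat_trans:
  fixes X Y Z :: "complex^'n^'n"
  assumes "conjugate_mat X Y" "conjugate_mat Y Z" shows "conjugate_mat X Z"
proof -
  obtain S T where S: "S ** T = mat 1" "T ** S = mat 1" "Y = S ** X ** T" using assms(1) by (rule conjugate_matE)
  obtain S' T' where S': "S' ** T' = mat 1" "T' ** S' = mat 1" "Z = S' ** Y ** T'" using assms(2) by (rule conjugate_matE)
  have "(S' ** S) ** (T ** T') = S' ** (S ** T) ** T'" by (simp only: matrix_mul_assoc)
  then have 1: "(S' ** S) ** (T ** T') = mat 1" by (simp add: S(1) S'(1))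
  have "(T ** T') ** (S' ** S) = T ** (T' ** S') ** S" by (simp only: matrix_mul_assoc)
  then have 2: "(T ** T') ** (S' ** S) = mat 1" by (simp add: S(2) S'(2))
  have 3: "Z = (S' ** S) ** X ** (T ** T')" by (simp only: S(3) S'(3) matrix_mul_assoc)
  show ?thesis by (rule conjugate_matI[OF 1 2 3])
qed

lemma conjugate_mat_relabel:
  fixes M M' :: "complex^'n^'n"
  assumes \<sigma>: "bij \<sigma>" and M': "\<And>i j. M' $ i $ j = M $ \<sigma> i $ \<sigma> j"
  shows "conjugate_mat M' M"
proof -
  define P :: "complex^'n^'n" where "P = (\<chi> i j. if i = \<sigma> j then 1 else 0)"
  define Q :: "complex^'n^'n" where "Q = (\<chi> i j. if \<sigma> i = j then 1 else 0)"
  have inv: "\<sigma> i = \<sigma> j \<longleftrightarrow> i = j" for i j using \<sigma> by (auto simp: bij_def inj_eq)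
  have PP: "P ** Q = mat 1"
  proof -
    have "(\<Sum>k\<in>UNIV. P $ i $ k * Q $ k $ j) = (mat 1 :: complex^'n^'n) $ i $ j" for i j
    proof -
      obtain k0 where k0: "i = \<sigma> k0" using \<sigma> by (metis bij_pointE)
      have "(\<Sum>k\<in>UNIV. P $ i $ k * Q $ k $ j) = (\<Sum>k\<in>UNIV. if k = k0 then (if i = j then 1 else 0) else 0)"
        by (intro sum.cong refl) (auto simp: P_def Q_def k0 inv)
      then show ?thesis by (simp add: mat_def)
    qed
    then show ?thesis by (simp add: vec_eq_iff matrix_matrix_mult_def)
  qed
  have QP: "Q ** P = mat 1"
    unfolding vec_eq_iff
  proof (intro allI)
    fix i j
    have "(\<Sum>k\<in>UNIV. Q $ i $ k * P $ k $ j) = (\<Sum>k\<in>UNIV. if k = \<sigma> i then (if i = j then 1 else 0) else 0)"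
      by (intro sum.cong refl) (auto simp: P_def Q_def inv)
    then show "(Q ** P) $ i $ j = mat 1 $ i $ j" by (simp add: mat_def matrix_matrix_mult_def)
  qed
  have "M ** P = P ** M'"
    unfolding vec_eq_iff
  proof (intro allI)
    fix i j
    obtain k0 where k0: "i = \<sigma> k0" using \<sigma> by (metis bij_pointE)
    have "(M ** P) $ i $ j = M $ i $ \<sigma> j"
      by (simp add: matrix_matrix_mult_def P_def if_distrib[of "\<lambda>a. _ * a"] cong: if_cong)
    moreover have "(P ** M') $ i $ j = M' $ k0 $ j"
      by (simp add: matrix_matrix_mult_def P_def k0 inv if_distrib[of "\<lambda>a. a * _"] cong: if_cong)
    ultimately show "(M ** P) $ i $ j = (P ** M') $ i $ j" by (simp add: M' k0)
  qed
  moreover have "invertible P" using PP QP invertible_def by blast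
  ultimately show ?thesis by (rule conjugate_mat_intertwine[rotated])
qed

section \<open>Jordan matrices and semisimplicity\<close>

text \<open>
A list of pairs of a block size and an eigenvalue describes a Jordan matrix. Its basis vectors are
indexed by cells \<open>(p, l)\<close>: the number of the block and the level inside the block. In this way the
index type \<open>'n\<close> needs no order, only a bijection \<open>f\<close> onto the cells.
\<close>

definition cells :: "(nat \<times> complex) list \<Rightarrow> (nat \<times> nat) set" where
  "cells bs = {(p, l). p < length bs \<and> l < fst (bs ! p)}"

text \<open>
The matrix with diagonal entries \<open>a j\<close> that also maps each basis vector to its predecessor in the
block. The diagonal is arbitrary and not constant on blocks, in order to cover perturbations that
split a Jordan block.
\<close>

definition band :: "('n \<Rightarrow> complex) \<Rightarrow> ('n \<Rightarrow> nat \<times> nat) \<Rightarrow> complex^'n^'n" where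
  "band a f = (\<chi> i j. if i = j then a j
      else if fst (f i) = fst (f j) \<and> snd (f j) = Suc (snd (f i)) then 1 else 0)"

definition jordan_form :: "complex^'n^'n \<Rightarrow> (nat \<times> complex) list \<Rightarrow> ('n \<Rightarrow> nat \<times> nat) \<Rightarrow> complex^'n^'n \<Rightarrow> bool" where
  "jordan_form W bs f S \<longleftrightarrow> (\<forall>b\<in>set bs. 0 < fst b) \<and> bij_betw f UNIV (cells bs) \<and> invertible S \<and>
     W ** S = S ** band (\<lambda>j. snd (bs ! fst (f j))) f"

lemma band_mult_vec:
  fixes f :: "'n::finite \<Rightarrow> nat \<times> nat"
  assumes f: "inj f"
  shows "f j = (p, Suc l) \<Longrightarrow> f i = (p, l) \<Longrightarrow> (band a f *v c) $ i = a i * c $ i + c $ j"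
    and "(\<And>j. f j \<noteq> (fst (f i), Suc (snd (f i)))) \<Longrightarrow> (band a f *v c) $ i = a i * c $ i"
proof -
  show "(band a f *v c) $ i = a i * c $ i + c $ j" if fj: "f j = (p, Suc l)" and fi: "f i = (p, l)"
  proof -
    have ij: "i \<noteq> j" using fi fj by auto
    have e: "band a f $ i $ k * c $ k = (if k = i then a i * c $ i else 0) + (if k = j then c $ j else 0)" for k
    proof (cases "k = i")
      case False
      have "fst (f i) = fst (f k) \<and> snd (f k) = Suc (snd (f i)) \<longleftrightarrow> k = j"
        using fi fj f by (metis fst_conv injD prod.collapse snd_conv)
      then show ?thesis using False by (auto simp: band_def)
    qed (use ij in \<open>auto simp: band_def\<close>)
    show ?thesis
      unfolding matrix_vector_mult_def by (simp only: e sum.distrib vec_lambda_beta) simp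
  qed
  show "(band a f *v c) $ i = a i * c $ i" if no: "\<And>j. f j \<noteq> (fst (f i), Suc (snd (f i)))"
  proof -
    have e: "band a f $ i $ k * c $ k = (if k = i then a i * c $ i else 0)" for k
    proof (cases "k = i")
      case False
      have "\<not> (fst (f i) = fst (f k) \<and> snd (f k) = Suc (snd (f i)))"
        using no[of k] by (metis prod.collapse)
      then show ?thesis using False by (auto simp: band_def)
    qed (auto simp: band_def)
    show ?thesis
      unfolding matrix_vector_mult_def by (simp only: e vec_lambda_beta) simp
  qed
qed

text \<open>
Downward induction along a block: once the higher coordinates vanish, the eigenvalue equation at a
cell involves only the coordinate of that cell.
\<close>

lemma band_block_zero:
  fixes f :: "'n::finite \<Rightarrow> nat \<times> nat" and x :: "complex^'n"
  assumes f: "inj f" and j: "f j = (p, l)" "l0 \<le> l"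
    and z: "\<And>j l. f j = (p, l) \<Longrightarrow> l0 \<le> l \<Longrightarrow> ((band a f *v x) $ j = \<mu> * x $ j \<and> a j \<noteq> \<mu>) \<or> x $ j = 0"
  shows "x $ j = 0"
proof -
  define m where "m = Max ((\<lambda>i. snd (f i)) ` UNIV)"
  have bnd: "snd (f i) \<le> m" for i unfolding m_def by (intro Max_ge) auto
  show ?thesis
    using j
  proof (induction "m - l" arbitrary: j l rule: less_induct)
    case less
    from z[OF less.prems] show ?case
    proof
      assume h: "(band a f *v x) $ j = \<mu> * x $ j \<and> a j \<noteq> \<mu>"
      have "(band a f *v x) $ j = a j * x $ j"
      proof (cases "\<exists>k. f k = (p, Suc l)")
        case True
        then obtain k where k: "f k = (p, Suc l)" by blast
        have "m - Suc l < m - l" using bnd[of k] k by simp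
        then have "x $ k = 0" by (rule less.hyps) (use k less.prems(2) in auto)
        then show ?thesis using band_mult_vec(1)[OF f k less.prems(1), of a x] by simp
      next
        case False
        then show ?thesis using band_mult_vec(2)[OF f, of j a x] less.prems(1) by simp
      qed
      then have "a j * x $ j = \<mu> * x $ j" using h by (elim conjE) (erule trans[OF sym])
      then have "(a j - \<mu>) * x $ j = 0" by (simp only: left_diff_distrib diff_self)
      then have "a j - \<mu> = 0 \<or> x $ j = 0" by (simp only: mult_eq_0_iff)
      then show ?thesis using h by (elim conjE disjE) simp_all
    qed
  qed
qed

definition shifted :: "complex^'n^'n \<Rightarrow> complex \<Rightarrow> complex^'n^'n" where
  "shifted X \<mu> = X - mat \<mu>"

lemma mat_mult_vec: "mat x *v v = x *s v" for v :: "complex^'n"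
  by (simp add: vec_eq_iff matrix_vector_mult_def mat_def if_distrib[of "\<lambda>a. a * _"] cong: if_cong)

lemma shifted_mult_vec: "(shifted X \<mu> *v v) $ i = (X *v v) $ i - \<mu> * v $ i"
  by (simp add: shifted_def matrix_vector_mult_diff_rdistrib mat_mult_vec)

text \<open>
Every generalized eigenvector is an eigenvector, that is, the matrix is diagonalizable.
\<close>

definition semisimple :: "complex^'n^'n \<Rightarrow> bool" where
  "semisimple X \<longleftrightarrow> (\<forall>\<mu> v. shifted X \<mu> *v (shifted X \<mu> *v v) = 0 \<longrightarrow> shifted X \<mu> *v v = 0)"

lemma shifted_conjugate:
  fixes X S T :: "complex^'n^'n"
  assumes "S ** T = mat 1"
  shows "shifted (S ** X ** T) \<mu> = S ** shifted X \<mu> ** T"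
proof -
  have "mat \<mu> ** T = T ** mat \<mu>"
    by (simp add: matrix_matrix_mult_def mat_def vec_eq_iff if_distrib[of "\<lambda>a. a * _"] if_distrib[of "\<lambda>a. _ * a"] mult.commute cong: if_cong)
  then have "S ** mat \<mu> ** T = (S ** T) ** mat \<mu>" by (simp only: matrix_mul_assoc[symmetric])
  then have "S ** mat \<mu> ** T = mat \<mu>" by (simp add: assms)
  moreover have "S ** (X - mat \<mu>) ** T = S ** X ** T - S ** mat \<mu> ** T"
    by (simp add: matrix_matrix_mult_def vec_eq_iff algebra_simps sum_subtractf sum_distrib_right sum_distrib_left)
  ultimately show ?thesis unfolding shifted_def by simp
qed

lemma semisimple_conjugate:
  fixes X Y :: "complex^'n^'n"
  assumes "semisimple X" "conjugate_mat X Y"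
  shows "semisimple Y"
proof -
  obtain S T where S: "S ** T = mat 1" "T ** S = mat 1" "Y = S ** X ** T" using assms(2) by (rule conjugate_matE)
  have sh: "shifted Y \<mu> *v v = S *v (shifted X \<mu> *v (T *v v))" for \<mu> v
    by (simp only: S(3) shifted_conjugate[OF S(1)] matrix_vector_mul_assoc matrix_mul_assoc)
  have TS: "T *v (S *v v) = v" for v by (simp add: matrix_vector_mul_assoc S(2))
  have S0: "S *v v = 0 \<longleftrightarrow> v = 0" for v by (metis TS matrix_vector_mult_0_right)
  show ?thesis
    unfolding semisimple_def
  proof (intro allI impI)
    fix \<mu> v assume "shifted Y \<mu> *v (shifted Y \<mu> *v v) = 0"
    then have "shifted X \<mu> *v (shifted X \<mu> *v (T *v v)) = 0" by (simp only: sh TS S0)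
    then have "shifted X \<mu> *v (T *v v) = 0" using assms(1) unfolding semisimple_def by blast
    then show "shifted Y \<mu> *v v = 0" by (simp only: sh S0)
  qed
qed

text \<open>
If the diagonal entries inside each block are distinct, the block splits. For a given \<open>\<mu>\<close> at most
one cell of the block has diagonal entry \<open>\<mu>\<close>; above it everything vanishes by \<open>band_block_zero\<close>,
and so does the component of \<open>d\<close> at that cell.
\<close>

lemma semisimple_band:
  fixes f :: "'n::finite \<Rightarrow> nat \<times> nat"
  assumes f: "inj f" and dist: "\<And>i j. fst (f i) = fst (f j) \<Longrightarrow> a i = a j \<Longrightarrow> i = j"
  shows "semisimple (band a f)"
  unfolding semisimple_def
proof (intro allI impI)
  fix \<mu> and v :: "complex^'n"
  define d where "d = shifted (band a f) \<mu> *v v"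
  assume "shifted (band a f) \<mu> *v (shifted (band a f) \<mu> *v v) = 0"
  then have dd: "(band a f *v d) $ i = \<mu> * d $ i" for i
    unfolding d_def[symmetric] by (metis eq_iff_diff_eq_0 shifted_mult_vec zero_index)
  have dv: "d $ i = (band a f *v v) $ i - \<mu> * v $ i" for i by (simp add: d_def shifted_mult_vec)
  have "d $ j = 0" for j
  proof (rule band_block_zero[OF f, where \<mu> = \<mu> and a = a and ?l0.0 = 0 and p = "fst (f j)" and l = "snd (f j)"])
    show "f j = (fst (f j), snd (f j))" by simp
    fix i l assume i: "f i = (fst (f j), l)"
    show "((band a f *v d) $ i = \<mu> * d $ i \<and> a i \<noteq> \<mu>) \<or> d $ i = 0"
    proof (cases "a i = \<mu>")
      case True
      have other: "a k \<noteq> \<mu>" if "f k = (fst (f j), l')" "Suc l \<le> l'" for k l'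
      proof
        assume "a k = \<mu>"
        with True have "a i = a k" by simp
        moreover have "fst (f i) = fst (f k)" using that(1) i by simp
        ultimately have "i = k" by (rule dist[rotated])
        then show False using that i by simp
      qed
      have d0: "d $ k = 0" if "f k = (fst (f j), l')" "Suc l \<le> l'" for k l'
        by (rule band_block_zero[OF f that, where \<mu> = \<mu> and a = a]) (rule disjI1, rule conjI, rule dd, rule other)
      have v0: "v $ k = 0" if "f k = (fst (f j), l')" "Suc l \<le> l'" for k l'
      proof (rule band_block_zero[OF f that, where \<mu> = \<mu> and a = a])
        fix k l' assume k: "f k = (fst (f j), l')" "Suc l \<le> l'"
        show "((band a f *v v) $ k = \<mu> * v $ k \<and> a k \<noteq> \<mu>) \<or> v $ k = 0"
          using d0[OF k] other[OF k] dv[of k] by simp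
      qed
      have "(band a f *v v) $ i = a i * v $ i"
      proof (cases "\<exists>k. f k = (fst (f j), Suc l)")
        case True
        then obtain k where k: "f k = (fst (f j), Suc l)" by blast
        show ?thesis using band_mult_vec(1)[OF f k i, of a v] v0[OF k] by simp
      next
        case False
        then show ?thesis using band_mult_vec(2)[OF f, of i a v] i by simp
      qed
      then show ?thesis using dv[of i] True by simp
    qed (use dd in simp)
  qed simp
  then show "shifted (band a f) \<mu> *v v = 0" by (simp add: d_def[symmetric] vec_eq_iff)
qed

section \<open>Existence of the Jordan form\<close>

text \<open>
The \<open>k\<close>-th basis vector of the block diagonal matrix, counted through all blocks in order, as a
cell.
\<close>

fun cell_of :: "(nat \<times> complex) list \<Rightarrow> nat \<Rightarrow> nat \<times> nat" where
  "cell_of [] k = (0, k)"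
| "cell_of (b # bs) k = (if k < fst b then (0, k)
     else (Suc (fst (cell_of bs (k - fst b))), snd (cell_of bs (k - fst b))))"

lemma cell_of_in_cells: "k < sum_list (map fst bs) \<Longrightarrow> cell_of bs k \<in> cells bs"
proof (induction bs arbitrary: k)
  case (Cons b bs)
  show ?case
  proof (cases "k < fst b")
    case True
    then show ?thesis by (simp add: cells_def)
  next
    case False
    then have "k - fst b < sum_list (map fst bs)" using Cons.prems by simp
    from Cons.IH[OF this] show ?thesis using False by (simp add: cells_def case_prod_beta)
  qed
qed (simp add: cells_def)

lemma cell_of_inj: "cell_of bs i = cell_of bs j \<Longrightarrow> i = j"
proof (induction bs arbitrary: i j)
  case (Cons b bs)
  have z: "fst (cell_of (b # bs) k) = 0 \<longleftrightarrow> k < fst b" for k by simp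
  have same: "i < fst b \<longleftrightarrow> j < fst b" by (simp only: z[symmetric] Cons.prems)
  show ?case
  proof (cases "i < fst b")
    case True
    then show ?thesis using same Cons.prems by simp
  next
    case False
    then have "cell_of bs (i - fst b) = cell_of bs (j - fst b)"
      using same Cons.prems by (simp add: prod_eq_iff)
    from Cons.IH[OF this] show ?thesis using False same by simp
  qed
qed simp

lemma cell_of_surj: "(p, l) \<in> cells bs \<Longrightarrow> \<exists>k < sum_list (map fst bs). cell_of bs k = (p, l)"
proof (induction bs arbitrary: p)
  case (Cons b bs)
  show ?case
  proof (cases p)
    case 0
    then show ?thesis using Cons.prems by (intro exI[of _ l]) (auto simp: cells_def)
  next
    case (Suc p')
    then have "(p', l) \<in> cells bs" using Cons.prems by (auto simp: cells_def)
    from Cons.IH[OF this] obtain k where "k < sum_list (map fst bs)" "cell_of bs k = (p', l)" by blast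
    then show ?thesis using Suc by (intro exI[of _ "fst b + k"]) auto
  qed
qed (simp add: cells_def)

lemma cell_of_bij: "bij_betw (cell_of bs) {..<sum_list (map fst bs)} (cells bs)"
  unfolding bij_betw_def
proof (intro conjI)
  show "inj_on (cell_of bs) {..<sum_list (map fst bs)}" by (rule inj_onI) (rule cell_of_inj)
  show "cell_of bs ` {..<sum_list (map fst bs)} = cells bs"
  proof (intro equalityI subsetI)
    fix x assume "x \<in> cells bs"
    then show "x \<in> cell_of bs ` {..<sum_list (map fst bs)}"
      using cell_of_surj[of "fst x" "snd x" bs] by force
  qed (auto intro: cell_of_in_cells)
qed

lemma jordan_matrix_entry:
  assumes "i < sum_list (map fst bs)" "j < sum_list (map fst bs)"
  shows "jordan_matrix bs $$ (i, j) = (if i = j then snd (bs ! fst (cell_of bs j))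
      else if fst (cell_of bs i) = fst (cell_of bs j) \<and> snd (cell_of bs j) = Suc (snd (cell_of bs i)) then 1 else 0)"
  using assms
proof (induction bs arbitrary: i j)
  case (Cons b bs)
  obtain n a where b: "b = (n, a)" by force
  have e: "jordan_matrix (b # bs) $$ (i, j) =
     (if i < n then if j < n then jordan_block n a $$ (i, j) else 0
      else if j < n then 0 else jordan_matrix bs $$ (i - n, j - n))"
    unfolding b jordan_matrix_Cons using Cons.prems by (subst index_mat_four_block) (auto simp: b)
  have IH: "jordan_matrix bs $$ (i - n, j - n) = (if i - n = j - n then snd (bs ! fst (cell_of bs (j - n)))
      else if fst (cell_of bs (i - n)) = fst (cell_of bs (j - n)) \<and>
        snd (cell_of bs (j - n)) = Suc (snd (cell_of bs (i - n))) then 1 else 0)" if "\<not> i < n" "\<not> j < n"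
    by (rule Cons.IH) (use Cons.prems that in \<open>auto simp: b\<close>)
  show ?case
  proof (cases "i < n \<or> j < n")
    case True
    then show ?thesis unfolding e by (auto simp: b)
  next
    case False
    then have "i = j \<longleftrightarrow> i - n = j - n" by auto
    then show ?thesis unfolding e using False IH by (simp add: b)
  qed
qed simp

lemma mat_mult_entry:
  assumes "A \<in> carrier_mat n n" "B \<in> carrier_mat n n" "i < n" "j < n"
  shows "(A * B) $$ (i, j) = (\<Sum>k<n. A $$ (i, k) * B $$ (k, j))"
  using assms by (simp add: scalar_prod_def lessThan_atLeast0)

text \<open>
A transfer of the Jordan normal form for matrices with numerical indices, along an enumeration of
the index type.
\<close>

theorem jordan_form_exists:
  fixes W :: "complex^'n^'n"
  shows "\<exists>bs f S. jordan_form W bs f S"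
proof -
  define n where "n = CARD('n)"
  obtain e :: "'n \<Rightarrow> nat" where e: "bij_betw e UNIV {0..<n}"
    unfolding n_def using ex_bij_betw_finite_nat[of "UNIV :: 'n set"] by auto
  have e': "bij_betw e UNIV {..<n}" using e by (simp add: lessThan_atLeast0)
  have en: "e i < n" for i using bij_betwE[OF e'] by auto
  have einj: "e i = e j \<longleftrightarrow> i = j" for i j using e by (auto simp: bij_betw_def inj_eq)
  define Wm where "Wm = Matrix.mat n n (\<lambda>(i, j). W $ (inv_into UNIV e i) $ (inv_into UNIV e j))"
  have Wm: "Wm \<in> carrier_mat n n" by (simp add: Wm_def)
  have invc: "inv_into UNIV e (e i) = i" for i using e by (simp add: bij_betw_def inv_into_f_f)
  have We: "Wm $$ (e i, e j) = W $ i $ j" for i j by (simp add: Wm_def en invc)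
  obtain as where "char_poly Wm = (\<Prod>a\<leftarrow>as. [:- a, 1:])" using char_poly_factorized[OF Wm] by blast
  from jordan_nf_exists[OF Wm this] obtain bs where bs: "jordan_nf Wm bs" by blast
  then obtain P Q where wit: "similar_mat_wit Wm (jordan_matrix bs) P Q"
    unfolding jordan_nf_def similar_mat_def by blast
  note w = similar_mat_witD2[OF Wm wit]
  have J: "jordan_matrix bs \<in> carrier_mat n n" and P: "P \<in> carrier_mat n n" and Q: "Q \<in> carrier_mat n n"
    and PQ: "P * Q = 1\<^sub>m n" and QP: "Q * P = 1\<^sub>m n" and WP: "Wm = P * jordan_matrix bs * Q" using w by auto
  have sum_n: "sum_list (map fst bs) = n" using J by (metis carrier_matD(1) jordan_matrix_dim(1))
  have "Wm * P = P * jordan_matrix bs * (Q * P)"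
    unfolding WP by (rule assoc_mult_mat[of _ n n _ n _ n]) (use P Q J in auto)
  then have WPJ: "Wm * P = P * jordan_matrix bs" by (simp only: QP right_mult_one_mat[OF mult_carrier_mat[OF P J]])
  define f where "f i = cell_of bs (e i)" for i
  define S :: "complex^'n^'n" where "S = (\<chi> i j. P $$ (e i, e j))"
  define T :: "complex^'n^'n" where "T = (\<chi> i j. Q $$ (e i, e j))"
  have re: "(\<Sum>k\<in>UNIV. h (e k)) = (\<Sum>k<n. h k)" for h :: "nat \<Rightarrow> complex"
    using sum.reindex_bij_betw[OF e', of h] .
  have "S ** T = mat 1"
  proof -
    have "(\<Sum>k\<in>UNIV. P $$ (e i, e k) * Q $$ (e k, e j)) = (if i = j then 1 else 0)" for i j
      unfolding re[of "\<lambda>k. P $$ (e i, k) * Q $$ (k, e j)"] mat_mult_entry[OF P Q en en, symmetric] PQ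
      using en einj by simp
    then show ?thesis by (simp add: vec_eq_iff matrix_matrix_mult_def S_def T_def Finite_Cartesian_Product.mat_def)
  qed
  moreover have "T ** S = mat 1"
  proof -
    have "(\<Sum>k\<in>UNIV. Q $$ (e i, e k) * P $$ (e k, e j)) = (if i = j then 1 else 0)" for i j
      unfolding re[of "\<lambda>k. Q $$ (e i, k) * P $$ (k, e j)"] mat_mult_entry[OF Q P en en, symmetric] QP
      using en einj by simp
    then show ?thesis by (simp add: vec_eq_iff matrix_matrix_mult_def S_def T_def Finite_Cartesian_Product.mat_def)
  qed
  ultimately have inv: "invertible S" using invertible_def by blast
  have WS: "W ** S = S ** band (\<lambda>j. snd (bs ! fst (f j))) f"
  proof -
    have "(\<Sum>k\<in>UNIV. W $ i $ k * S $ k $ j) = (\<Sum>k\<in>UNIV. S $ i $ k * band (\<lambda>j. snd (bs ! fst (f j))) f $ k $ j)" for i j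
    proof -
      have Jb: "jordan_matrix bs $$ (e k, e j) = band (\<lambda>j. snd (bs ! fst (f j))) f $ k $ j" for k
      proof -
        have b: "band (\<lambda>j. snd (bs ! fst (f j))) f $ k $ j = (if k = j then snd (bs ! fst (f j))
            else if fst (f k) = fst (f j) \<and> snd (f j) = Suc (snd (f k)) then 1 else 0)"
          unfolding band_def vec_lambda_beta ..
        show ?thesis
          unfolding b jordan_matrix_entry[of "e k" bs "e j", unfolded sum_n, OF en en, folded f_def, unfolded einj] ..
      qed
      have "(\<Sum>k\<in>UNIV. W $ i $ k * S $ k $ j) = (\<Sum>k\<in>UNIV. Wm $$ (e i, e k) * P $$ (e k, e j))"
        by (simp add: We S_def)
      also have "\<dots> = (P * jordan_matrix bs) $$ (e i, e j)"
        unfolding re[of "\<lambda>k. Wm $$ (e i, k) * P $$ (k, e j)"] mat_mult_entry[OF Wm P en en, symmetric] WPJ ..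
      also have "\<dots> = (\<Sum>k\<in>UNIV. P $$ (e i, e k) * jordan_matrix bs $$ (e k, e j))"
        unfolding re[of "\<lambda>k. P $$ (e i, k) * jordan_matrix bs $$ (k, e j)"] mat_mult_entry[OF P J en en] ..
      finally show ?thesis by (simp add: Jb S_def)
    qed
    then show ?thesis by (simp add: vec_eq_iff matrix_matrix_mult_def)
  qed
  have bij: "bij_betw f UNIV (cells bs)"
    using bij_betw_trans[OF e', of "cell_of bs" "cells bs"] cell_of_bij[of bs] sum_n
    by (simp only: f_def[abs_def] o_def)
  have pos: "\<forall>b\<in>set bs. 0 < fst b"
  proof
    fix b assume "b \<in> set bs"
    then have "fst b \<in> fst ` set bs" by (rule imageI)
    moreover have "0 \<notin> fst ` set bs" using bs unfolding jordan_nf_def by (elim conjE)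
    ultimately show "0 < fst b" by (cases "fst b = 0") simp_all
  qed
  have "jordan_form W bs f S" unfolding jordan_form_def by (intro conjI pos bij inv WS)
  then show ?thesis by (intro exI)
qed

section \<open>Perturbation of eigenvalues\<close>

lemma tendsto_matrix_mult:
  fixes A B :: "complex^'n^'n"
  assumes "(X \<longlongrightarrow> A) F" "(Y \<longlongrightarrow> B) F"
  shows "((\<lambda>z. X z ** Y z) \<longlongrightarrow> A ** B) F"
  unfolding matrix_matrix_mult_def
  by (intro vec_tendstoI, simp only: vec_lambda_beta) (intro tendsto_sum tendsto_mult tendsto_vec_nth assms)

lemma tendsto_matrix_vector_mult:
  fixes A :: "complex^'n^'n" and b :: "complex^'n"
  assumes "(X \<longlongrightarrow> A) F" "(y \<longlongrightarrow> b) F"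
  shows "((\<lambda>z. X z *v y z) \<longlongrightarrow> A *v b) F"
  unfolding matrix_vector_mult_def
  by (intro vec_tendstoI, simp only: vec_lambda_beta) (intro tendsto_sum tendsto_mult tendsto_vec_nth assms)

lemma tendsto_mat:
  assumes "(x \<longlongrightarrow> l) F"
  shows "((\<lambda>z. Finite_Cartesian_Product.mat (x z) :: complex^'n^'n) \<longlongrightarrow> mat l) F"
proof (intro vec_tendstoI)
  fix i j :: 'n
  show "((\<lambda>z. (mat (x z) :: complex^'n^'n) $ i $ j) \<longlongrightarrow> (mat l :: complex^'n^'n) $ i $ j) F"
    unfolding Finite_Cartesian_Product.mat_def by (cases "i = j") (simp_all add: assms)
qed

lemma tendsto_det:
  fixes A :: "complex^'n^'n"
  assumes "(X \<longlongrightarrow> A) F"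
  shows "((\<lambda>z. det (X z)) \<longlongrightarrow> det A) F"
  unfolding det_def by (intro tendsto_intros tendsto_vec_nth assms)

lemma conjugation_entry_bound:
  fixes S T :: "complex^'n^'n"
  shows "\<exists>\<kappa>\<ge>0. \<forall>Z i j. cmod ((T ** Z ** S) $ i $ j) \<le> \<kappa> * norm Z"
proof -
  have "linear (\<lambda>Z. T ** Z ** S)"
    by (rule linearI)
       (simp_all add: vec_eq_iff matrix_matrix_mult_def sum.distrib distrib_left distrib_right flip: scaleR_sum_right)
  from linear_bounded_pos[OF this] obtain B where B: "0 < B" "\<And>Z. norm (T ** Z ** S) \<le> B * norm Z" by blast
  have "cmod ((T ** Z ** S) $ i $ j) \<le> B * norm Z" for Z i j
    by (rule order_trans[OF order_trans[OF Finite_Cartesian_Product.norm_nth_le Finite_Cartesian_Product.norm_nth_le] B(2)])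
  then show ?thesis using B(1) by (intro exI[of _ B]) simp
qed

text \<open>
The theorem of Bauer and Fike: eigenvalues of a diagonalizable matrix move at most linearly. In an
eigenbasis of \<open>W\<close>, the row of the eigenvector equation of \<open>X\<close> that belongs to the largest coordinate
compares \<open>x\<close> with the corresponding diagonal entry.
\<close>

lemma bauer_fike:
  fixes W S D :: "complex^'n^'n"
  assumes WS: "W ** S = S ** D" and S: "invertible S" and D: "\<And>i j. i \<noteq> j \<Longrightarrow> D $ i $ j = 0"
  shows "\<exists>\<kappa>\<ge>0. \<forall>X. \<forall>x\<in>spectrum X. \<exists>i. cmod (x - D $ i $ i) \<le> \<kappa> * norm (X - W)"
proof -
  obtain T where T: "S ** T = mat 1" "T ** S = mat 1" using S unfolding invertible_def by (elim exE conjE)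
  obtain \<kappa> where \<kappa>: "\<kappa> \<ge> 0" "\<And>Z i j. cmod ((T ** Z ** S) $ i $ j) \<le> \<kappa> * norm Z"
    using conjugation_entry_bound[of T S] by (elim exE conjE) simp
  have "\<exists>i. cmod (x - D $ i $ i) \<le> real CARD('n) * \<kappa> * norm (X - W)" if x: "x \<in> spectrum X" for X x
  proof -
    obtain v where v: "v \<noteq> 0" "X *v v = x *s v"
      using x[unfolded spectrum_def, THEN CollectD] by (elim exE conjE)
    define u where "u = T *v v"
    have Su: "S *v u = v" by (simp add: u_def matrix_vector_mul_assoc T)
    have u0: "u \<noteq> 0" using Su v(1) by auto
    define E where "E = T ** (X - W) ** S"
    have "T ** (W ** S) = D" by (simp only: WS matrix_mul_assoc T matrix_mul_lid)
    then have TW: "T *v (W *v v) = D *v u"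
      by (simp only: Su[symmetric] matrix_vector_mul_assoc matrix_mul_assoc)
    have "E *v u = T *v ((X - W) *v v)" by (simp only: E_def Su[symmetric] matrix_vector_mul_assoc matrix_mul_assoc)
    also have "\<dots> = x *s u - D *v u"
      by (simp add: matrix_vector_mult_diff_rdistrib matrix_vector_mult_diff_distrib v(2) TW vector_scalar_commute u_def)
    finally have Eu: "E *v u = x *s u - D *v u" .
    have "Max (range (\<lambda>j. cmod (u $ j))) \<in> range (\<lambda>j. cmod (u $ j))" by (intro Max_in) auto
    then obtain i where i: "Max (range (\<lambda>j. cmod (u $ j))) = cmod (u $ i)" by (elim imageE)
    have mx: "cmod (u $ j) \<le> cmod (u $ i)" for j unfolding i[symmetric] by (intro Max_ge) auto
    have ui: "0 < cmod (u $ i)"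
    proof (rule ccontr)
      assume "\<not> 0 < cmod (u $ i)"
      then have "u $ j = 0" for j using mx[of j] by simp
      then show False using u0 by (simp add: vec_eq_iff)
    qed
    have Dui: "(D *v u) $ i = D $ i $ i * u $ i"
    proof -
      have "D $ i $ j * u $ j = (if j = i then D $ i $ i * u $ i else 0)" for j using D[of i j] by auto
      then have "(\<Sum>j\<in>UNIV. D $ i $ j * u $ j) = (\<Sum>j\<in>UNIV. if j = i then D $ i $ i * u $ i else 0)"
        by (intro sum.cong refl)
      then show ?thesis by (simp add: matrix_vector_mult_def)
    qed
    have "cmod (x - D $ i $ i) * cmod (u $ i) = cmod ((E *v u) $ i)"
      by (simp add: Eu Dui left_diff_distrib[symmetric] norm_mult)
    also have "\<dots> \<le> (\<Sum>j\<in>(UNIV::'n set). \<kappa> * norm (X - W) * cmod (u $ i))"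
      unfolding matrix_vector_mult_def vec_lambda_beta
    proof (rule sum_norm_le)
      fix j
      show "cmod (E $ i $ j * u $ j) \<le> \<kappa> * norm (X - W) * cmod (u $ i)"
        unfolding norm_mult E_def by (intro mult_mono \<kappa>(2) mx mult_nonneg_nonneg \<kappa>(1)) auto
    qed
    also have "\<dots> = (real CARD('n) * \<kappa> * norm (X - W)) * cmod (u $ i)" by simp
    finally show ?thesis using ui by (intro exI[of _ i]) simp
  qed
  then show ?thesis using \<kappa>(1) by (intro exI[of _ "real CARD('n) * \<kappa>"]) simp
qed

text \<open>
Eigenvalues of a convergent sequence of matrices are bounded, and a limit of zeros of the
characteristic polynomials is a zero of the limit.
\<close>

lemma open_S_n:
  assumes "open \<Omega>"
  shows "open (S_n \<Omega> :: (complex^'n^'n) set)"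
  unfolding open_closed closed_sequential_limits
proof (intro allI impI, elim conjE)
  fix X :: "nat \<Rightarrow> complex^'n^'n" and Y
  assume X: "\<forall>m. X m \<in> - S_n \<Omega>" and lim: "X \<longlonglongrightarrow> Y"
  have "\<forall>m. \<exists>\<mu>. \<mu> \<in> spectrum (X m) \<and> \<mu> \<in> - \<Omega>" using X unfolding S_n_def by blast
  from choice[OF this] obtain \<mu> where "\<forall>m. \<mu> m \<in> spectrum (X m) \<and> \<mu> m \<in> - \<Omega>" by (elim exE)
  then have \<mu>: "\<And>m. \<mu> m \<in> spectrum (X m)" "\<And>m. \<mu> m \<in> - \<Omega>" by simp_all
  have "\<exists>\<kappa>\<ge>0. \<forall>X :: complex^'n^'n. \<forall>x\<in>spectrum X. \<exists>i. cmod (x - (0 :: complex^'n^'n) $ i $ i) \<le> \<kappa> * norm (X - 0)"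
    by (rule bauer_fike[of 0 "mat 1" 0]) (auto simp: invertible_def intro: exI[of _ "mat 1"])
  then obtain \<kappa> where \<kappa>: "\<kappa> \<ge> 0" "\<And>X x. x \<in> spectrum (X :: complex^'n^'n) \<Longrightarrow> cmod x \<le> \<kappa> * norm X"
    by auto
  obtain b where "\<forall>x\<in>range X. norm x \<le> b"
    using convergent_imp_bounded[OF lim, unfolded bounded_iff] by (elim exE)
  then have b: "norm (X m) \<le> b" for m by simp
  have "cmod (\<mu> m) \<le> \<kappa> * b" for m
    by (rule order_trans[OF \<kappa>(2)[OF \<mu>(1)] mult_left_mono[OF b \<kappa>(1)]])
  then have "bounded (range \<mu>)" unfolding bounded_iff by blast
  from bounded_imp_convergent_subsequence[OF this]
  obtain l r where r: "strict_mono r" "(\<mu> \<circ> r) \<longlonglongrightarrow> l" by (elim exE conjE)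
  have "(\<lambda>k. char_fun (X (r k)) (\<mu> (r k))) \<longlonglongrightarrow> char_fun Y l"
    by (intro tendsto_det tendsto_diff tendsto_mat r(2)[unfolded o_def]
        LIMSEQ_subseq_LIMSEQ[OF lim r(1), unfolded o_def])
  moreover have "char_fun (X (r k)) (\<mu> (r k)) = 0" for k by (simp only: char_fun_eq_0_iff \<mu>(1))
  ultimately have "char_fun Y l = 0" by (simp add: LIMSEQ_const_iff)
  then have "l \<in> spectrum Y" by (simp only: char_fun_eq_0_iff)
  moreover have "l \<in> - \<Omega>"
    by (rule closed_sequentially[OF closed_Compl[OF assms] _ r(2)]) (simp only: o_def \<mu>(2))
  ultimately show "Y \<in> - S_n \<Omega>" unfolding S_n_def by blast
qed

section \<open>Semisimple matrices are classified by the characteristic polynomial\<close>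

lemma char_fun_intertwine:
  fixes X M S :: "complex^'n^'n"
  assumes S: "invertible S" and XS: "X ** S = S ** M"
  shows "char_fun X x = char_fun M x"
proof -
  have "mat x ** S = S ** mat x"
    by (simp add: matrix_matrix_mult_def Finite_Cartesian_Product.mat_def vec_eq_iff
        if_distrib[of "\<lambda>a. a * _"] if_distrib[of "\<lambda>a. _ * a"] mult.commute cong: if_cong)
  then have "(mat x - X) ** S = S ** (mat x - M)" using XS
    by (simp add: matrix_matrix_mult_def vec_eq_iff left_diff_distrib right_diff_distrib sum_subtractf)
  then have "char_fun X x * det S = det S * char_fun M x" by (simp only: det_mul[symmetric])
  then show ?thesis using S by (simp add: invertible_det_nz)
qed

lemma char_fun_diagonal:
  fixes D :: "complex^'n^'n"
  assumes D: "\<And>i j. i \<noteq> j \<Longrightarrow> D $ i $ j = 0"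
  shows "char_fun D x = (\<Prod>i\<in>UNIV. x - D $ i $ i)"
  by (subst det_diagonal) (simp_all add: D Finite_Cartesian_Product.mat_def)

text \<open>
The characteristic polynomials have the same multiset of roots, so the diagonals differ by a
permutation of the indices.
\<close>

lemma diagonal_conjugate:
  fixes D D' :: "complex^'n^'n"
  assumes D: "\<And>i j. i \<noteq> j \<Longrightarrow> D $ i $ j = 0" and D': "\<And>i j. i \<noteq> j \<Longrightarrow> D' $ i $ j = 0"
    and eq: "\<And>x. char_fun D x = char_fun D' x"
  shows "conjugate_mat D D'"
proof -
  have "(\<Prod>i\<in>UNIV. [:- (D $ i $ i), 1:]) = (\<Prod>i\<in>UNIV. [:- (D' $ i $ i), 1:])"
  proof (rule poly_eq_poly_eq_iff[THEN iffD1], rule ext)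
    fix x
    show "poly (\<Prod>i\<in>UNIV. [:- (D $ i $ i), 1:]) x = poly (\<Prod>i\<in>UNIV. [:- (D' $ i $ i), 1:]) x"
      using eq[of x] by (simp add: poly_prod char_fun_diagonal[OF D] char_fun_diagonal[OF D'])
  qed
  then have "(\<Sum>i\<in>UNIV. {#D $ i $ i#}) = (\<Sum>i\<in>UNIV. {#D' $ i $ i#})"
    using proots_prod[of UNIV "\<lambda>i. [:- (D $ i $ i), 1:]"] proots_prod[of UNIV "\<lambda>i. [:- (D' $ i $ i), 1:]"]
    by simp
  moreover have "(\<Sum>i\<in>A. {#h i#}) = image_mset h (mset_set A)" if "finite A" for A and h :: "'n \<Rightarrow> complex"
    using that by induction auto
  ultimately have "image_mset (\<lambda>i. D $ i $ i) (mset_set UNIV) = image_mset (\<lambda>i. D' $ i $ i) (mset_set UNIV)" by simp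
  from image_mset_eq_implies_permutes[OF _ this]
  obtain p where p: "p permutes UNIV" "\<forall>i\<in>UNIV. D $ i $ i = D' $ p i $ p i" by auto
  have "bij p" using p(1) by (rule permutes_bij)
  then show ?thesis
  proof (rule conjugate_mat_relabel)
    show "D $ i $ j = D' $ p i $ p j" for i j
    proof (cases "i = j")
      case False
      then have "p i \<noteq> p j" using permutes_inj[OF p(1)] by (simp add: inj_eq)
      then show ?thesis using D[OF False] D' by simp
    qed (use p(2) in simp)
  qed
qed

lemma jordan_formD:
  assumes "jordan_form W bs f S"
  shows "inj f" "invertible S" "W ** S = S ** band (\<lambda>j. snd (bs ! fst (f j))) f"
    "conjugate_mat (band (\<lambda>j. snd (bs ! fst (f j))) f) W" "\<forall>b\<in>set bs. 0 < fst b" "bij_betw f UNIV (cells bs)"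
  using assms conjugate_mat_intertwine unfolding jordan_form_def bij_betw_def by auto

lemma cell_predecessor:
  assumes J: "jordan_form W bs f S" and i: "f i = (p, l)" and k: "k \<le> l"
  obtains j where "f j = (p, k)"
proof -
  have bij: "bij_betw f UNIV (cells bs)" by (rule jordan_formD[OF J])
  have "(p, l) \<in> cells bs" using bij_betwE[OF bij] i by (metis UNIV_I)
  then have "(p, k) \<in> cells bs" using k by (auto simp: cells_def)
  then show thesis using bij that by (metis bij_betw_imp_surj_on imageE)
qed

lemma shifted_band_axis:
  fixes f :: "'n::finite \<Rightarrow> nat \<times> nat"
  assumes f: "inj f"
  shows "f i = (p, l) \<Longrightarrow> f j = (p, Suc l) \<Longrightarrow> shifted (band a f) (a j) *v axis j 1 = axis i 1"
    and "f j = (p, 0) \<Longrightarrow> shifted (band a f) (a j) *v axis j 1 = 0"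
proof -
  have c: "(shifted (band a f) (a j) *v axis j 1) $ k = band a f $ k $ j - a j * (axis j 1 :: complex^'n) $ k" for k
    unfolding shifted_mult_vec
    by (simp add: matrix_vector_mult_def axis_def if_distrib[of "\<lambda>a. _ * a"] cong: if_cong)
  show "shifted (band a f) (a j) *v axis j 1 = axis i 1" if ij: "f i = (p, l)" "f j = (p, Suc l)"
  proof (unfold vec_eq_iff, intro allI)
    fix k
    have "f k = f i \<longleftrightarrow> fst (f k) = p \<and> Suc l = Suc (snd (f k))"
      unfolding ij(1) prod_eq_iff by (simp add: eq_commute)
    then have "fst (f k) = p \<and> Suc l = Suc (snd (f k)) \<longleftrightarrow> k = i" by (simp only: inj_eq[OF f])
    moreover have "i \<noteq> j" using ij by auto
    ultimately show "(shifted (band a f) (a j) *v axis j 1) $ k = (axis i 1 :: complex^'n) $ k"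
      unfolding c using ij by (auto simp add: band_def axis_def)
  qed
  show "shifted (band a f) (a j) *v axis j 1 = 0" if "f j = (p, 0)"
    unfolding vec_eq_iff c using that by (simp add: band_def axis_def)
qed

text \<open>
A cell of level 1 gives a chain of length two, which semisimplicity forbids.
\<close>

lemma semisimple_jordan_form_levels:
  fixes Y :: "complex^'n^'n"
  assumes J: "jordan_form Y bs f S" and ss: "semisimple Y"
  shows "snd (f i) = 0"
proof (rule ccontr)
  assume i: "snd (f i) \<noteq> 0"
  define a where "a = (\<lambda>j. snd (bs ! fst (f j)))"
  note D = jordan_formD[OF J, folded a_def]
  have ssb: "semisimple (band a f)" by (rule semisimple_conjugate[OF ss conjugate_mat_sym[OF D(4)]])
  obtain p l where fi: "f i = (p, l)" by force
  have l: "Suc 0 \<le> l" using i fi by simp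
  obtain j1 where j1: "f j1 = (p, Suc 0)" by (rule cell_predecessor[OF J fi l])
  obtain j0 where j0: "f j0 = (p, 0)" by (rule cell_predecessor[OF J fi le0])
  have a: "a j1 = a j0" by (simp add: a_def j0 j1)
  have 1: "shifted (band a f) (a j1) *v axis j1 1 = axis j0 1" by (rule shifted_band_axis(1)[OF D(1) j0 j1])
  have 2: "shifted (band a f) (a j1) *v axis j0 1 = 0"
    unfolding a by (rule shifted_band_axis(2)[OF D(1) j0])
  from ssb[unfolded semisimple_def, THEN spec, THEN spec, THEN mp, of "a j1" "axis j1 1", unfolded 1 2]
  have "axis j0 (1::complex) = 0" by simp
  then show False by simp
qed

lemma band_level_zero_diagonal:
  assumes "\<And>i. snd (f i) = 0" "i \<noteq> j"
  shows "band a f $ i $ j = 0"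
  using assms by (simp add: band_def)

lemma semisimple_diagonal_form:
  fixes Y :: "complex^'n^'n"
  assumes "semisimple Y"
  shows "\<exists>S D :: complex^'n^'n. invertible S \<and> Y ** S = S ** D \<and> (\<forall>i j. i \<noteq> j \<longrightarrow> D $ i $ j = 0)"
proof -
  obtain bs f S where J: "jordan_form Y bs f S" using jordan_form_exists by blast
  show ?thesis
    by (intro exI conjI allI impI, rule jordan_formD(2)[OF J], rule jordan_formD(3)[OF J])
       (rule band_level_zero_diagonal[OF semisimple_jordan_form_levels[OF J assms]])
qed

lemma semisimple_char_fun_eq_conjugate:
  fixes X Y :: "complex^'n^'n"
  assumes X: "semisimple X" and Y: "semisimple Y" and eq: "\<And>x. char_fun X x = char_fun Y x"
  shows "conjugate_mat X Y"
proof -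
  obtain S D :: "complex^'n^'n" where S: "invertible S" "X ** S = S ** D" "\<And>i j. i \<noteq> j \<Longrightarrow> D $ i $ j = 0"
    using semisimple_diagonal_form[OF X] by metis
  obtain S' D' :: "complex^'n^'n" where S': "invertible S'" "Y ** S' = S' ** D'" "\<And>i j. i \<noteq> j \<Longrightarrow> D' $ i $ j = 0"
    using semisimple_diagonal_form[OF Y] by metis
  have "char_fun D x = char_fun D' x" for x
    by (simp only: eq char_fun_intertwine[OF S(1,2), symmetric] char_fun_intertwine[OF S'(1,2), symmetric])
  then have "conjugate_mat D D'" by (intro diagonal_conjugate S(3) S'(3))
  then show ?thesis
    by (rule conjugate_mat_trans[OF conjugate_mat_trans[OF conjugate_mat_sym[OF conjugate_mat_intertwine[OF S(1,2)]]]
          conjugate_mat_intertwine[OF S'(1,2)]])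
qed

section \<open>Lipschitz maps reflect semisimplicity\<close>

lemma matrix_unit_mult_vec: "(\<chi> i j. if i = p \<and> j = q then 1 else 0) *v v = (v $ q) *s (axis p 1 :: complex^'n)"
  for v :: "complex^'n"
proof -
  have "(\<Sum>j\<in>UNIV. (if i = p \<and> j = q then 1 else 0) * v $ j) = (if i = p then v $ q else 0)" for i
    by (simp add: if_distrib[of "\<lambda>a. a * _"] cong: if_cong conj_cong)
  then show ?thesis by (simp add: vec_eq_iff matrix_vector_mult_def axis_def)
qed

lemma shifted_eqD: "shifted X \<mu> *v v = w \<Longrightarrow> X *v v = \<mu> *s v + w"
  by (auto simp: shifted_def matrix_vector_mult_diff_rdistrib mat_mult_vec)

text \<open>
Let \<open>u\<^sub>0\<close>, \<open>u\<^sub>1\<close> be the first two vectors of a Jordan chain for \<open>\<mu>\<close>, and let \<open>M\<close> map \<open>u\<^sub>0\<close> to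
\<open>u\<^sub>1\<close> and the other basis vectors to 0. Then \<open>u\<^sub>0 + s *s u\<^sub>1\<close> is an eigenvector of \<open>Y + s\<^sup>2 M\<close> for
\<open>\<mu> + s\<close>. An eigenvalue moves like the square root of the perturbation.
\<close>

lemma jordan_chain_perturbation:
  fixes Y :: "complex^'n^'n"
  assumes J: "jordan_form Y bs f S" and lev: "snd (f i) \<noteq> 0"
  shows "\<exists>\<mu> M. \<forall>s. \<mu> + s \<in> spectrum (Y + mat_scale (s ^ 2) M)"
proof -
  define a where "a = (\<lambda>j. snd (bs ! fst (f j)))"
  note D = jordan_formD[OF J, folded a_def]
  obtain p l where fi: "f i = (p, l)" by force
  have l: "Suc 0 \<le> l" using lev fi by simp
  obtain j1 where j1: "f j1 = (p, Suc 0)" by (rule cell_predecessor[OF J fi l])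
  obtain j0 where j0: "f j0 = (p, 0)" by (rule cell_predecessor[OF J fi le0])
  have ne: "j0 \<noteq> j1" using j0 j1 by auto
  define \<mu> where "\<mu> = a j0"
  have a: "a j1 = \<mu>" by (simp add: a_def \<mu>_def j0 j1)
  have B1: "band a f *v axis j1 1 = \<mu> *s axis j1 1 + axis j0 1"
    using shifted_eqD[OF shifted_band_axis(1)[OF D(1) j0 j1, of a]] unfolding a .
  have B0: "band a f *v axis j0 1 = \<mu> *s axis j0 1"
    using shifted_eqD[OF shifted_band_axis(2)[OF D(1) j0, of a]] by (simp add: \<mu>_def)
  obtain T where T: "S ** T = mat 1" "T ** S = mat 1" using D(2) unfolding invertible_def by (elim exE conjE)
  define E :: "complex^'n^'n" where "E = (\<chi> i j. if i = j1 \<and> j = j0 then 1 else 0)"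
  define M where "M = S ** E ** T"
  have "\<mu> + s \<in> spectrum (Y + mat_scale (s ^ 2) M)" for s
  proof -
    define u :: "complex^'n" where "u = axis j0 1 + s *s axis j1 1"
    have u0: "u $ j0 = 1" using ne by (simp add: u_def axis_def)
    define v where "v = S *v u"
    have Tv: "T *v v = u" by (simp add: v_def matrix_vector_mul_assoc T)
    have "v \<noteq> 0"
    proof
      assume "v = 0"
      then have "u = 0" using Tv by simp
      then show False using u0 by simp
    qed
    have Eu: "E *v u = axis j1 1" unfolding E_def matrix_unit_mult_vec u0 by simp
    have "Y *v v = S *v (band a f *v u)" by (simp only: v_def matrix_vector_mul_assoc D(3))
    moreover have "M *v v = S *v axis j1 1"
      unfolding M_def Eu[symmetric] by (simp only: Tv[symmetric] matrix_vector_mul_assoc matrix_mul_assoc)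
    moreover have "mat_scale c M *v v = c *s (M *v v)" for c
      by (simp add: vec_eq_iff matrix_vector_mult_def sum_distrib_left mult.assoc)
    ultimately have "(Y + mat_scale (s ^ 2) M) *v v = S *v (band a f *v u + s ^ 2 *s axis j1 1)"
      by (simp add: matrix_vector_mult_add_rdistrib matrix_vector_right_distrib vector_scalar_commute)
    also have "band a f *v u + s ^ 2 *s axis j1 1 = (\<mu> + s) *s u"
      by (simp add: u_def matrix_vector_right_distrib vector_scalar_commute B0 B1)
         (simp add: vec_eq_iff algebra_simps power2_eq_square)
    also have "S *v ((\<mu> + s) *s u) = (\<mu> + s) *s v" by (simp only: v_def vector_scalar_commute)
    finally show ?thesis using \<open>v \<noteq> 0\<close> unfolding spectrum_def by (intro CollectI exI conjI)
  qed
  then show ?thesis by (intro exI allI)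
qed

lemma finite_set_separated_from_point:
  fixes \<mu> :: complex
  assumes "finite D"
  obtains \<delta> where "\<delta> > 0" "\<And>d. d \<in> D \<Longrightarrow> d \<noteq> \<mu> \<Longrightarrow> \<delta> \<le> cmod (\<mu> - d)"
proof -
  obtain \<delta> where "\<delta> > 0" "\<forall>d\<in>D. d \<noteq> \<mu> \<longrightarrow> \<delta> \<le> dist \<mu> d"
    using finite_set_avoid[OF assms, of \<mu>] by (elim exE conjE)
  then show thesis using that by (simp add: dist_norm)
qed

text \<open>
Along the perturbation of \<open>jordan_chain_perturbation\<close> an eigenvalue of \<open>X\<close>, which is also one of
\<open>g X\<close>, moves by \<open>s\<close> while \<open>g X\<close> moves by a multiple of \<open>s\<^sup>2\<close>. For small \<open>s\<close> this contradicts the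
linear bound of \<open>bauer_fike\<close> at the semisimple matrix \<open>g Y\<close>.
\<close>

lemma semisimple_reflected:
  fixes g :: "complex^'n^'n \<Rightarrow> complex^'n^'n"
  assumes V: "open V" and Y: "Y \<in> V" and ss: "semisimple (g Y)"
    and lip: "\<And>X. X \<in> V \<Longrightarrow> norm (g X - g Y) \<le> L * norm (X - Y)"
    and eq: "\<And>X x. X \<in> V \<Longrightarrow> char_fun (g X) x = char_fun X x"
  shows "semisimple Y"
proof -
  obtain bs f S where J: "jordan_form Y bs f S" using jordan_form_exists[of Y] by (elim exE)
  have lev: "snd (f i) = 0" for i
  proof (rule ccontr)
    assume "snd (f i) \<noteq> 0"
    from jordan_chain_perturbation[OF J this]
    obtain \<mu> M where eigen: "\<forall>s. \<mu> + s \<in> spectrum (Y + mat_scale (s ^ 2) M)" by (elim exE)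
    obtain S' D :: "complex^'n^'n" where S': "invertible S'" "g Y ** S' = S' ** D" "\<forall>i j. i \<noteq> j \<longrightarrow> D $ i $ j = 0"
      using semisimple_diagonal_form[OF ss] by (elim exE conjE)
    have "\<exists>\<kappa>\<ge>0. \<forall>X. \<forall>x\<in>spectrum X. \<exists>i. cmod (x - D $ i $ i) \<le> \<kappa> * norm (X - g Y)"
      by (rule bauer_fike[OF S'(2,1)]) (simp add: S'(3))
    then obtain \<kappa> where \<kappa>0: "0 \<le> \<kappa>" and \<kappa>: "\<forall>X. \<forall>x\<in>spectrum X. \<exists>i. cmod (x - D $ i $ i) \<le> \<kappa> * norm (X - g Y)"
      by (elim exE conjE)
    obtain \<delta> where \<delta>: "\<delta> > 0" "\<And>d. d \<in> range (\<lambda>i. D $ i $ i) \<Longrightarrow> d \<noteq> \<mu> \<Longrightarrow> \<delta> \<le> cmod (\<mu> - d)"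
      by (rule finite_set_separated_from_point[of "range (\<lambda>i. D $ i $ i)" \<mu>]) simp_all
    obtain r where r: "r > 0" "ball Y r \<subseteq> V" using V Y open_contains_ball by blast
    define C where "C = \<kappa> * (\<bar>L\<bar> * norm M)"
    have C0: "0 \<le> C" using \<kappa>0 by (simp add: C_def)
    have n1: "0 < norm M + 1" using norm_ge_zero[of M] by linarith
    have "0 < min (min 1 (r / (norm M + 1))) (min (\<delta> / 4) (1 / (2 * (C + 1))))"
      using r \<delta>(1) C0 n1 by simp
    from dense[OF this] obtain s where s0: "0 < s"
      and s_less: "s < min (min 1 (r / (norm M + 1))) (min (\<delta> / 4) (1 / (2 * (C + 1))))" by (elim exE conjE)
    from s_less have s1: "s < 1" "s < r / (norm M + 1)" "s < \<delta> / 4" "s < 1 / (2 * (C + 1))"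
      by (simp_all only: min_less_iff_conj)
    have ss: "s ^ 2 \<le> s" using s0 s1(1) by (simp add: power2_eq_square)
    define X where "X = Y + mat_scale (of_real s ^ 2) M"
    have nX: "norm (X - Y) = s ^ 2 * norm M" by (simp add: X_def norm_mat_scale norm_power)
    have "s ^ 2 * norm M \<le> s * (norm M + 1)" using ss s0 by (intro mult_mono) auto
    also have "\<dots> < r" using s1(2) n1 by (simp add: pos_less_divide_eq)
    finally have XV: "X \<in> V" using r(2) nX by (auto simp: subset_iff dist_norm norm_minus_commute)
    have "\<mu> + of_real s \<in> spectrum X" unfolding X_def by (rule eigen[rule_format])
    then have "\<mu> + of_real s \<in> spectrum (g X)" by (simp only: char_fun_eq_0_iff[symmetric] eq[OF XV])
    from \<kappa>[THEN spec, THEN bspec, OF this] obtain k where k: "cmod (\<mu> + of_real s - D $ k $ k) \<le> \<kappa> * norm (g X - g Y)"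
      by (elim exE)
    have "norm (g X - g Y) \<le> \<bar>L\<bar> * norm (X - Y)"
      by (rule order_trans[OF lip[OF XV]]) (simp add: mult_right_mono)
    then have "\<kappa> * norm (g X - g Y) \<le> \<kappa> * (\<bar>L\<bar> * norm (X - Y))" using \<kappa>0 by (rule mult_left_mono)
    also have "\<dots> = C * s ^ 2" by (simp add: nX C_def)
    finally have le: "cmod (\<mu> + of_real s - D $ k $ k) \<le> C * s ^ 2" using k by linarith
    have "s * (2 * (C + 1)) < 1" using s1(4) C0 by (simp add: pos_less_divide_eq)
    moreover have "s * (2 * (C + 1)) = 2 * (C * s) + 2 * s" by (simp add: algebra_simps)
    ultimately have "C * s < 1" using s0 by linarith
    then have "(C * s) * s < 1 * s" using s0 by (intro mult_strict_right_mono)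
    then have half: "C * s ^ 2 < s" by (simp add: power2_eq_square mult.assoc)
    show False
    proof (cases "D $ k $ k = \<mu>")
      case True
      then show False using le half s0 by simp
    next
      case False
      then have "\<delta> \<le> cmod (\<mu> - D $ k $ k)" by (intro \<delta>(2)) auto
      also have "\<dots> \<le> cmod (\<mu> + of_real s - D $ k $ k) + cmod (of_real s)"
        using norm_triangle_ineq4[of "\<mu> + of_real s - D $ k $ k" "of_real s"] by simp
      also have "\<dots> \<le> s + s" using le half s0 by simp
      finally show False using s1(3) \<delta>(1) by linarith
    qed
  qed
  define a where "a = (\<lambda>j. snd (bs ! fst (f j)))"
  note D = jordan_formD[OF J, folded a_def]
  have "semisimple (band a f)"
  proof (rule semisimple_band[OF D(1)])
    fix i j assume "fst (f i) = fst (f j)"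
    then have "f i = f j" by (simp add: prod_eq_iff lev)
    then show "i = j" by (rule injD[OF D(1)])
  qed
  then show ?thesis by (rule semisimple_conjugate[OF _ D(4)])
qed

section \<open>Semicontinuity of the Jordan structure\<close>

text \<open>
There are fewer equations than unknowns. As a square system: the conditions \<open>c $ i = 0\<close> occupy the
rows outside \<open>A\<close>, the equations for \<open>B\<close> occupy rows in \<open>A\<close>, and at least one row is left empty.
\<close>

lemma kernel_vector_with_support:
  fixes T :: "complex^'n^'n"
  assumes card: "card B < card A"
  shows "\<exists>c. c \<noteq> 0 \<and> (\<forall>i. i \<notin> A \<longrightarrow> c $ i = 0) \<and> (\<forall>j\<in>B. (T *v c) $ j = 0)"
proof -
  obtain h where h: "h ` B \<subseteq> A" "inj_on h B"
    using card_le_inj[of B A] card by (meson finite less_imp_le)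
  have "card (h ` B) < card A" using card card_image[OF h(2)] by simp
  then have "h ` B \<noteq> A" by auto
  then obtain i0 where i0: "i0 \<in> A" "i0 \<notin> h ` B" using h(1) by blast
  define M :: "complex^'n^'n" where "M = (\<chi> i k. if i \<notin> A then (if i = k then 1 else 0)
      else if i \<in> h ` B then T $ inv_into B h i $ k else 0)"
  have "row i0 M = 0" using i0 by (simp add: row_def M_def vec_eq_iff)
  then have "det M = 0" by (rule det_zero_row)
  then have "\<not> invertible M" by (simp add: invertible_det_nz)
  then obtain c where c: "c \<noteq> 0" "M *v c = 0"
    unfolding invertible_left_inverse matrix_left_invertible_ker by blast
  have row: "(\<Sum>k\<in>UNIV. M $ i $ k * c $ k) = 0" for i
    using arg_cong[OF c(2), of "\<lambda>v. v $ i"] by (simp add: matrix_vector_mult_def)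
  have "c $ i = 0" if "i \<notin> A" for i
    using row[of i] that by (simp add: M_def if_distrib[of "\<lambda>a. a * _"] cong: if_cong)
  moreover have "(T *v c) $ j = 0" if j: "j \<in> B" for j
  proof -
    have "h j \<in> A" "h j \<in> h ` B" "inv_into B h (h j) = j" using j h by (auto simp: inv_into_f_f)
    then show ?thesis using row[of "h j"] by (simp add: M_def matrix_vector_mult_def)
  qed
  ultimately show ?thesis using c(1) by (intro exI[of _ c]) simp
qed

text \<open>
The product of \<open>X - \<mu> - j * \<epsilon>\<close> over \<open>j < k\<close>. For \<open>\<epsilon> = 0\<close> it is the power whose kernel has the
dimension given by the number of cells of level below \<open>k\<close> for \<open>\<mu>\<close>. For \<open>\<epsilon> \<noteq> 0\<close> it has a kernel at least as large when the
eigenvalue of each cell has been moved by \<open>\<epsilon>\<close> times its level.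
\<close>

primrec shift_prod :: "complex \<Rightarrow> complex \<Rightarrow> nat \<Rightarrow> complex^'n^'n \<Rightarrow> complex^'n^'n" where
  "shift_prod \<mu> \<epsilon> 0 X = Finite_Cartesian_Product.mat 1"
| "shift_prod \<mu> \<epsilon> (Suc k) X = shift_prod \<mu> \<epsilon> k X ** shifted X (\<mu> + of_nat k * \<epsilon>)"

lemma shift_prod_conjugate:
  fixes X S T :: "complex^'n^'n"
  assumes "S ** T = mat 1" "T ** S = mat 1"
  shows "shift_prod \<mu> \<epsilon> k (S ** X ** T) = S ** shift_prod \<mu> \<epsilon> k X ** T"
proof (induction k)
  case (Suc k)
  have "shift_prod \<mu> \<epsilon> (Suc k) (S ** X ** T) =
      S ** shift_prod \<mu> \<epsilon> k X ** (T ** S) ** shifted X (\<mu> + of_nat k * \<epsilon>) ** T"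
    by (simp only: shift_prod.simps Suc.IH shifted_conjugate[OF assms(1)] matrix_mul_assoc)
  then show ?case by (simp add: assms(2) matrix_mul_assoc)
qed (simp add: assms)

lemma tendsto_shift_prod:
  fixes X :: "'a \<Rightarrow> complex^'n^'n"
  assumes "(X \<longlongrightarrow> Y) F" "(e \<longlongrightarrow> \<epsilon>) F"
  shows "((\<lambda>z. shift_prod \<mu> (e z) k (X z)) \<longlongrightarrow> shift_prod \<mu> \<epsilon> k Y) F"
proof (induction k)
  case (Suc k)
  show ?case
    unfolding shift_prod.simps shifted_def
    by (intro tendsto_matrix_mult Suc.IH tendsto_diff tendsto_mat tendsto_add tendsto_mult tendsto_const assms)
qed simp

text \<open>
The last factor annihilates level \<open>k\<close>, where the diagonal entry is \<open>\<mu> + k * \<epsilon>\<close>, up to a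
contribution to the level below; induction on \<open>k\<close> handles the rest.
\<close>

lemma shift_prod_kills_low_levels:
  fixes f :: "'n::finite \<Rightarrow> nat \<times> nat" and v :: "complex^'n"
  assumes f: "inj f" and a: "\<And>j. a j = h (fst (f j)) + of_nat (snd (f j)) * \<epsilon>"
    and v: "\<And>j. \<not> (h (fst (f j)) = \<mu> \<and> snd (f j) < k) \<Longrightarrow> v $ j = 0"
  shows "shift_prod \<mu> \<epsilon> k (band a f) *v v = 0"
  using v
proof (induction k arbitrary: v)
  case 0
  then have "v = 0" by (simp add: vec_eq_iff)
  then show ?case by simp
next
  case (Suc k)
  define y where "y = shifted (band a f) (\<mu> + of_nat k * \<epsilon>) *v v"
  have "shift_prod \<mu> \<epsilon> k (band a f) *v y = 0"
  proof (rule Suc.IH)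
    fix i assume i: "\<not> (h (fst (f i)) = \<mu> \<and> snd (f i) < k)"
    have yi: "y $ i = (band a f *v v) $ i - (\<mu> + of_nat k * \<epsilon>) * v $ i"
      unfolding y_def by (rule shifted_mult_vec)
    have "(band a f *v v) $ i = a i * v $ i"
    proof (cases "\<exists>j. f j = (fst (f i), Suc (snd (f i)))")
      case True
      then obtain j where j: "f j = (fst (f i), Suc (snd (f i)))" by (elim exE)
      have "v $ j = 0" by (rule Suc.prems) (use i j in auto)
      then show ?thesis using band_mult_vec(1)[OF f j, of i a v] by simp
    next
      case False
      then show ?thesis by (intro band_mult_vec(2)[OF f]) simp
    qed
    moreover have "v $ i = 0 \<or> a i = \<mu> + of_nat k * \<epsilon>"
    proof (cases "h (fst (f i)) = \<mu> \<and> snd (f i) = k")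
      case True
      then show ?thesis by (simp add: a)
    next
      case False
      then have "v $ i = 0" by (intro Suc.prems) (use i in auto)
      then show ?thesis ..
    qed
    ultimately show "y $ i = 0" unfolding yi by auto
  qed
  then show ?case by (simp add: y_def matrix_vector_mul_assoc)
qed

text \<open>
In blocks with another eigenvalue \<open>band_block_zero\<close> applies. In a block for \<open>\<mu>\<close> each factor moves
the coordinates down by one level, so a coordinate of level \<open>k\<close> or more cannot be lost.
\<close>

lemma shift_prod_kernel_low_levels:
  fixes f :: "'n::finite \<Rightarrow> nat \<times> nat" and x :: "complex^'n"
  assumes f: "inj f" and a: "\<And>j. a j = h (fst (f j))"
    and pred: "\<And>j p l. f j = (p, Suc l) \<Longrightarrow> \<exists>i. f i = (p, l)"
    and x: "shift_prod \<mu> 0 k (band a f) *v x = 0"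
    and j: "\<not> (h (fst (f j)) = \<mu> \<and> snd (f j) < k)"
  shows "x $ j = 0"
  using x j
proof (induction k arbitrary: x j)
  case (Suc k)
  define y where "y = shifted (band a f) \<mu> *v x"
  have yi: "y $ i = (band a f *v x) $ i - \<mu> * x $ i" for i
    unfolding y_def by (rule shifted_mult_vec)
  have "shift_prod \<mu> 0 k (band a f) *v y = 0"
    using Suc.prems(1) by (simp add: y_def matrix_vector_mul_assoc)
  note y0 = Suc.IH[OF this]
  obtain p l where fj: "f j = (p, l)" by force
  show ?case
  proof (cases "h p = \<mu>")
    case False
    show ?thesis
    proof (rule band_block_zero[OF f fj le0, where \<mu> = \<mu> and a = a])
      fix i m assume i: "f i = (p, m)"
      have "y $ i = 0" by (rule y0) (simp add: i False)
      then show "((band a f *v x) $ i = \<mu> * x $ i \<and> a i \<noteq> \<mu>) \<or> x $ i = 0"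
        using False by (simp add: yi a i)
    qed
  next
    case True
    then have "Suc k \<le> l" using Suc.prems(2) fj by simp
    then obtain m where m: "l = Suc m" "k \<le> m" by (cases l) auto
    have fj': "f j = (p, Suc m)" using fj m by simp
    from pred[OF this] obtain i where i: "f i = (p, m)" by (elim exE)
    have "y $ i = 0" by (rule y0) (use i m in simp)
    then show ?thesis using band_mult_vec(1)[OF f fj' i, of a x] True by (simp add: yi a i)
  qed
qed simp

lemma of_real_vector_scale: "complex_of_real r *s v = r *\<^sub>R (v :: complex^'n)"
  by (simp add: vec_eq_iff scaleR_conv_of_real[where 'a = complex])

text \<open>
Approximate \<open>W\<close> by semisimple matrices: in a Jordan basis, move the eigenvalue of each cell by
\<open>\<epsilon>\<close> times its level. For these matrices \<open>shift_prod \<mu> \<epsilon> k\<close> annihilates a space whose dimension is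
the number of cells on the left, and conjugation carries it to such a space for \<open>\<Phi> (Z \<epsilon>)\<close>. If the
count on the right were smaller, each of these spaces would contain a unit vector without
coordinates in the corresponding cells of \<open>\<Phi> W\<close>. A limit of these vectors lies in the kernel of
\<open>shift_prod \<mu> 0 k (\<Phi> W)\<close>, which is spanned by these cells.
\<close>

lemma level_count_le:
  fixes W :: "complex^'n^'n"
  assumes J: "jordan_form W bs f S" and J': "jordan_form (\<Phi> W) bs' f' S'"
    and U: "open U" "W \<in> U" and cont: "isCont \<Phi> W"
    and ss: "\<And>X. X \<in> U \<Longrightarrow> semisimple X \<Longrightarrow> conjugate_mat X (\<Phi> X)"
  shows "card {i. snd (bs ! fst (f i)) = \<mu> \<and> snd (f i) < k} \<le> card {i. snd (bs' ! fst (f' i)) = \<mu> \<and> snd (f' i) < k}"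
    (is "card ?A \<le> card ?B")
proof (rule ccontr)
  assume "\<not> card ?A \<le> card ?B"
  then have less: "card ?B < card ?A" by simp
  note D = jordan_formD[OF J] and D' = jordan_formD[OF J']
  obtain T where T: "S ** T = mat 1" "T ** S = mat 1" using D(2) unfolding invertible_def by (elim exE conjE)
  obtain T' where T': "S' ** T' = mat 1" "T' ** S' = mat 1" using D'(2) unfolding invertible_def by (elim exE conjE)
  define a' where "a' = (\<lambda>j. snd (bs' ! fst (f' j)))"
  define a where "a \<epsilon> = (\<lambda>j. snd (bs ! fst (f j)) + of_nat (snd (f j)) * \<epsilon>)" for \<epsilon> :: complex
  define Z where "Z \<epsilon> = S ** band (a \<epsilon>) f ** T" for \<epsilon>
  define e where "e m = inverse (complex_of_nat (Suc m))" for m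
  have e0: "e m \<noteq> 0" for m unfolding e_def by (simp del: of_nat_Suc)
  have elim: "e \<longlonglongrightarrow> 0"
    unfolding e_def[abs_def] by (rule LIMSEQ_Suc[OF lim_inverse_n])
  have a_lim: "(\<lambda>m. a (e m) j) \<longlonglongrightarrow> snd (bs ! fst (f j))" for j
  proof -
    have "(\<lambda>m. a (e m) j) \<longlonglongrightarrow> snd (bs ! fst (f j)) + of_nat (snd (f j)) * 0"
      unfolding a_def by (intro tendsto_intros elim)
    then show ?thesis by simp
  qed
  have "(\<lambda>m. band (a (e m)) f) \<longlonglongrightarrow> band (\<lambda>j. snd (bs ! fst (f j))) f"
  proof (intro vec_tendstoI)
    fix i j
    show "(\<lambda>m. band (a (e m)) f $ i $ j) \<longlonglongrightarrow> band (\<lambda>j. snd (bs ! fst (f j))) f $ i $ j"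
      using a_lim[of j] by (simp add: band_def)
  qed
  then have "(\<lambda>m. Z (e m)) \<longlonglongrightarrow> S ** band (\<lambda>j. snd (bs ! fst (f j))) f ** T"
    unfolding Z_def by (intro tendsto_matrix_mult tendsto_const)
  also have "S ** band (\<lambda>j. snd (bs ! fst (f j))) f ** T = W ** (S ** T)"
    by (simp only: D(3)[symmetric] matrix_mul_assoc)
  finally have Zlim: "(\<lambda>m. Z (e m)) \<longlonglongrightarrow> W" by (simp add: T)
  have Zss: "semisimple (Z (e m))" for m
  proof (rule semisimple_conjugate)
    show "conjugate_mat (band (a (e m)) f) (Z (e m))" by (rule conjugate_matI[OF T]) (simp add: Z_def)
    show "semisimple (band (a (e m)) f)"
    proof (rule semisimple_band[OF D(1)])
      fix i j assume ij: "fst (f i) = fst (f j)" "a (e m) i = a (e m) j"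
      then have "snd (f i) = snd (f j)" using e0[of m] by (simp add: a_def)
      with ij(1) have "f i = f j" by (simp add: prod_eq_iff)
      then show "i = j" by (rule injD[OF D(1)])
    qed
  qed
  have "eventually (\<lambda>m. Z (e m) \<in> U) sequentially" by (rule topological_tendstoD[OF Zlim U])
  then obtain m0 where m0: "\<And>m. m \<ge> m0 \<Longrightarrow> Z (e m) \<in> U" unfolding eventually_sequentially by blast
  define E where "E m = e (m + m0)" for m
  have Elim: "E \<longlonglongrightarrow> 0" unfolding E_def by (rule LIMSEQ_ignore_initial_segment[OF elim])
  have ZElim: "(\<lambda>m. Z (E m)) \<longlonglongrightarrow> W" unfolding E_def by (rule LIMSEQ_ignore_initial_segment[OF Zlim])
  have "\<exists>w. norm w = 1 \<and> shift_prod \<mu> (E m) k (\<Phi> (Z (E m))) *v w = 0 \<and> (\<forall>j\<in>?B. (T' *v w) $ j = 0)" for m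
  proof -
    have "conjugate_mat (Z (E m)) (\<Phi> (Z (E m)))" unfolding E_def by (intro ss m0 Zss) simp
    then obtain R Q where R: "R ** Q = mat 1" "Q ** R = mat 1" "\<Phi> (Z (E m)) = R ** Z (E m) ** Q"
      by (rule conjugate_matE)
    from kernel_vector_with_support[OF less, of "T' ** R ** S"]
    obtain c where c: "c \<noteq> 0" "\<forall>i. i \<notin> ?A \<longrightarrow> c $ i = 0" "\<forall>j\<in>?B. (T' ** R ** S *v c) $ j = 0"
      by (elim exE conjE)
    define w where "w = R *v (S *v c)"
    have cw: "c = T *v (Q *v w)"
    proof -
      have "T *v (Q *v w) = (T ** (Q ** R) ** S) *v c" by (simp only: w_def matrix_vector_mul_assoc matrix_mul_assoc)
      then show ?thesis by (simp add: R T)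
    qed
    have w0: "w \<noteq> 0" using c(1) cw by auto
    have kill: "shift_prod \<mu> (E m) k (band (a (E m)) f) *v c = 0"
      by (rule shift_prod_kills_low_levels[OF D(1), where h = "\<lambda>p. snd (bs ! p)"]) (use c(2) in \<open>simp_all add: a_def\<close>)
    have zz: "shift_prod \<mu> (E m) k (Z (E m)) = S ** shift_prod \<mu> (E m) k (band (a (E m)) f) ** T"
      unfolding Z_def by (rule shift_prod_conjugate[OF T])
    have sp: "shift_prod \<mu> (E m) k (\<Phi> (Z (E m))) =
        R ** (S ** shift_prod \<mu> (E m) k (band (a (E m)) f) ** T) ** Q"
      by (simp only: R(3) shift_prod_conjugate[OF R(1,2)] zz)
    have "shift_prod \<mu> (E m) k (\<Phi> (Z (E m))) *v w = R *v (S *v (shift_prod \<mu> (E m) k (band (a (E m)) f) *v c))"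
      unfolding sp cw by (simp only: matrix_vector_mul_assoc matrix_mul_assoc)
    then have 1: "shift_prod \<mu> (E m) k (\<Phi> (Z (E m))) *v w = 0" by (simp only: kill matrix_vector_mult_0_right)
    have 2: "(T' *v w) $ j = 0" if "j \<in> ?B" for j
      using c(3) that by (simp only: w_def matrix_vector_mul_assoc matrix_mul_assoc)
    define z where "z = complex_of_real (1 / norm w) *s w"
    have "norm z = 1" using w0 unfolding z_def of_real_vector_scale by simp
    moreover have "shift_prod \<mu> (E m) k (\<Phi> (Z (E m))) *v z = 0"
      unfolding z_def by (simp only: vector_scalar_commute 1 vector_smult_rzero)
    moreover have "\<forall>j\<in>?B. (T' *v z) $ j = 0"
      unfolding z_def by (simp only: vector_scalar_commute vector_smult_component) (use 2 in simp)
    ultimately show ?thesis by (intro exI conjI)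
  qed
  then have "\<forall>m. \<exists>w. norm w = 1 \<and> shift_prod \<mu> (E m) k (\<Phi> (Z (E m))) *v w = 0 \<and> (\<forall>j\<in>?B. (T' *v w) $ j = 0)"
    by (intro allI)
  from choice[OF this] obtain w where w: "\<forall>m. norm (w m) = 1 \<and>
      shift_prod \<mu> (E m) k (\<Phi> (Z (E m))) *v w m = 0 \<and> (\<forall>j\<in>?B. (T' *v w m) $ j = 0)" by (elim exE)
  have "bounded (range w)" unfolding bounded_iff using w by (intro exI[of _ 1]) auto
  from bounded_imp_convergent_subsequence[OF this]
  obtain l r where r: "strict_mono r" "(w \<circ> r) \<longlonglongrightarrow> l" by (elim exE conjE)
  have wl: "(\<lambda>m. w (r m)) \<longlonglongrightarrow> l" using r(2) by (simp only: o_def)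
  have "(\<lambda>m. norm (w (r m))) \<longlonglongrightarrow> norm l" by (rule tendsto_norm[OF wl])
  then have nl: "norm l = 1" using w by (simp add: LIMSEQ_const_iff)
  have El: "(\<lambda>m. E (r m)) \<longlonglongrightarrow> 0" using LIMSEQ_subseq_LIMSEQ[OF Elim r(1)] by (simp only: o_def)
  have Zl: "(\<lambda>m. Z (E (r m))) \<longlonglongrightarrow> W" using LIMSEQ_subseq_LIMSEQ[OF ZElim r(1)] by (simp only: o_def)
  have "(\<lambda>m. shift_prod \<mu> (E (r m)) k (\<Phi> (Z (E (r m)))) *v w (r m)) \<longlonglongrightarrow> shift_prod \<mu> 0 k (\<Phi> W) *v l"
    by (intro tendsto_matrix_vector_mult tendsto_shift_prod isCont_tendsto_compose[OF cont Zl] El wl)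
  then have ker: "shift_prod \<mu> 0 k (\<Phi> W) *v l = 0" using w by (simp add: LIMSEQ_const_iff)
  have supp: "(T' *v l) $ j = 0" if "j \<in> ?B" for j
  proof -
    have "(\<lambda>m. (T' *v w (r m)) $ j) \<longlonglongrightarrow> (T' *v l) $ j"
      by (intro tendsto_vec_nth tendsto_matrix_vector_mult tendsto_const wl)
    then show ?thesis using w that by (simp add: LIMSEQ_const_iff)
  qed
  have "\<Phi> W = \<Phi> W ** (S' ** T')" by (simp add: T')
  then have Yb: "\<Phi> W = S' ** band a' f' ** T'" by (simp only: D'(3)[folded a'_def] matrix_mul_assoc)
  define x where "x = T' *v l"
  have l: "l = S' *v x" by (simp add: x_def matrix_vector_mul_assoc T')
  have "shift_prod \<mu> 0 k (\<Phi> W) = S' ** shift_prod \<mu> 0 k (band a' f') ** T'"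
    unfolding Yb by (rule shift_prod_conjugate[OF T'])
  then have "T' *v (shift_prod \<mu> 0 k (\<Phi> W) *v l) = (T' ** S') *v (shift_prod \<mu> 0 k (band a' f') *v x)"
    by (simp only: x_def matrix_vector_mul_assoc matrix_mul_assoc)
  then have kx: "shift_prod \<mu> 0 k (band a' f') *v x = 0" by (simp add: ker T')
  have "x $ j = 0" for j
  proof (cases "j \<in> ?B")
    case True
    then show ?thesis unfolding x_def by (rule supp)
  next
    case False
    show ?thesis
    proof (rule shift_prod_kernel_low_levels[OF D'(1) _ _ kx, where h = "\<lambda>p. snd (bs' ! p)"])
      show "a' j = snd (bs' ! fst (f' j))" for j by (simp add: a'_def)
      show "\<exists>i. f' i = (p, l)" if succ: "f' j = (p, Suc l)" for j p l
      proof -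
        obtain i where "f' i = (p, l)" by (rule cell_predecessor[OF J' succ, of l]) simp
        then show ?thesis by (rule exI)
      qed
      show "\<not> (snd (bs' ! fst (f' j)) = \<mu> \<and> snd (f' j) < k)" using False by simp
    qed
  qed
  then have "x = 0" by (simp add: vec_eq_iff)
  then have "l = 0" unfolding l by simp
  then show False using nl by simp
qed

section \<open>Jordan blocks from level counts\<close>

definition cell_count :: "(nat \<times> complex) list \<Rightarrow> complex \<Rightarrow> nat \<Rightarrow> nat" where
  "cell_count bs \<mu> k = (\<Sum>b\<leftarrow>bs. if snd b = \<mu> then min (fst b) k else 0)"

lemma card_low_level_cells:
  assumes f: "bij_betw f UNIV (cells bs)"
  shows "card {i. snd (bs ! fst (f i)) = \<mu> \<and> snd (f i) < k} = cell_count bs \<mu> k"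
proof -
  define Q where "Q p = {l. l < fst (bs ! p) \<and> snd (bs ! p) = \<mu> \<and> l < k}" for p
  have Q: "card (Q p) = (if snd (bs ! p) = \<mu> then min (fst (bs ! p)) k else 0)" for p
  proof (cases "snd (bs ! p) = \<mu>")
    case True
    then have "Q p = {..<min (fst (bs ! p)) k}" by (auto simp: Q_def)
    then show ?thesis using True by simp
  next
    case False
    then show ?thesis by (simp add: Q_def)
  qed
  have fin: "finite (Q p)" for p by (rule finite_subset[of _ "{..<k}"]) (auto simp: Q_def)
  have inj: "inj f" and surj: "f ` UNIV = cells bs" using f by (simp_all add: bij_betw_def)
  have "f ` {i. snd (bs ! fst (f i)) = \<mu> \<and> snd (f i) < k} = {c \<in> cells bs. snd (bs ! fst c) = \<mu> \<and> snd c < k}"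
    unfolding surj[symmetric] by blast
  also have "\<dots> = Sigma {0..<length bs} Q" by (auto simp: cells_def Q_def)
  finally have "card (f ` {i. snd (bs ! fst (f i)) = \<mu> \<and> snd (f i) < k}) = card (Sigma {0..<length bs} Q)" by simp
  also have "\<dots> = (\<Sum>p = 0..<length bs. card (Q p))" using fin by (simp add: card_SigmaI)
  also have "\<dots> = cell_count bs \<mu> k" by (simp add: cell_count_def Q sum_list_sum_nth)
  finally show ?thesis using card_image[OF inj_on_subset[OF inj subset_UNIV]] by simp
qed

text \<open>
The function \<open>min s\<close> has a single kink, at \<open>s\<close>, so second differences of the counts isolate the
blocks of a given size.
\<close>

lemma cell_count_second_difference:
  "cell_count bs \<mu> k + cell_count bs \<mu> (k + 2) + count (mset bs) (Suc k, \<mu>) = 2 * cell_count bs \<mu> (Suc k)"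
proof (induction bs)
  case (Cons b bs)
  obtain s \<nu> where b: "b = (s, \<nu>)" by force
  have "min s k + min s (k + 2) + (if s = Suc k then 1 else 0) = 2 * min s (Suc k)" by (auto simp: min_def)
  then show ?case using Cons.IH by (cases "\<nu> = \<mu>") (auto simp: cell_count_def b split: if_splits)
qed (simp add: cell_count_def)

lemma mset_eq_of_cell_count_eq:
  assumes pos: "\<forall>b\<in>set bs. 0 < fst b" "\<forall>b\<in>set bs'. 0 < fst b"
    and eq: "\<And>\<mu> k. cell_count bs \<mu> k = cell_count bs' \<mu> k"
  shows "mset bs = mset bs'"
proof (rule multiset_eqI)
  fix b :: "nat \<times> complex"
  obtain s \<mu> where b: "b = (s, \<mu>)" by force
  show "count (mset bs) b = count (mset bs') b"
  proof (cases s)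
    case 0
    then have "b \<notin> set bs" "b \<notin> set bs'" using pos b by auto
    then show ?thesis by (simp add: count_eq_zero_iff[THEN iffD2])
  next
    case (Suc k)
    show ?thesis
      using cell_count_second_difference[of bs \<mu> k] cell_count_second_difference[of bs' \<mu> k]
      unfolding eq b Suc by linarith
  qed
qed

text \<open>
A permutation of the blocks induces a permutation of the cells, and thus a relabelling of the
basis.
\<close>

lemma jordan_form_conjugate:
  fixes W Y :: "complex^'n^'n"
  assumes J: "jordan_form W bs f S" and J': "jordan_form Y bs' f' S'" and eq: "mset bs = mset bs'"
  shows "conjugate_mat W Y"
proof -
  note D = jordan_formD[OF J] and D' = jordan_formD[OF J']
  obtain \<pi> where \<pi>: "\<pi> permutes {..<length bs'}" "permute_list \<pi> bs' = bs"
    by (rule mset_eq_permutation[OF eq])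
  have len: "length bs = length bs'" using eq by (rule mset_eq_length)
  have nth: "bs ! p = bs' ! \<pi> p" if "p < length bs" for p
    using permute_list_nth[OF \<pi>(1), of p] that len \<pi>(2) by simp
  have inj\<pi>: "\<pi> p = \<pi> q \<longleftrightarrow> p = q" for p q using permutes_inj[OF \<pi>(1)] by (simp add: inj_eq)
  have cellf: "f i \<in> cells bs" for i using bij_betwE[OF D(6)] by blast
  have ltf: "fst (f i) < length bs" for i using cellf[of i] by (auto simp: cells_def)
  have surj': "f' ` UNIV = cells bs'" using D'(6) by (simp add: bij_betw_def)
  have "\<forall>i. \<exists>j. f' j = (\<pi> (fst (f i)), snd (f i))"
  proof
    fix i
    have "\<pi> (fst (f i)) < length bs'"
      using permutes_in_image[OF \<pi>(1), of "fst (f i)"] ltf[of i] len by simp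
    moreover have "snd (f i) < fst (bs' ! \<pi> (fst (f i)))"
      using cellf[of i] by (simp add: cells_def case_prod_beta nth[OF ltf, symmetric])
    ultimately have "(\<pi> (fst (f i)), snd (f i)) \<in> f' ` UNIV" unfolding surj' by (simp add: cells_def)
    then show "\<exists>j. f' j = (\<pi> (fst (f i)), snd (f i))" by (elim imageE) (rule exI, rule sym)
  qed
  from choice[OF this] obtain \<sigma> where \<sigma>: "\<forall>i. f' (\<sigma> i) = (\<pi> (fst (f i)), snd (f i))" by (elim exE)
  have "inj \<sigma>"
  proof (rule injI)
    fix i j assume "\<sigma> i = \<sigma> j"
    then have "f' (\<sigma> i) = f' (\<sigma> j)" by simp
    then have "f i = f j" by (simp add: \<sigma> inj\<pi> prod_eq_iff)
    then show "i = j" by (rule injD[OF D(1)])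
  qed
  then have \<sigma>bij: "bij \<sigma>" using finite_UNIV_inj_surj[of \<sigma>] by (simp add: bij_def)
  have "conjugate_mat (band (\<lambda>j. snd (bs ! fst (f j))) f) (band (\<lambda>j. snd (bs' ! fst (f' j))) f')"
  proof (rule conjugate_mat_relabel[OF \<sigma>bij])
    fix i j
    have "\<sigma> i = \<sigma> j \<longleftrightarrow> i = j" using \<open>inj \<sigma>\<close> by (simp add: inj_eq)
    then show "band (\<lambda>j. snd (bs ! fst (f j))) f $ i $ j = band (\<lambda>j. snd (bs' ! fst (f' j))) f' $ \<sigma> i $ \<sigma> j"
      by (simp add: band_def \<sigma> inj\<pi> nth[OF ltf])
  qed
  then show ?thesis
    by (rule conjugate_mat_trans[OF conjugate_mat_trans[OF conjugate_mat_sym[OF D(4)]] D'(4)])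
qed

section \<open>Conjugacy\<close>

text \<open>
Both maps reflect semisimplicity, hence both preserve it, and semisimple matrices are conjugate to
their images because the characteristic polynomials agree. Semicontinuity of the level counts for
\<open>\<Phi>\<close> and for its inverse gives equality of the counts at an arbitrary \<open>W\<close>.
\<close>

theorem conjugate_of_bilipschitz_char_fun_preserving:
  fixes \<Phi> \<Gamma> :: "complex^'n^'n \<Rightarrow> complex^'n^'n"
  assumes U: "open U" and V: "open V" and \<Phi>: "\<And>X. X \<in> U \<Longrightarrow> \<Phi> X \<in> V" and \<Gamma>: "\<And>X. X \<in> V \<Longrightarrow> \<Gamma> X \<in> U"
    and \<Gamma>\<Phi>: "\<And>X. X \<in> U \<Longrightarrow> \<Gamma> (\<Phi> X) = X" and \<Phi>\<Gamma>: "\<And>X. X \<in> V \<Longrightarrow> \<Phi> (\<Gamma> X) = X"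
    and lip\<Phi>: "\<And>X Y. X \<in> U \<Longrightarrow> Y \<in> U \<Longrightarrow> norm (\<Phi> X - \<Phi> Y) \<le> L * norm (X - Y)"
    and lip\<Gamma>: "\<And>X Y. X \<in> V \<Longrightarrow> Y \<in> V \<Longrightarrow> norm (\<Gamma> X - \<Gamma> Y) \<le> L * norm (X - Y)"
    and eq: "\<And>X x. X \<in> U \<Longrightarrow> char_fun (\<Phi> X) x = char_fun X x"
    and W: "W \<in> U"
  shows "conjugate_mat W (\<Phi> W)"
proof -
  have eq': "char_fun (\<Gamma> X) x = char_fun X x" if "X \<in> V" for X x
    using eq[OF \<Gamma>[OF that], of x] by (simp add: \<Phi>\<Gamma>[OF that])
  have cont: "isCont h X"
    if N: "open N" "X \<in> N" and h: "\<And>Y. Y \<in> N \<Longrightarrow> norm (h Y - h X) \<le> L * norm (Y - X)"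
    for h :: "complex^'n^'n \<Rightarrow> complex^'n^'n" and N X
  proof -
    have lim: "((\<lambda>Y. L * norm (Y - X)) \<longlongrightarrow> L * norm (X - X)) (at X)" by (intro tendsto_intros)
    have "eventually (\<lambda>Y. Y \<in> N) (at X)" by (rule eventually_at_in_open'[OF N])
    then have "eventually (\<lambda>Y. norm (h Y - h X) \<le> L * norm (Y - X)) (at X)"
      by eventually_elim (rule h)
    then have "((\<lambda>Y. h Y - h X) \<longlongrightarrow> 0) (at X)"
      by (rule Lim_null_comparison) (use lim in simp)
    then show ?thesis unfolding isCont_def by (simp add: LIM_zero_iff)
  qed
  have ss\<Phi>: "semisimple (\<Phi> X)" if "X \<in> U" "semisimple X" for X
  proof (rule semisimple_reflected[OF V \<Phi>[OF that(1)], where g = \<Gamma> and L = L])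
    show "semisimple (\<Gamma> (\<Phi> X))" using that by (simp add: \<Gamma>\<Phi>)
  qed (intro lip\<Gamma> \<Phi> that(1) eq'; assumption)+
  have ss\<Gamma>: "semisimple (\<Gamma> X)" if "X \<in> V" "semisimple X" for X
  proof (rule semisimple_reflected[OF U \<Gamma>[OF that(1)], where g = \<Phi> and L = L])
    show "semisimple (\<Phi> (\<Gamma> X))" using that by (simp add: \<Phi>\<Gamma>)
  qed (intro lip\<Phi> \<Gamma> that(1) eq; assumption)+
  have conj\<Phi>: "conjugate_mat X (\<Phi> X)" if "X \<in> U" "semisimple X" for X
    by (rule semisimple_char_fun_eq_conjugate[OF that(2) ss\<Phi>[OF that]]) (rule eq[OF that(1), symmetric])
  have conj\<Gamma>: "conjugate_mat X (\<Gamma> X)" if "X \<in> V" "semisimple X" for X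
    by (rule semisimple_char_fun_eq_conjugate[OF that(2) ss\<Gamma>[OF that]]) (rule eq'[OF that(1), symmetric])
  obtain bs f S where J: "jordan_form W bs f S" using jordan_form_exists[of W] by (elim exE)
  obtain bs' f' S' where J': "jordan_form (\<Phi> W) bs' f' S'" using jordan_form_exists[of "\<Phi> W"] by (elim exE)
  have J2: "jordan_form (\<Gamma> (\<Phi> W)) bs f S" using J by (simp add: \<Gamma>\<Phi>[OF W])
  have "isCont \<Phi> W" by (rule cont[OF U W]) (rule lip\<Phi>[OF _ W])
  note cont\<Phi> = this
  have 1: "cell_count bs \<mu> k \<le> cell_count bs' \<mu> k" for \<mu> k
    unfolding card_low_level_cells[OF jordan_formD(6)[OF J], symmetric]
      card_low_level_cells[OF jordan_formD(6)[OF J'], symmetric]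
    by (rule level_count_le[OF J J' U W cont\<Phi>]) (rule conj\<Phi>)
  have "isCont \<Gamma> (\<Phi> W)" by (rule cont[OF V \<Phi>[OF W]]) (rule lip\<Gamma>[OF _ \<Phi>[OF W]])
  note cont\<Gamma> = this
  have 2: "cell_count bs' \<mu> k \<le> cell_count bs \<mu> k" for \<mu> k
    unfolding card_low_level_cells[OF jordan_formD(6)[OF J], symmetric]
      card_low_level_cells[OF jordan_formD(6)[OF J'], symmetric]
    by (rule level_count_le[OF J' J2 V \<Phi>[OF W] cont\<Gamma>]) (rule conj\<Gamma>)
  have "mset bs = mset bs'"
    by (rule mset_eq_of_cell_count_eq[OF jordan_formD(5)[OF J] jordan_formD(5)[OF J']]) (rule antisym[OF 1 2])
  then show ?thesis by (rule jordan_form_conjugate[OF J J'])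
qed

theorem corollary1p4:
  fixes \<Omega> :: "complex set"
    and \<Psi> :: "complex^'n^'n \<Rightarrow> complex^'n^'n"
    and A :: "complex^'n^'n"
  assumes "2 \<le> CARD('n)"
    and "domain_in_plane \<Omega>"
    and "infinite (- \<Omega>) \<or> 2 * CARD('n) \<le> card (- \<Omega>)"
    and "\<Psi> \<in> S_n \<Omega> \<rightarrow> S_n \<Omega>"
    and "mat_holomorphic_on \<Psi> (S_n \<Omega>)"
    and "A \<in> S_n \<Omega>"
    and "\<Psi> A = A"
    and "(\<Psi> has_derivative (\<lambda>H. H)) (at A)"
    and "diagonalizable_mat A \<or> nonderogatory A"
  shows "\<exists>N. open N \<and> A \<in> N \<and> N \<subseteq> S_n \<Omega> \<and> (\<forall>W\<in>N. conjugate_mat W (\<Psi> W))"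
proof -
  have U: "open (S_n \<Omega> :: (complex^'n^'n) set)"
    by (rule open_S_n) (use assms(2) in \<open>simp add: domain_in_plane_def\<close>)
  obtain r1 where r1: "r1 > 0" "\<forall>W\<in>ball A r1. \<forall>x. char_fun (\<Psi> W) x = char_fun W x"
    using charpoly_preserved_near_fixed_point[OF U assms(5,4,6,7,8) char_fun_bounded_on_discs[OF assms(3)]]
    by (elim exE conjE)
  obtain r2 where r2: "r2 > 0" "ball A r2 \<subseteq> S_n \<Omega>"
    "\<forall>X\<in>ball A r2. \<forall>Y\<in>ball A r2. norm ((\<Psi> Y - Y) - (\<Psi> X - X)) \<le> 1/2 * norm (Y - X)"
    using holomorphic_near_identity_lipschitz[OF U assms(5-8)] by (elim exE conjE)
  define r where "r = min r1 r2"
  have r: "r > 0" "ball A r \<subseteq> ball A r1" "ball A r \<subseteq> ball A r2" using r1 r2 by (auto simp: r_def)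
  have half: "norm ((\<Psi> Y - Y) - (\<Psi> X - X)) \<le> 1/2 * norm (Y - X)" if "X \<in> ball A r" "Y \<in> ball A r" for X Y
    using r2(3) that r(3) by blast
  have lower: "norm (Y - X) \<le> 2 * norm (\<Psi> Y - \<Psi> X)" if "X \<in> ball A r" "Y \<in> ball A r" for X Y
  proof -
    have "(\<Psi> Y - \<Psi> X) - ((\<Psi> Y - Y) - (\<Psi> X - X)) = Y - X" by simp
    then have "norm (Y - X) \<le> norm (\<Psi> Y - \<Psi> X) + norm ((\<Psi> Y - Y) - (\<Psi> X - X))"
      by (metis norm_triangle_ineq4)
    then show ?thesis using half[OF that] by linarith
  qed
  have upper: "norm (\<Psi> Y - \<Psi> X) \<le> 2 * norm (Y - X)" if "X \<in> ball A r" "Y \<in> ball A r" for X Y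
  proof -
    have "((\<Psi> Y - Y) - (\<Psi> X - X)) + (Y - X) = \<Psi> Y - \<Psi> X" by simp
    then have "norm (\<Psi> Y - \<Psi> X) \<le> norm ((\<Psi> Y - Y) - (\<Psi> X - X)) + norm (Y - X)"
      by (metis norm_triangle_ineq)
    then show ?thesis using half[OF that] norm_ge_zero[of "Y - X"] by linarith
  qed
  have inj: "inj_on \<Psi> (ball A r)"
  proof (rule inj_onI)
    fix X Y assume "X \<in> ball A r" "Y \<in> ball A r" "\<Psi> X = \<Psi> Y"
    then show "X = Y" using lower[of X Y] by simp
  qed
  have "continuous_on (ball A r) \<Psi>"
  proof (rule continuous_at_imp_continuous_on, rule ballI)
    fix X assume "X \<in> ball A r"
    then have "X \<in> S_n \<Omega>" using r(3) r2(2) by blast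
    then obtain L where "(\<Psi> has_derivative L) (at X)" using assms(5) unfolding mat_holomorphic_on_def by blast
    then show "isCont \<Psi> X" by (rule has_derivative_continuous)
  qed
  then have V: "open (\<Psi> ` ball A r)" by (rule invariance_of_domain[OF _ open_ball inj])
  define \<Gamma> where "\<Gamma> = inv_into (ball A r) \<Psi>"
  have \<Gamma>: "\<Gamma> X \<in> ball A r" "\<Psi> (\<Gamma> X) = X" if "X \<in> \<Psi> ` ball A r" for X
    unfolding \<Gamma>_def using that by (rule inv_into_into, rule f_inv_into_f)
  have lip\<Gamma>: "norm (\<Gamma> X - \<Gamma> Y) \<le> 2 * norm (X - Y)" if "X \<in> \<Psi> ` ball A r" "Y \<in> \<Psi> ` ball A r" for X Y
    using lower[OF \<Gamma>(1)[OF that(2)] \<Gamma>(1)[OF that(1)]] by (simp only: \<Gamma>(2)[OF that(1)] \<Gamma>(2)[OF that(2)])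
  have "conjugate_mat W (\<Psi> W)" if W: "W \<in> ball A r" for W
  proof (rule conjugate_of_bilipschitz_char_fun_preserving[OF open_ball V _ _ _ _ _ lip\<Gamma> _ W])
    show "\<Gamma> (\<Psi> X) = X" if "X \<in> ball A r" for X unfolding \<Gamma>_def by (rule inv_into_f_f[OF inj that])
    show "norm (\<Psi> X - \<Psi> Y) \<le> 2 * norm (X - Y)" if "X \<in> ball A r" "Y \<in> ball A r" for X Y
      by (rule upper[OF that(2,1)])
    show "char_fun (\<Psi> X) x = char_fun X x" if "X \<in> ball A r" for X x using r1(2) r(2) that by blast
  qed (use \<Gamma> in auto)
  then show ?thesis using r r2(2) by (intro exI[of _ "ball A r"]) auto
qed

end
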